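(* Let $\mathcal{M}$ be a class of manipulations of a system $A$ (classical or quantum). If $M\in\mathcal{M}$ is a manipulation that takes each member of a distinguishable set $\{a_1,\dots,a_n\}$ of states of $A$ to the same state $b$, then $$\sum_{i=1}^n e^{-\delta_M(a_i\rightarrow b)/k}\;\leq\;1.$$ The result holds in both the classical and the quantum reading.
   Context: Two parallel readings. Classical: $\rho$ is a probability density with respect to Liouville measure on a phase space, $\langle F\rangle_\rho=\int F\rho$, and Hamiltonian evolution is the (Liouville-measure-preserving) flow of a possibly time-dependent Hamiltonian. Quantum: $\rho$ is a density operator on a Hilbert space, $\langle F\rangle_\rho=\mathrm{Tr}(\rho F)$, and Hamiltonian evolution is unitary evolution under a possibly time-dependent Hamiltonian. Logarithms are natural; $k>0$ is Boltzmann's constant. All Gibbs/von Neumann entropies $-k\langle\log\rho\rangle_\rho$ and energy expectation values that occur are assumed well defined and finite. States: a state of the system $A$ is a pair $a=(\rho_a,H_a)$, where $\rho_a$ is a density (operator) of $A$ and $H_a$ a Hamiltonian of $A$. A set of states is distinguishable if, classically, their densities have pairwise non-overlapping supports; in the quantum case, if their density operators are pairwise orthogonal. Manipulations: there are heat reservoirs $B_i$ with fixed internal Hamiltonians $H_{B_i}$ and temperatures $T_i>0$. A manipulation $M$ is a prescribed time-dependent Hamiltonian $H(t)$, $t\in[t_0,t_1]$, of the composite of $A$ and finitely many reservoirs $B_i$; $H(t)$ may include couplings of $A$ with the reservoirs and does not depend on the state of $A$; the reservoirs do not interact with $A$ at $t_0$. $M$ takes $a=(\rho_a,H_a)$ to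 $b=(\rho_b,H_b)$ if: the Hamiltonian of $A$ is $H_a$ at $t_0$ and $H_b$ at $t_1$; the composite starts at $t_0$ in the product of $\rho_a$ with the canonical distributions $Z_i^{-1}e^{-H_{B_i}/kT_i}$ of the reservoirs; the composite undergoes the Hamiltonian evolution given by $H(t)$; and the resulting marginal of $A$ at $t_1$ is $\rho_b$. Heat: for $M$ taking $a$ to $b$, $\langle Q_i(a\rightarrow b)\rangle_M=-\left(\langle H_{B_i}\rangle_{\rho_{B_i}(t_1)}-\langle H_{B_i}\rangle_{\rho_{B_i}(t_0)}\right)$ is the expected heat obtained by $A$ from $B_i$, where $\rho_{B_i}(t)$ is the marginal of $B_i$ at time $t$, and $\sigma_M(a\rightarrow b)=\sum_i \langle Q_i(a\rightarrow b)\rangle_M/T_i$. For a class $\mathcal{M}$ of manipulations, $\mathcal{M}(a\rightarrow b)$ is the set of $M\in\mathcal{M}$ taking $a$ to $b$, and $S_{\mathcal M}(a\rightarrow b)=\sup\{\sigma_M(a\rightarrow b): M\in\mathcal{M}(a\rightarrow b)\}$, taken in the extended reals (so it is $-\infty$ if the set is empty). Dissipation: for $M\in\mathcal{M}$ taking $a$ to $b$, $\delta_M(a\rightarrow b)=-S_{\mathcal M}(b\rightarrow a)-\sigma_M(a\rightarrow b)$ (equal to $+\infty$ if $\mathcal{M}(b\rightarrow a)$ is empty, with $e^{-\infty}=0$). *)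

theory Defs
  imports "HOL-Analysis.Analysis" "HOL-Library.Nonpos_Ints"
begin

section \<open>Notions common to the classical and the quantum reading\<close>

text \<open>
  Below, \<open>takes M a b\<close> says that the manipulation \<open>M\<close> takes the state \<open>a\<close> to the state \<open>b\<close>.
  The value \<open>sig M a\<close> is \<open>\<sigma>\<^sub>M(a \<rightarrow> b)\<close>: the manipulation and the initial state determine the
  whole evolution, hence the heats, so the target \<open>b\<close> is not an argument.
\<close>

definition max_sigma ::
  "('m \<Rightarrow> 's \<Rightarrow> 's \<Rightarrow> bool) \<Rightarrow> ('m \<Rightarrow> 's \<Rightarrow> real) \<Rightarrow> 'm set \<Rightarrow> 's \<Rightarrow> 's \<Rightarrow> ereal" where
  "max_sigma takes sig MM a b = (SUP M\<in>{M \<in> MM. takes M a b}. ereal (sig M a))"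

definition dissipation ::
  "('m \<Rightarrow> 's \<Rightarrow> 's \<Rightarrow> bool) \<Rightarrow> ('m \<Rightarrow> 's \<Rightarrow> real) \<Rightarrow> 'm set \<Rightarrow> 'm \<Rightarrow> 's \<Rightarrow> 's \<Rightarrow> ereal" where
  "dissipation takes sig MM M a b = - max_sigma takes sig MM b a - ereal (sig M a)"

definition exp_ereal :: "ereal \<Rightarrow> ereal" where
  "exp_ereal x = (case x of ereal r \<Rightarrow> ereal (exp r) | PInfty \<Rightarrow> \<infinity> | MInfty \<Rightarrow> 0)"


section \<open>Classical reading\<close>

subsection \<open>Phase spaces and Hamiltonian flows\<close>

text \<open>
  Phase spaces are described without coordinates, by the Liouville measure and the Poisson algebra
  of smooth observables. A symplectic manifold is the case where \<open>observables\<close> consists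
  of the smooth functions; \<open>{q, p} = 1\<close> is the sign convention for \<open>bracket\<close>.
  Functions live on a whole type, so only their values on the points of the phase space count
  (the congruence clause of \<open>phase_space\<close>).
\<close>

record 'x phase_space =
  liouville :: "'x measure"
  observables :: "('x \<Rightarrow> real) set"
  bracket :: "('x \<Rightarrow> real) \<Rightarrow> ('x \<Rightarrow> real) \<Rightarrow> 'x \<Rightarrow> real"

abbreviation points :: "('x, 'z) phase_space_scheme \<Rightarrow> 'x set" where
  "points P \<equiv> space (liouville P)"

definition phase_space :: "'x phase_space \<Rightarrow> bool" where
  "phase_space P \<longleftrightarrow>
     sigma_finite_measure (liouville P) \<and>
     observables P \<subseteq> borel_measurable (liouville P) \<and>
     (\<forall>x\<in>points P. \<forall>y\<in>points P. x \<noteq> y \<longrightarrow> (\<exists>f\<in>observables P. f x \<noteq> f y)) \<and>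
     (\<forall>f\<in>observables P. \<forall>g. (\<forall>x\<in>points P. g x = f x) \<longrightarrow>
        g \<in> observables P \<and>
        (\<forall>h\<in>observables P. \<forall>x\<in>points P. bracket P g h x = bracket P f h x)) \<and>
     (\<forall>c. (\<lambda>x. c) \<in> observables P) \<and>
     (\<forall>f\<in>observables P. \<forall>g\<in>observables P.
        (\<lambda>x. f x + g x) \<in> observables P \<and> (\<lambda>x. f x * g x) \<in> observables P \<and>
        bracket P f g \<in> observables P) \<and>
     (\<forall>f\<in>observables P. \<forall>g\<in>observables P. \<forall>x\<in>points P.
        bracket P f g x = - bracket P g f x) \<and>
     (\<forall>f\<in>observables P. \<forall>g\<in>observables P. \<forall>h\<in>observables P. \<forall>c. \<forall>x\<in>points P.
        bracket P (\<lambda>y. c * f y + g y) h x = c * bracket P f h x + bracket P g h x \<and>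
        bracket P (\<lambda>y. f y * g y) h x = f x * bracket P g h x + bracket P f h x * g x \<and>
        bracket P f (bracket P g h) x + bracket P g (bracket P h f) x
          + bracket P h (bracket P f g) x = 0)"

text \<open>
  Phase space of the composite of a system with the finite family of reservoirs indexed by \<open>I\<close>.
  The bracket of a composite of manifolds, being a biderivation, is determined by its values on
  observables of the components.
\<close>

definition composite_phase_space ::
  "'a phase_space \<Rightarrow> 'i set \<Rightarrow> ('i \<Rightarrow> 'b phase_space) \<Rightarrow> ('a \<times> ('i \<Rightarrow> 'b)) phase_space \<Rightarrow> bool" where
  "composite_phase_space A I B C \<longleftrightarrow>
     phase_space C \<and>
     liouville C = liouville A \<Otimes>\<^sub>M (\<Pi>\<^sub>M i\<in>I. liouville (B i)) \<and>
     (\<forall>f\<in>observables A. (\<lambda>z. f (fst z)) \<in> observables C) \<and>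
     (\<forall>i\<in>I. \<forall>f\<in>observables (B i). (\<lambda>z. f (snd z i)) \<in> observables C) \<and>
     (\<forall>f\<in>observables A. \<forall>g\<in>observables A. \<forall>z\<in>points C.
        bracket C (\<lambda>w. f (fst w)) (\<lambda>w. g (fst w)) z = bracket A f g (fst z)) \<and>
     (\<forall>i\<in>I. \<forall>f\<in>observables (B i). \<forall>g\<in>observables (B i). \<forall>z\<in>points C.
        bracket C (\<lambda>w. f (snd w i)) (\<lambda>w. g (snd w i)) z = bracket (B i) f g (snd z i)) \<and>
     (\<forall>i\<in>I. \<forall>f\<in>observables A. \<forall>g\<in>observables (B i). \<forall>z\<in>points C.
        bracket C (\<lambda>w. f (fst w)) (\<lambda>w. g (snd w i)) z = 0) \<and>
     (\<forall>i\<in>I. \<forall>j\<in>I. i \<noteq> j \<longrightarrow>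
        (\<forall>f\<in>observables (B i). \<forall>g\<in>observables (B j). \<forall>z\<in>points C.
          bracket C (\<lambda>w. f (snd w i)) (\<lambda>w. g (snd w j)) z = 0))"

text \<open>
  \<open>\<phi> t\<close> maps the phase point at time \<open>t0\<close> to the one at time \<open>t\<close>. Hamilton's equations
  \<open>df/dt = {f, H(t)}\<close> along the motion are written in integrated form, so that the Hamiltonian may
  jump in time.
\<close>

definition hamiltonian_flow ::
  "'x phase_space \<Rightarrow> (real \<Rightarrow> 'x \<Rightarrow> real) \<Rightarrow> real \<Rightarrow> real \<Rightarrow> (real \<Rightarrow> 'x \<Rightarrow> 'x) \<Rightarrow> bool" where
  "hamiltonian_flow P H t0 t1 \<phi> \<longleftrightarrow>
     (\<forall>t\<in>{t0..t1}.
        bij_betw (\<phi> t) (points P) (points P) \<and>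
        \<phi> t \<in> measurable (liouville P) (liouville P) \<and>
        inv_into (points P) (\<phi> t) \<in> measurable (liouville P) (liouville P) \<and>
        distr (liouville P) (liouville P) (\<phi> t) = liouville P) \<and>
     (\<forall>x\<in>points P. \<phi> t0 x = x) \<and>
     (\<forall>f\<in>observables P. \<forall>x\<in>points P. \<forall>t\<in>{t0..t1}.
        ((\<lambda>s. bracket P f (H s) (\<phi> s x)) has_integral (f (\<phi> t x) - f x)) {t0..t})"

subsection \<open>States, manipulations and heat\<close>

type_synonym 'a cstate = "('a \<Rightarrow> real) \<times> ('a \<Rightarrow> real)"

record ('a, 'i, 'b) classical_setting =
  c_sys :: "'a phase_space"
  c_res :: "'i \<Rightarrow> 'b phase_space"
  c_res_ham :: "'i \<Rightarrow> 'b \<Rightarrow> real"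
  c_temp :: "'i \<Rightarrow> real"
  c_comp :: "'i set \<Rightarrow> ('a \<times> ('i \<Rightarrow> 'b)) phase_space"

definition partition_function :: "real \<Rightarrow> 'x phase_space \<Rightarrow> real \<Rightarrow> ('x \<Rightarrow> real) \<Rightarrow> real" where
  "partition_function k P T H = (\<integral>x. exp (- H x / (k * T)) \<partial>liouville P)"

definition canonical_density ::
  "real \<Rightarrow> 'x phase_space \<Rightarrow> real \<Rightarrow> ('x \<Rightarrow> real) \<Rightarrow> 'x \<Rightarrow> real" where
  "canonical_density k P T H x = exp (- H x / (k * T)) / partition_function k P T H"

definition classical_setting :: "real \<Rightarrow> ('a, 'i, 'b) classical_setting \<Rightarrow> bool" where
  "classical_setting k S \<longleftrightarrow>
     phase_space (c_sys S) \<and>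
     (\<forall>i. phase_space (c_res S i) \<and>
          c_res_ham S i \<in> observables (c_res S i) \<and>
          c_temp S i > 0 \<and>
          integrable (liouville (c_res S i)) (\<lambda>x. exp (- c_res_ham S i x / (k * c_temp S i))) \<and>
          partition_function k (c_res S i) (c_temp S i) (c_res_ham S i) > 0) \<and>
     (\<forall>I. finite I \<longrightarrow> composite_phase_space (c_sys S) I (c_res S) (c_comp S I))"

definition classical_state :: "('a, 'i, 'b) classical_setting \<Rightarrow> 'a cstate \<Rightarrow> bool" where
  "classical_state S a \<longleftrightarrow>
     fst a \<in> borel_measurable (liouville (c_sys S)) \<and>
     (\<forall>x\<in>points (c_sys S). fst a x \<ge> 0) \<and>
     (\<integral>\<^sup>+x. ennreal (fst a x) \<partial>liouville (c_sys S)) = 1 \<and>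
     snd a \<in> observables (c_sys S)"

definition classical_distinguishable ::
  "('a, 'i, 'b) classical_setting \<Rightarrow> 'a cstate \<Rightarrow> 'a cstate \<Rightarrow> bool" where
  "classical_distinguishable S a b \<longleftrightarrow>
     (AE x in liouville (c_sys S). fst a x = 0 \<or> fst b x = 0)"

text \<open>The Gibbs entropy \<open>- k \<langle>log \<rho>\<rangle>\<^sub>\<rho>\<close> is well defined and finite (recall \<open>0 * ln 0 = 0\<close>).\<close>

definition classical_entropy_finite :: "('a, 'i, 'b) classical_setting \<Rightarrow> 'a cstate \<Rightarrow> bool" where
  "classical_entropy_finite S a \<longleftrightarrow>
     integrable (liouville (c_sys S)) (\<lambda>x. fst a x * ln (fst a x))"

text \<open>
  A manipulation uses the reservoirs in \<open>cm_res\<close> during \<open>[cm_start, cm_end]\<close>. The Hamiltonian of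
  the composite at time \<open>t\<close> is \<open>H\<^sub>A(t) + \<Sum>\<^sub>i H\<^sub>B\<^sub>i + V(t)\<close>, with \<open>H\<^sub>A = cm_ham\<close> and an arbitrary
  coupling \<open>V = cm_coupling\<close>. The flow it generates is carried along in \<open>cm_flow\<close>.
\<close>

record ('a, 'i, 'b) cmanipulation =
  cm_res :: "'i set"
  cm_start :: real
  cm_end :: real
  cm_ham :: "real \<Rightarrow> 'a \<Rightarrow> real"
  cm_coupling :: "real \<Rightarrow> 'a \<times> ('i \<Rightarrow> 'b) \<Rightarrow> real"
  cm_flow :: "real \<Rightarrow> 'a \<times> ('i \<Rightarrow> 'b) \<Rightarrow> 'a \<times> ('i \<Rightarrow> 'b)"

definition cm_total ::
  "('a, 'i, 'b) classical_setting \<Rightarrow> ('a, 'i, 'b) cmanipulation \<Rightarrow>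
   real \<Rightarrow> 'a \<times> ('i \<Rightarrow> 'b) \<Rightarrow> real" where
  "cm_total S M t z =
     cm_ham M t (fst z) + (\<Sum>i\<in>cm_res M. c_res_ham S i (snd z i)) + cm_coupling M t z"

definition classical_manipulation ::
  "('a, 'i, 'b) classical_setting \<Rightarrow> ('a, 'i, 'b) cmanipulation \<Rightarrow> bool" where
  "classical_manipulation S M \<longleftrightarrow>
     finite (cm_res M) \<and> cm_start M \<le> cm_end M \<and>
     (\<forall>t\<in>{cm_start M..cm_end M}.
        cm_ham M t \<in> observables (c_sys S) \<and>
        cm_coupling M t \<in> observables (c_comp S (cm_res M))) \<and>
     (\<forall>z\<in>points (c_comp S (cm_res M)). cm_coupling M (cm_start M) z = 0) \<and>
     hamiltonian_flow (c_comp S (cm_res M)) (cm_total S M) (cm_start M) (cm_end M) (cm_flow M)"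

definition cm_initial ::
  "real \<Rightarrow> ('a, 'i, 'b) classical_setting \<Rightarrow> ('a, 'i, 'b) cmanipulation \<Rightarrow> 'a cstate \<Rightarrow>
   ('a \<times> ('i \<Rightarrow> 'b)) measure" where
  "cm_initial k S M a =
     density (liouville (c_comp S (cm_res M)))
       (\<lambda>z. ennreal (fst a (fst z) *
         (\<Prod>i\<in>cm_res M. canonical_density k (c_res S i) (c_temp S i) (c_res_ham S i) (snd z i))))"

definition cm_marginal_sys ::
  "real \<Rightarrow> ('a, 'i, 'b) classical_setting \<Rightarrow> ('a, 'i, 'b) cmanipulation \<Rightarrow> 'a cstate \<Rightarrow>
   real \<Rightarrow> 'a measure" where
  "cm_marginal_sys k S M a t =
     distr (cm_initial k S M a) (liouville (c_sys S)) (\<lambda>z. fst (cm_flow M t z))"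

definition cm_marginal_res ::
  "real \<Rightarrow> ('a, 'i, 'b) classical_setting \<Rightarrow> ('a, 'i, 'b) cmanipulation \<Rightarrow> 'a cstate \<Rightarrow>
   'i \<Rightarrow> real \<Rightarrow> 'b measure" where
  "cm_marginal_res k S M a i t =
     distr (cm_initial k S M a) (liouville (c_res S i)) (\<lambda>z. snd (cm_flow M t z) i)"

definition classical_takes ::
  "real \<Rightarrow> ('a, 'i, 'b) classical_setting \<Rightarrow> ('a, 'i, 'b) cmanipulation \<Rightarrow>
   'a cstate \<Rightarrow> 'a cstate \<Rightarrow> bool" where
  "classical_takes k S M a b \<longleftrightarrow>
     (\<forall>x\<in>points (c_sys S). cm_ham M (cm_start M) x = snd a x) \<and>
     (\<forall>x\<in>points (c_sys S). cm_ham M (cm_end M) x = snd b x) \<and>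
     cm_marginal_sys k S M a (cm_end M) = density (liouville (c_sys S)) (\<lambda>x. ennreal (fst b x))"

definition classical_energies_finite ::
  "real \<Rightarrow> ('a, 'i, 'b) classical_setting \<Rightarrow> ('a, 'i, 'b) cmanipulation \<Rightarrow> 'a cstate \<Rightarrow> bool" where
  "classical_energies_finite k S M a \<longleftrightarrow>
     (\<forall>i\<in>cm_res M. \<forall>t\<in>{cm_start M, cm_end M}.
        integrable (cm_marginal_res k S M a i t) (c_res_ham S i))"

definition classical_heat ::
  "real \<Rightarrow> ('a, 'i, 'b) classical_setting \<Rightarrow> ('a, 'i, 'b) cmanipulation \<Rightarrow> 'a cstate \<Rightarrow>
   'i \<Rightarrow> real" where
  "classical_heat k S M a i =
     - ((\<integral>x. c_res_ham S i x \<partial>cm_marginal_res k S M a i (cm_end M))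
        - (\<integral>x. c_res_ham S i x \<partial>cm_marginal_res k S M a i (cm_start M)))"

definition classical_sigma ::
  "real \<Rightarrow> ('a, 'i, 'b) classical_setting \<Rightarrow> ('a, 'i, 'b) cmanipulation \<Rightarrow> 'a cstate \<Rightarrow> real" where
  "classical_sigma k S M a = (\<Sum>i\<in>cm_res M. classical_heat k S M a i / c_temp S i)"


section \<open>Quantum reading\<close>

subsection \<open>The Hilbert spaces \<open>\<ell>\<^sup>2(X)\<close> and their operators\<close>

text \<open>
  Every complex Hilbert space is, after the choice of an orthonormal basis, the space \<open>\<ell>\<^sup>2(X)\<close> of
  square-summable functions on a set \<open>X\<close>, and \<open>\<ell>\<^sup>2(X) \<otimes> \<ell>\<^sup>2(Y) = \<ell>\<^sup>2(X \<times> Y)\<close>. Vectors are functions on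
  the whole type that vanish off \<open>X\<close>. There is no restriction on the dimension.
\<close>

definition ell2 :: "'x set \<Rightarrow> ('x \<Rightarrow> complex) set" where
  "ell2 X = {\<psi>. (\<forall>x. x \<notin> X \<longrightarrow> \<psi> x = 0) \<and> (\<lambda>x. (cmod (\<psi> x))\<^sup>2) summable_on X}"

definition l2inner :: "'x set \<Rightarrow> ('x \<Rightarrow> complex) \<Rightarrow> ('x \<Rightarrow> complex) \<Rightarrow> complex" where
  "l2inner X \<psi> \<phi> = (\<Sum>\<^sub>\<infinity>x\<in>X. cnj (\<psi> x) * \<phi> x)"

definition ket :: "'x \<Rightarrow> 'x \<Rightarrow> complex" where
  "ket x = (\<lambda>y. if y = x then 1 else 0)"

definition l2dense :: "'x set \<Rightarrow> ('x \<Rightarrow> complex) set \<Rightarrow> bool" where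
  "l2dense X D \<longleftrightarrow>
     (\<forall>\<psi>\<in>ell2 X. \<forall>\<epsilon>>0. \<exists>\<phi>\<in>D. (\<Sum>\<^sub>\<infinity>x\<in>X. (cmod (\<psi> x - \<phi> x))\<^sup>2) < \<epsilon>)"

definition orthonormal_basis :: "'x set \<Rightarrow> ('x \<Rightarrow> 'x \<Rightarrow> complex) \<Rightarrow> bool" where
  "orthonormal_basis X e \<longleftrightarrow>
     (\<forall>j\<in>X. e j \<in> ell2 X) \<and>
     (\<forall>i\<in>X. \<forall>j\<in>X. l2inner X (e i) (e j) = (if i = j then 1 else 0)) \<and>
     l2dense X {(\<lambda>x. \<Sum>j\<in>F. c j * e j x) | F c. finite F \<and> F \<subseteq> X}"

text \<open>Possibly unbounded operators; the values of \<open>op_app\<close> outside \<open>op_dom\<close> are irrelevant.\<close>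

record 'x operator =
  op_dom :: "('x \<Rightarrow> complex) set"
  op_app :: "('x \<Rightarrow> complex) \<Rightarrow> 'x \<Rightarrow> complex"

definition op_eq :: "'x operator \<Rightarrow> 'x operator \<Rightarrow> bool" where
  "op_eq H K \<longleftrightarrow> op_dom H = op_dom K \<and> (\<forall>\<psi>\<in>op_dom H. op_app H \<psi> = op_app K \<psi>)"

definition linear_operator :: "'x set \<Rightarrow> 'x operator \<Rightarrow> bool" where
  "linear_operator X H \<longleftrightarrow>
     op_dom H \<subseteq> ell2 X \<and> (\<lambda>x. 0) \<in> op_dom H \<and> op_app H ` op_dom H \<subseteq> ell2 X \<and>
     (\<forall>\<psi>\<in>op_dom H. \<forall>\<phi>\<in>op_dom H. \<forall>c.
        (\<lambda>x. c * \<psi> x + \<phi> x) \<in> op_dom H \<and>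
        op_app H (\<lambda>x. c * \<psi> x + \<phi> x) = (\<lambda>x. c * op_app H \<psi> x + op_app H \<phi> x))"

definition symmetric_operator :: "'x set \<Rightarrow> 'x operator \<Rightarrow> bool" where
  "symmetric_operator X H \<longleftrightarrow>
     linear_operator X H \<and>
     (\<forall>\<psi>\<in>op_dom H. \<forall>\<phi>\<in>op_dom H. l2inner X \<psi> (op_app H \<phi>) = l2inner X (op_app H \<psi>) \<phi>)"

definition selfadjoint_operator :: "'x set \<Rightarrow> 'x operator \<Rightarrow> bool" where
  "selfadjoint_operator X H \<longleftrightarrow>
     symmetric_operator X H \<and> l2dense X (op_dom H) \<and>
     (\<forall>\<phi>\<in>ell2 X.
        (\<exists>\<eta>\<in>ell2 X. \<forall>\<psi>\<in>op_dom H. l2inner X \<phi> (op_app H \<psi>) = l2inner X \<eta> \<psi>) \<longrightarrow> \<phi> \<in> op_dom H)"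

definition unitary_operator :: "'x set \<Rightarrow> (('x \<Rightarrow> complex) \<Rightarrow> 'x \<Rightarrow> complex) \<Rightarrow> bool" where
  "unitary_operator X U \<longleftrightarrow>
     U ` ell2 X = ell2 X \<and>
     (\<forall>\<psi>\<in>ell2 X. \<forall>\<phi>\<in>ell2 X. \<forall>c. U (\<lambda>x. c * \<psi> x + \<phi> x) = (\<lambda>x. c * U \<psi> x + U \<phi> x)) \<and>
     (\<forall>\<psi>\<in>ell2 X. \<forall>\<phi>\<in>ell2 X. l2inner X (U \<psi>) (U \<phi>) = l2inner X \<psi> \<phi>)"

text \<open>
  An orthonormal basis of eigenvectors \<open>e j\<close> with real eigenvalues \<open>E j\<close>. Density operators always
  have one, and so does a Hamiltonian \<open>H\<close> for which \<open>e\<^sup>-\<^sup>H\<^sup>/\<^sup>k\<^sup>T\<close> has finite trace.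
\<close>

definition eigenbasis ::
  "'x set \<Rightarrow> 'x operator \<Rightarrow> ('x \<Rightarrow> 'x \<Rightarrow> complex) \<Rightarrow> ('x \<Rightarrow> real) \<Rightarrow> bool" where
  "eigenbasis X H e E \<longleftrightarrow>
     orthonormal_basis X e \<and>
     (\<forall>j\<in>X. e j \<in> op_dom H \<and> op_app H (e j) = (\<lambda>x. complex_of_real (E j) * e j x))"

text \<open>Some eigenbasis; what is built from it below does not depend on the choice.\<close>

definition eigensystem :: "'x set \<Rightarrow> 'x operator \<Rightarrow> ('x \<Rightarrow> 'x \<Rightarrow> complex) \<times> ('x \<Rightarrow> real)" where
  "eigensystem X H = (SOME (e, E). eigenbasis X H e E)"

subsection \<open>Density operators\<close>

text \<open>
  A bounded operator on \<open>\<ell>\<^sup>2(X)\<close> is given by its matrix \<open>\<rho> x y = \<langle>x|\<rho>|y\<rangle>\<close>. The density operators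
  (positive, trace class, of trace 1) are exactly the positive semidefinite matrices on \<open>X\<close>
  whose diagonal sums to 1.
\<close>

definition density_operator :: "'x set \<Rightarrow> ('x \<Rightarrow> 'x \<Rightarrow> complex) \<Rightarrow> bool" where
  "density_operator X \<rho> \<longleftrightarrow>
     (\<forall>F c. finite F \<and> F \<subseteq> X \<longrightarrow>
        (\<Sum>x\<in>F. \<Sum>y\<in>F. cnj (c x) * \<rho> x y * c y) \<in> \<real>\<^sub>\<ge>\<^sub>0) \<and>
     ((\<lambda>x. \<rho> x x) has_sum 1) X"

definition mat_app ::
  "'x set \<Rightarrow> ('x \<Rightarrow> 'x \<Rightarrow> complex) \<Rightarrow> ('x \<Rightarrow> complex) \<Rightarrow> 'x \<Rightarrow> complex" where
  "mat_app X \<rho> \<psi> = (\<lambda>x. if x \<in> X then \<Sum>\<^sub>\<infinity>y\<in>X. \<rho> x y * \<psi> y else 0)"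

definition mat_operator :: "'x set \<Rightarrow> ('x \<Rightarrow> 'x \<Rightarrow> complex) \<Rightarrow> 'x operator" where
  "mat_operator X \<rho> = \<lparr>op_dom = ell2 X, op_app = mat_app X \<rho>\<rparr>"

text \<open>The matrix of \<open>U \<rho> U\<^sup>-\<^sup>1\<close>.\<close>

definition conjugate_by ::
  "'x set \<Rightarrow> (('x \<Rightarrow> complex) \<Rightarrow> 'x \<Rightarrow> complex) \<Rightarrow> ('x \<Rightarrow> 'x \<Rightarrow> complex) \<Rightarrow> 'x \<Rightarrow> 'x \<Rightarrow> complex"
  where
  "conjugate_by X U \<rho> x y = U (mat_app X \<rho> (inv_into (ell2 X) U (ket y))) x"

text \<open>\<open>Z = Tr e\<^sup>-\<^sup>H\<^sup>/\<^sup>k\<^sup>T\<close> and \<open>Z\<^sup>-\<^sup>1 e\<^sup>-\<^sup>H\<^sup>/\<^sup>k\<^sup>T\<close>, by functional calculus in an eigenbasis of \<open>H\<close>.\<close>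

definition has_canonical :: "real \<Rightarrow> 'x set \<Rightarrow> real \<Rightarrow> 'x operator \<Rightarrow> bool" where
  "has_canonical k X T H \<longleftrightarrow>
     (\<exists>e E. eigenbasis X H e E \<and> (\<lambda>j. exp (- E j / (k * T))) summable_on X)"

definition quantum_partition_function :: "real \<Rightarrow> 'x set \<Rightarrow> real \<Rightarrow> 'x operator \<Rightarrow> real" where
  "quantum_partition_function k X T H =
     (\<Sum>\<^sub>\<infinity>j\<in>X. exp (- snd (eigensystem X H) j / (k * T)))"

definition canonical_operator ::
  "real \<Rightarrow> 'x set \<Rightarrow> real \<Rightarrow> 'x operator \<Rightarrow> 'x \<Rightarrow> 'x \<Rightarrow> complex" where
  "canonical_operator k X T H x y =
     (let (e, E) = eigensystem X H in
      \<Sum>\<^sub>\<infinity>j\<in>X. complex_of_real (exp (- E j / (k * T)) / quantum_partition_function k X T H)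
               * e j x * cnj (e j y))"

text \<open>
  \<open>\<langle>H\<rangle>\<^sub>\<rho> = Tr (\<rho> H) = \<Sum>\<^sub>j E\<^sub>j \<langle>e\<^sub>j|\<rho>|e\<^sub>j\<rangle>\<close>, for \<open>H\<close> with an eigenbasis; it is well defined and finite
  when the sum converges (absolutely).
\<close>

definition expectation_finite :: "'x set \<Rightarrow> 'x operator \<Rightarrow> ('x \<Rightarrow> 'x \<Rightarrow> complex) \<Rightarrow> bool" where
  "expectation_finite X H \<rho> \<longleftrightarrow>
     (let (e, E) = eigensystem X H in
      (\<lambda>j. E j * Re (l2inner X (e j) (mat_app X \<rho> (e j)))) summable_on X)"

definition expectation :: "'x set \<Rightarrow> 'x operator \<Rightarrow> ('x \<Rightarrow> 'x \<Rightarrow> complex) \<Rightarrow> real" where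
  "expectation X H \<rho> =
     (let (e, E) = eigensystem X H in
      \<Sum>\<^sub>\<infinity>j\<in>X. E j * Re (l2inner X (e j) (mat_app X \<rho> (e j))))"

subsection \<open>Unitary evolution\<close>

text \<open>
  \<open>U t\<close> maps the vector at time \<open>t0\<close> to the one at time \<open>t\<close>. The Schroedinger equation
  \<open>i \<hbar> dU(t)\<psi>/dt = H(t) U(t)\<psi>\<close> is written in integrated weak form, for a dense set of initial vectors,
  so that the Hamiltonian may jump in time.
\<close>

definition unitary_evolution ::
  "real \<Rightarrow> 'x set \<Rightarrow> (real \<Rightarrow> 'x operator) \<Rightarrow> real \<Rightarrow> real \<Rightarrow>
   (real \<Rightarrow> ('x \<Rightarrow> complex) \<Rightarrow> 'x \<Rightarrow> complex) \<Rightarrow> bool" where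
  "unitary_evolution hbar X H t0 t1 U \<longleftrightarrow>
     (\<forall>t\<in>{t0..t1}. unitary_operator X (U t)) \<and>
     (\<forall>\<psi>\<in>ell2 X. U t0 \<psi> = \<psi>) \<and>
     (\<exists>D\<subseteq>ell2 X. l2dense X D \<and>
        (\<forall>\<psi>\<in>D. \<forall>t\<in>{t0..t1}. U t \<psi> \<in> op_dom (H t) \<and>
          (\<forall>\<phi>\<in>ell2 X.
             ((\<lambda>s. - (\<i> / complex_of_real hbar) * l2inner X \<phi> (op_app (H s) (U s \<psi>)))
                has_integral (l2inner X \<phi> (U t \<psi>) - l2inner X \<phi> \<psi>)) {t0..t})))"

subsection \<open>States, manipulations and heat\<close>

type_synonym 'a qstate = "('a \<Rightarrow> 'a \<Rightarrow> complex) \<times> 'a operator"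

text \<open>The system is \<open>\<ell>\<^sup>2(q_sys)\<close> and the reservoir \<open>i\<close> is \<open>\<ell>\<^sup>2(q_res i)\<close>.\<close>

record ('a, 'i, 'b) quantum_setting =
  q_sys :: "'a set"
  q_res :: "'i \<Rightarrow> 'b set"
  q_res_ham :: "'i \<Rightarrow> 'b operator"
  q_temp :: "'i \<Rightarrow> real"

definition q_comp :: "('a, 'i, 'b) quantum_setting \<Rightarrow> 'i set \<Rightarrow> ('a \<times> ('i \<Rightarrow> 'b)) set" where
  "q_comp S I = q_sys S \<times> (\<Pi>\<^sub>E i\<in>I. q_res S i)"

definition quantum_setting :: "real \<Rightarrow> ('a, 'i, 'b) quantum_setting \<Rightarrow> bool" where
  "quantum_setting k S \<longleftrightarrow>
     q_sys S \<noteq> {} \<and>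
     (\<forall>i. q_res S i \<noteq> {} \<and>
          selfadjoint_operator (q_res S i) (q_res_ham S i) \<and>
          q_temp S i > 0 \<and>
          has_canonical k (q_res S i) (q_temp S i) (q_res_ham S i))"

definition quantum_state :: "('a, 'i, 'b) quantum_setting \<Rightarrow> 'a qstate \<Rightarrow> bool" where
  "quantum_state S a \<longleftrightarrow>
     density_operator (q_sys S) (fst a) \<and> selfadjoint_operator (q_sys S) (snd a)"

definition quantum_distinguishable ::
  "('a, 'i, 'b) quantum_setting \<Rightarrow> 'a qstate \<Rightarrow> 'a qstate \<Rightarrow> bool" where
  "quantum_distinguishable S a b \<longleftrightarrow>
     (\<forall>\<psi>\<in>ell2 (q_sys S).
        mat_app (q_sys S) (fst a) (mat_app (q_sys S) (fst b) \<psi>) = (\<lambda>x. 0))"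

text \<open>
  The von Neumann entropy \<open>- k Tr (\<rho> log \<rho>)\<close> is well defined and finite; \<open>log \<rho>\<close> is taken by
  functional calculus, and \<open>0 * ln 0 = 0\<close>.
\<close>

definition quantum_entropy_finite :: "('a, 'i, 'b) quantum_setting \<Rightarrow> 'a qstate \<Rightarrow> bool" where
  "quantum_entropy_finite S a \<longleftrightarrow>
     (\<exists>e p. eigenbasis (q_sys S) (mat_operator (q_sys S) (fst a)) e p \<and>
            (\<lambda>j. p j * ln (p j)) summable_on q_sys S)"

text \<open>
  A manipulation uses the reservoirs in \<open>qm_res\<close> during \<open>[qm_start, qm_end]\<close>; \<open>qm_ham\<close> is the
  Hamiltonian \<open>H\<^sub>A(t)\<close> of the system, \<open>qm_coupling\<close> the coupling \<open>V(t)\<close>, \<open>qm_total\<close> the Hamiltonian of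
  the composite, and \<open>qm_evol\<close> the evolution generated by the latter.
\<close>

record ('a, 'i, 'b) qmanipulation =
  qm_res :: "'i set"
  qm_start :: real
  qm_end :: real
  qm_ham :: "real \<Rightarrow> 'a operator"
  qm_coupling :: "real \<Rightarrow> ('a \<times> ('i \<Rightarrow> 'b)) operator"
  qm_total :: "real \<Rightarrow> ('a \<times> ('i \<Rightarrow> 'b)) operator"
  qm_evol :: "real \<Rightarrow> ('a \<times> ('i \<Rightarrow> 'b) \<Rightarrow> complex) \<Rightarrow> 'a \<times> ('i \<Rightarrow> 'b) \<Rightarrow> complex"

text \<open>The product vector \<open>\<psi> \<otimes> \<Otimes>\<^sub>i \<xi>\<^sub>i\<close>.\<close>

definition product_vector ::
  "('a, 'i, 'b) quantum_setting \<Rightarrow> 'i set \<Rightarrow> ('a \<Rightarrow> complex) \<Rightarrow> ('i \<Rightarrow> 'b \<Rightarrow> complex) \<Rightarrow>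
   'a \<times> ('i \<Rightarrow> 'b) \<Rightarrow> complex" where
  "product_vector S I \<psi> \<xi> z =
     (if z \<in> q_comp S I then \<psi> (fst z) * (\<Prod>i\<in>I. \<xi> i (snd z i)) else 0)"

text \<open>
  The Hamiltonian of the composite is a self-adjoint extension of \<open>H\<^sub>A + \<Sum>\<^sub>i H\<^sub>B\<^sub>i + V\<close>, where this sum
  acts on the product vectors for which all terms are defined. The extension is unique if \<open>V = 0\<close>.
\<close>

definition extends_sum ::
  "('a, 'i, 'b) quantum_setting \<Rightarrow> 'i set \<Rightarrow> 'a operator \<Rightarrow> ('a \<times> ('i \<Rightarrow> 'b)) operator \<Rightarrow>
   ('a \<times> ('i \<Rightarrow> 'b)) operator \<Rightarrow> bool" where
  "extends_sum S I HA V H \<longleftrightarrow>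
     (\<forall>\<psi>\<in>op_dom HA. \<forall>\<xi>. (\<forall>i\<in>I. \<xi> i \<in> op_dom (q_res_ham S i)) \<longrightarrow>
        product_vector S I \<psi> \<xi> \<in> op_dom V \<longrightarrow>
        product_vector S I \<psi> \<xi> \<in> op_dom H \<and>
        op_app H (product_vector S I \<psi> \<xi>) =
          (\<lambda>z. product_vector S I (op_app HA \<psi>) \<xi> z
             + (\<Sum>i\<in>I. product_vector S I \<psi> (\<xi>(i := op_app (q_res_ham S i) (\<xi> i))) z)
             + op_app V (product_vector S I \<psi> \<xi>) z))"

definition quantum_manipulation ::
  "real \<Rightarrow> ('a, 'i, 'b) quantum_setting \<Rightarrow> ('a, 'i, 'b) qmanipulation \<Rightarrow> bool" where
  "quantum_manipulation hbar S M \<longleftrightarrow>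
     finite (qm_res M) \<and> qm_start M \<le> qm_end M \<and>
     (\<forall>t\<in>{qm_start M..qm_end M}.
        selfadjoint_operator (q_sys S) (qm_ham M t) \<and>
        symmetric_operator (q_comp S (qm_res M)) (qm_coupling M t) \<and>
        selfadjoint_operator (q_comp S (qm_res M)) (qm_total M t) \<and>
        extends_sum S (qm_res M) (qm_ham M t) (qm_coupling M t) (qm_total M t)) \<and>
     op_eq (qm_coupling M (qm_start M)) \<lparr>op_dom = ell2 (q_comp S (qm_res M)), op_app = (\<lambda>\<psi> z. 0)\<rparr> \<and>
     unitary_evolution hbar (q_comp S (qm_res M)) (qm_total M) (qm_start M) (qm_end M) (qm_evol M)"

definition qm_initial ::
  "real \<Rightarrow> ('a, 'i, 'b) quantum_setting \<Rightarrow> ('a, 'i, 'b) qmanipulation \<Rightarrow> 'a qstate \<Rightarrow>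
   'a \<times> ('i \<Rightarrow> 'b) \<Rightarrow> 'a \<times> ('i \<Rightarrow> 'b) \<Rightarrow> complex" where
  "qm_initial k S M a z w =
     fst a (fst z) (fst w) *
     (\<Prod>i\<in>qm_res M.
        canonical_operator k (q_res S i) (q_temp S i) (q_res_ham S i) (snd z i) (snd w i))"

definition qm_state_at ::
  "real \<Rightarrow> ('a, 'i, 'b) quantum_setting \<Rightarrow> ('a, 'i, 'b) qmanipulation \<Rightarrow> 'a qstate \<Rightarrow> real \<Rightarrow>
   'a \<times> ('i \<Rightarrow> 'b) \<Rightarrow> 'a \<times> ('i \<Rightarrow> 'b) \<Rightarrow> complex" where
  "qm_state_at k S M a t =
     conjugate_by (q_comp S (qm_res M)) (qm_evol M t) (qm_initial k S M a)"

text \<open>The marginals are the partial traces.\<close>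

definition qm_marginal_sys ::
  "real \<Rightarrow> ('a, 'i, 'b) quantum_setting \<Rightarrow> ('a, 'i, 'b) qmanipulation \<Rightarrow> 'a qstate \<Rightarrow> real \<Rightarrow>
   'a \<Rightarrow> 'a \<Rightarrow> complex" where
  "qm_marginal_sys k S M a t x x' =
     (\<Sum>\<^sub>\<infinity>y\<in>(\<Pi>\<^sub>E i\<in>qm_res M. q_res S i). qm_state_at k S M a t (x, y) (x', y))"

definition qm_marginal_res ::
  "real \<Rightarrow> ('a, 'i, 'b) quantum_setting \<Rightarrow> ('a, 'i, 'b) qmanipulation \<Rightarrow> 'a qstate \<Rightarrow>
   'i \<Rightarrow> real \<Rightarrow> 'b \<Rightarrow> 'b \<Rightarrow> complex" where
  "qm_marginal_res k S M a i t v v' =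
     (\<Sum>\<^sub>\<infinity>(x, y)\<in>q_comp S (qm_res M - {i}). qm_state_at k S M a t (x, y(i := v)) (x, y(i := v')))"

definition quantum_takes ::
  "real \<Rightarrow> ('a, 'i, 'b) quantum_setting \<Rightarrow> ('a, 'i, 'b) qmanipulation \<Rightarrow>
   'a qstate \<Rightarrow> 'a qstate \<Rightarrow> bool" where
  "quantum_takes k S M a b \<longleftrightarrow>
     op_eq (qm_ham M (qm_start M)) (snd a) \<and>
     op_eq (qm_ham M (qm_end M)) (snd b) \<and>
     (\<forall>x\<in>q_sys S. \<forall>y\<in>q_sys S. qm_marginal_sys k S M a (qm_end M) x y = fst b x y)"

definition quantum_energies_finite ::
  "real \<Rightarrow> ('a, 'i, 'b) quantum_setting \<Rightarrow> ('a, 'i, 'b) qmanipulation \<Rightarrow> 'a qstate \<Rightarrow> bool" where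
  "quantum_energies_finite k S M a \<longleftrightarrow>
     (\<forall>i\<in>qm_res M. \<forall>t\<in>{qm_start M, qm_end M}.
        expectation_finite (q_res S i) (q_res_ham S i) (qm_marginal_res k S M a i t))"

definition quantum_heat ::
  "real \<Rightarrow> ('a, 'i, 'b) quantum_setting \<Rightarrow> ('a, 'i, 'b) qmanipulation \<Rightarrow> 'a qstate \<Rightarrow>
   'i \<Rightarrow> real" where
  "quantum_heat k S M a i =
     - (expectation (q_res S i) (q_res_ham S i) (qm_marginal_res k S M a i (qm_end M))
        - expectation (q_res S i) (q_res_ham S i) (qm_marginal_res k S M a i (qm_start M)))"

definition quantum_sigma ::
  "real \<Rightarrow> ('a, 'i, 'b) quantum_setting \<Rightarrow> ('a, 'i, 'b) qmanipulation \<Rightarrow> 'a qstate \<Rightarrow> real" where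
  "quantum_sigma k S M a = (\<Sum>i\<in>qm_res M. quantum_heat k S M a i / q_temp S i)"

end

(*
  Attach to the run from a_i a random variable W_i comparing the initial state with the product of
  b and the canonical states, read off after the evolution: W_i = log (initial weight) - log (final
  reference weight). Its mean is (S(b) - S(a_i) - sigma_M(a_i -> b)) / k, S being the entropy: the
  partition functions cancel and the reservoirs contribute only through the exchanged heats. Jensen's
  inequality gives exp (- E W_i) <= E exp (- W_i), and the right-hand side is the reference weight
  of the set of final configurations that come from the support of a_i. The evolution is injective
  (measure preserving, respectively unitary) and the supports are disjoint (orthogonal), so these
  weights add up to at most 1. With a single initial state this is the second law, which bounds
  S_M(b -> a_i) by S(a_i) - S(b) and turns the inequality into the one for the dissipations.

  In the quantum case W_i lives on pairs (J, K) of eigenvectors of the initial and of the reference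
  state, with probability lambda_J |<K|U|J>|^2.
*)

theory Submission
  imports Defs
begin

section \<open>The classical bound\<close>

text \<open>The mean of W is computable because W is a sum of functions of one component at one
  time: the system at the start and at the end, and each reservoir at the start and at the end.
  Correlations created by the evolution therefore do not matter; only the marginals enter that
  define the final state and the heats. That the final marginal of the system is exactly
  \<open>b\<close> has a second use: places where \<open>b\<close> has weight zero have probability
  zero, so a meaningless logarithm there does no harm. In the quantum case the pairs (J, K) fit
  because \<open>b\<close> and the reservoir Hamiltonians are diagonal in the basis labelled by K:
  the law of a component of K is the diagonal of the corresponding reduced final state. Density
  operators enter the estimate through eigendecompositions, whose bases come from the hypotheses of
  finite entropy and of a canonical state. As the dimension is arbitrary, most of the labour lies in
  exchanging unconditional sums.\<close>

text \<open>The tangent of \<open>exp\<close> at \<open>- w\<close> lies below the graph: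
  \<open>exp (- W) \<ge> exp (- w) * (1 + w - W)\<close>. The right-hand side may be infinite, hence
  \<open>ennreal\<close>; \<open>max 0\<close> is there because \<open>ennreal\<close> cuts off the
  negative part of the tangent.\<close>

lemma exp_jensen_integral:
  fixes W :: "'a \<Rightarrow> real"
  assumes P: "emeasure P (space P) = 1" and W: "integrable P W"
  shows "ennreal (exp (- (\<integral>x. W x \<partial>P))) \<le> (\<integral>\<^sup>+x. ennreal (exp (- W x)) \<partial>P)"
proof -
  define w where "w = (\<integral>x. W x \<partial>P)"
  interpret finite_measure P by (rule finite_measureI) (simp add: P)
  have one: "measure P (space P) = 1" using P by (simp add: measure_def)
  define g where "g x = exp (- w) * (1 + w - W x)" for x
  have g: "integrable P g" unfolding g_def using W by simp
  have "(\<integral>x. g x \<partial>P) = exp (- w)"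
    unfolding g_def using W by (simp add: w_def one)
  then have "exp (- w) \<le> (\<integral>x. max 0 (g x) \<partial>P)"
    using integral_mono[OF g integrable_max[OF integrable_zero g]] by simp
  then have "ennreal (exp (- w)) \<le> ennreal (\<integral>x. max 0 (g x) \<partial>P)"
    by (rule ennreal_leI)
  also have "\<dots> = (\<integral>\<^sup>+x. ennreal (max 0 (g x)) \<partial>P)"
    using g by (intro nn_integral_eq_integral[symmetric]) auto
  also have "\<dots> \<le> (\<integral>\<^sup>+x. ennreal (exp (- W x)) \<partial>P)"
  proof (intro nn_integral_mono ennreal_leI)
    fix x
    have "exp (- w) * (1 + (w - W x)) \<le> exp (- w) * exp (w - W x)"
      by (intro mult_left_mono exp_ge_add_one_self) auto
    also have "\<dots> = exp (- W x)" by (simp flip: exp_add)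
    finally show "max 0 (g x) \<le> exp (- W x)" by (simp add: g_def add_diff_eq)
  qed
  finally show ?thesis by (simp add: w_def)
qed

section \<open>Canonical reservoirs and the Liouville measure of a composite\<close>

lemma classical_settingD:
  assumes "classical_setting k S"
  shows "sigma_finite_measure (liouville (c_sys S))"
    and "sigma_finite_measure (liouville (c_res S i))"
    and "c_res_ham S i \<in> borel_measurable (liouville (c_res S i))"
    and "integrable (liouville (c_res S i)) (\<lambda>x. exp (- c_res_ham S i x / (k * c_temp S i)))"
    and "partition_function k (c_res S i) (c_temp S i) (c_res_ham S i) > 0"
    and "finite I \<Longrightarrow> liouville (c_comp S I) = liouville (c_sys S) \<Otimes>\<^sub>M (\<Pi>\<^sub>M i\<in>I. liouville (c_res S i))"
proof -
  have r: "phase_space (c_res S i)" "c_res_ham S i \<in> observables (c_res S i)"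
    using assms by (simp_all add: classical_setting_def)
  show "sigma_finite_measure (liouville (c_sys S))" "sigma_finite_measure (liouville (c_res S i))"
    using assms by (simp_all add: classical_setting_def phase_space_def)
  show "c_res_ham S i \<in> borel_measurable (liouville (c_res S i))"
    using r(1)[unfolded phase_space_def, THEN conjunct2, THEN conjunct1] r(2) by (rule subsetD)
  show "integrable (liouville (c_res S i)) (\<lambda>x. exp (- c_res_ham S i x / (k * c_temp S i)))"
    "partition_function k (c_res S i) (c_temp S i) (c_res_ham S i) > 0"
    using assms by (simp_all add: classical_setting_def)
  show "liouville (c_comp S I) = liouville (c_sys S) \<Otimes>\<^sub>M (\<Pi>\<^sub>M i\<in>I. liouville (c_res S i))" if "finite I"
    using assms that by (simp add: classical_setting_def composite_phase_space_def)
qed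

definition bath_density :: "real \<Rightarrow> ('a, 'i, 'b) classical_setting \<Rightarrow> 'i set \<Rightarrow> ('i \<Rightarrow> 'b) \<Rightarrow> real" where
  "bath_density k S I y = (\<Prod>i\<in>I. canonical_density k (c_res S i) (c_temp S i) (c_res_ham S i) (y i))"

text \<open>In this form the partition functions are additive constants in the exponent, which
  cancel when the weights at the two ends of a run are compared. Positivity can be read off
  too.\<close>

lemma bath_density_exp:
  assumes "classical_setting k S" "finite I"
  shows "bath_density k S I y = exp (\<Sum>i\<in>I. - c_res_ham S i (y i) / (k * c_temp S i)
      - ln (partition_function k (c_res S i) (c_temp S i) (c_res_ham S i)))"
  using classical_settingD(5)[OF assms(1)] assms(2)
  by (simp add: bath_density_def canonical_density_def exp_sum exp_diff)

lemma canonical_density_measurable: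
  assumes "classical_setting k S"
  shows "canonical_density k (c_res S i) (c_temp S i) (c_res_ham S i) \<in> borel_measurable (liouville (c_res S i))"
  using classical_settingD(3)[OF assms, of i] unfolding canonical_density_def[abs_def] by measurable

lemma bath_density_measurable:
  assumes S: "classical_setting k S"
  shows "bath_density k S I \<in> borel_measurable (\<Pi>\<^sub>M i\<in>I. liouville (c_res S i))"
  unfolding bath_density_def[abs_def]
proof (rule borel_measurable_prod)
  fix i assume "i \<in> I"
  then have "(\<lambda>y. y i) \<in> measurable (\<Pi>\<^sub>M i\<in>I. liouville (c_res S i)) (liouville (c_res S i))"
    by (rule measurable_component_singleton)
  from measurable_compose[OF this canonical_density_measurable[OF S]]
  show "(\<lambda>y. canonical_density k (c_res S i) (c_temp S i) (c_res_ham S i) (y i))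
      \<in> borel_measurable (\<Pi>\<^sub>M i\<in>I. liouville (c_res S i))" .
qed

lemma bath_density_nn_integral:
  assumes S: "classical_setting k S" and I: "finite I"
  shows "(\<integral>\<^sup>+y. ennreal (bath_density k S I y) \<partial>(\<Pi>\<^sub>M i\<in>I. liouville (c_res S i))) = 1"
proof -
  interpret product_sigma_finite "\<lambda>i. liouville (c_res S i)"
    using classical_settingD(2)[OF S] by (simp add: product_sigma_finite_def)
  let ?c = "\<lambda>i. canonical_density k (c_res S i) (c_temp S i) (c_res_ham S i)"
  have nonneg: "?c i y \<ge> 0" for i y
    using classical_settingD(5)[OF S, of i] by (simp add: canonical_density_def)
  have one: "(\<integral>\<^sup>+y. ennreal (?c i y) \<partial>liouville (c_res S i)) = 1" for i
  proof -
    have "(\<integral>\<^sup>+y. ennreal (?c i y) \<partial>liouville (c_res S i)) = ennreal (\<integral>y. ?c i y \<partial>liouville (c_res S i))"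
      using classical_settingD(4,5)[OF S, of i]
      by (intro nn_integral_eq_integral) (auto simp: canonical_density_def)
    also have "(\<integral>y. ?c i y \<partial>liouville (c_res S i)) = 1"
      using classical_settingD(5)[OF S, of i] by (simp add: canonical_density_def partition_function_def)
    finally show ?thesis by simp
  qed
  have "(\<integral>\<^sup>+y. ennreal (bath_density k S I y) \<partial>(\<Pi>\<^sub>M i\<in>I. liouville (c_res S i))) =
      (\<integral>\<^sup>+y. (\<Prod>i\<in>I. ennreal (?c i (y i))) \<partial>(\<Pi>\<^sub>M i\<in>I. liouville (c_res S i)))"
    by (simp add: bath_density_def prod_ennreal nonneg)
  also have "\<dots> = (\<Prod>i\<in>I. \<integral>\<^sup>+y. ennreal (?c i y) \<partial>liouville (c_res S i))"
    using canonical_density_measurable[OF S] by (intro product_nn_integral_prod I) auto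
  finally show ?thesis by (simp add: one)
qed

text \<open>Tonelli in the reservoir variables, whose density has integral 1. It serves three times
  below: for the total mass of the initial measure, for its marginal on the system, and for the
  total mass of the reference density.\<close>

lemma composite_nn_integral:
  assumes S: "classical_setting k S" and I: "finite I"
    and u: "u \<in> borel_measurable (liouville (c_sys S))"
  shows "(\<integral>\<^sup>+z. u (fst z) * ennreal (bath_density k S I (snd z)) \<partial>liouville (c_comp S I)) =
    (\<integral>\<^sup>+x. u x \<partial>liouville (c_sys S))"
proof -
  let ?B = "\<Pi>\<^sub>M i\<in>I. liouville (c_res S i)"
  interpret product_sigma_finite "\<lambda>i. liouville (c_res S i)"
    using classical_settingD(2)[OF S] by (simp add: product_sigma_finite_def)
  interpret B: sigma_finite_measure ?B
    by (rule sigma_finite[OF I])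
  note [measurable] = u bath_density_measurable[OF S]
  have "(\<integral>\<^sup>+z. u (fst z) * ennreal (bath_density k S I (snd z)) \<partial>liouville (c_comp S I)) =
      (\<integral>\<^sup>+x. \<integral>\<^sup>+y. u x * ennreal (bath_density k S I y) \<partial>?B \<partial>liouville (c_sys S))"
    unfolding classical_settingD(6)[OF S I]
    by (subst B.nn_integral_fst[symmetric]) (simp_all, measurable)
  also have "\<dots> = (\<integral>\<^sup>+x. u x \<partial>liouville (c_sys S))"
    by (simp add: nn_integral_cmult bath_density_nn_integral[OF S I])
  finally show ?thesis .
qed

text \<open>Carries the disjointness of supports, known almost everywhere on the system, over to the
  composite.\<close>

lemma AE_composite_fst:
  assumes S: "classical_setting k S" and I: "finite I"
    and [measurable]: "Measurable.pred (liouville (c_sys S)) Q" and AE: "AE x in liouville (c_sys S). Q x"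
  shows "AE z in liouville (c_comp S I). Q (fst z)"
proof -
  let ?B = "\<Pi>\<^sub>M i\<in>I. liouville (c_res S i)"
  interpret product_sigma_finite "\<lambda>i. liouville (c_res S i)"
    using classical_settingD(2)[OF S] by (simp add: product_sigma_finite_def)
  interpret B: sigma_finite_measure ?B
    by (rule sigma_finite[OF I])
  interpret A: sigma_finite_measure "liouville (c_sys S)"
    by (rule classical_settingD(1)[OF S])
  interpret pair_sigma_finite "liouville (c_sys S)" ?B ..
  show ?thesis
    unfolding classical_settingD(6)[OF S I]
    by (rule AE_pair_measure) (use AE in auto)
qed

text \<open>The two integrals are minus the entropies divided by \<open>k\<close>, so each exponent
  is minus the mean of W for the run from \<open>a n\<close>. No class of manipulations occurs
  yet.\<close>

lemma classical_dissipation_bound: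
  assumes k: "k > 0" and S: "classical_setting k S" and M: "classical_manipulation S M"
    and N: "finite N"
    and a: "\<And>n. n \<in> N \<Longrightarrow> classical_state S (a n)" and b: "classical_state S b"
    and dist: "\<And>m n. m \<in> N \<Longrightarrow> n \<in> N \<Longrightarrow> m \<noteq> n \<Longrightarrow> classical_distinguishable S (a m) (a n)"
    and takes: "\<And>n. n \<in> N \<Longrightarrow> classical_takes k S M (a n) b"
    and sa: "\<And>n. n \<in> N \<Longrightarrow> classical_entropy_finite S (a n)" and sb: "classical_entropy_finite S b"
    and en: "\<And>n. n \<in> N \<Longrightarrow> classical_energies_finite k S M (a n)"
  shows "(\<Sum>n\<in>N. exp (classical_sigma k S M (a n) / k
      - (\<integral>x. fst (a n) x * ln (fst (a n) x) \<partial>liouville (c_sys S))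
      + (\<integral>x. fst b x * ln (fst b x) \<partial>liouville (c_sys S)))) \<le> 1"
proof -
  define I where "I = cm_res M"
  define A where "A = liouville (c_sys S)"
  define \<mu> where "\<mu> = liouville (c_comp S I)"
  define \<phi> where "\<phi> = cm_flow M (cm_end M)"
  \<comment> \<open>The identity on phase points; it has a name because the initial marginals are
    defined through the flow as well.\<close>
  define \<phi>0 where "\<phi>0 = cm_flow M (cm_start M)"
  define G where "G = bath_density k S I"
  define P where "P n = cm_initial k S M (a n)" for n
  have I: "finite I" using M by (simp add: classical_manipulation_def I_def)
  have \<phi>[measurable]: "\<phi> \<in> measurable \<mu> \<mu>" "\<phi>0 \<in> measurable \<mu> \<mu>" and \<mu>\<phi>: "distr \<mu> \<mu> \<phi> = \<mu>"
    and id: "\<And>z. z \<in> space \<mu> \<Longrightarrow> \<phi>0 z = z"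
    using M by (auto simp: classical_manipulation_def hamiltonian_flow_def \<phi>_def \<phi>0_def \<mu>_def I_def)
  have \<mu>: "\<mu> = A \<Otimes>\<^sub>M (\<Pi>\<^sub>M i\<in>I. liouville (c_res S i))"
    unfolding \<mu>_def A_def by (rule classical_settingD(6)[OF S I])
  have fst_m[measurable]: "fst \<in> measurable \<mu> A" unfolding \<mu> by measurable
  have snd_m: "(\<lambda>z. snd z i) \<in> measurable \<mu> (liouville (c_res S i))" if "i \<in> I" for i
    unfolding \<mu> using measurable_compose[OF measurable_snd measurable_component_singleton[OF that]] .
  have G_m[measurable]: "(\<lambda>z. G (snd z)) \<in> borel_measurable \<mu>"
    unfolding \<mu> G_def using measurable_compose[OF measurable_snd bath_density_measurable[OF S]] .
  have G0: "G y > 0" for y unfolding G_def bath_density_exp[OF S I] by simp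
  have state: "fst c \<in> borel_measurable A" "\<And>x. x \<in> space A \<Longrightarrow> fst c x \<ge> 0" "(\<integral>\<^sup>+x. ennreal (fst c x) \<partial>A) = 1"
    if "classical_state S c" for c
    using that by (auto simp: classical_state_def A_def)
  note [measurable] = state(1)[OF b]
  have space: "fst z \<in> space A" "\<phi> z \<in> space \<mu>" if "z \<in> space \<mu>" for z
    using that measurable_space[OF fst_m] measurable_space[OF \<phi>(1)] by auto
  have P: "P n = density \<mu> (\<lambda>z. ennreal (fst (a n) (fst z)) * ennreal (G (snd z)))" if "n \<in> N" for n
    unfolding P_def cm_initial_def \<mu>_def[symmetric, unfolded I_def] G_def bath_density_def I_def
  proof (intro density_cong)
    have "fst (a n) \<in> borel_measurable A" using state(1)[OF a[OF that]] .
    then show "(\<lambda>z. ennreal (fst (a n) (fst z) * (\<Prod>i\<in>cm_res M. canonical_density k (c_res S i) (c_temp S i) (c_res_ham S i) (snd z i)))) \<in> borel_measurable \<mu>"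
      "(\<lambda>z. ennreal (fst (a n) (fst z)) * ennreal (\<Prod>i\<in>cm_res M. canonical_density k (c_res S i) (c_temp S i) (c_res_ham S i) (snd z i))) \<in> borel_measurable \<mu>"
      using G_m by (auto simp: G_def bath_density_def I_def)
  qed (intro AE_I2 ennreal_mult less_imp_le[OF G0[unfolded G_def bath_density_def I_def]]
      state(2)[OF a[OF that]] space(1))
  have nn: "(\<integral>\<^sup>+z. u (fst z) * ennreal (G (snd z)) \<partial>\<mu>) = (\<integral>\<^sup>+x. u x \<partial>A)" if "u \<in> borel_measurable A" for u
    using composite_nn_integral[OF S I that[unfolded A_def]] by (simp add: \<mu>_def A_def G_def)
  define gb where "gb z = fst b (fst z) * G (snd z)" for z
  \<comment> \<open>The reference weight of the final points reached from the support of
    \<open>a n\<close>, written as an integral over initial points so that no inverse of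
    \<open>\<phi>\<close> appears.\<close>
  define x where "x n = (\<integral>\<^sup>+z. (if fst (a n) (fst z) > 0 then 1 else 0) * ennreal (gb (\<phi> z)) \<partial>\<mu>)" for n
  have gb_m[measurable]: "gb \<in> borel_measurable \<mu>" unfolding gb_def by measurable

  have main: "ennreal (exp (classical_sigma k S M (a n) / k - (\<integral>x. fst (a n) x * ln (fst (a n) x) \<partial>A)
      + (\<integral>x. fst b x * ln (fst b x) \<partial>A))) \<le> x n" if n: "n \<in> N" for n
  proof -
    note [measurable] = state(1)[OF a[OF n]]
    have sets_P[measurable_cong]: "sets (P n) = sets \<mu>" and space_P: "space (P n) = space \<mu>"
      by (simp_all add: P[OF n])
    have emP: "emeasure (P n) (space (P n)) = 1"
    proof -
      have "emeasure (P n) (space (P n)) = (\<integral>\<^sup>+z. ennreal (fst (a n) (fst z)) * ennreal (G (snd z)) \<partial>\<mu>)"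
        unfolding space_P unfolding P[OF n]
        by (subst emeasure_density) (auto intro!: nn_integral_cong)
      also have "\<dots> = 1"
        by (subst nn) (simp_all add: state(3)[OF a[OF n]])
      finally show ?thesis .
    qed
    have ini: "distr (P n) A fst = density A (\<lambda>x. ennreal (fst (a n) x))"
    proof (rule measure_eqI)
      fix X assume "X \<in> sets (distr (P n) A fst)"
      then have [measurable]: "X \<in> sets A" by simp
      have "emeasure (distr (P n) A fst) X = emeasure (P n) (fst -` X \<inter> space \<mu>)"
        by (subst emeasure_distr) (simp_all add: space_P)
      also have "\<dots> = (\<integral>\<^sup>+z. ennreal (fst (a n) (fst z)) * ennreal (G (snd z)) * indicator (fst -` X \<inter> space \<mu>) z \<partial>\<mu>)"
        unfolding P[OF n] by (subst emeasure_density) measurable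
      also have "\<dots> = (\<integral>\<^sup>+z. (ennreal (fst (a n) (fst z)) * indicator X (fst z)) * ennreal (G (snd z)) \<partial>\<mu>)"
        by (intro nn_integral_cong) (auto simp: indicator_def)
      also have "\<dots> = (\<integral>\<^sup>+x. ennreal (fst (a n) x) * indicator X x \<partial>A)"
        by (rule nn) measurable
      also have "\<dots> = emeasure (density A (\<lambda>x. ennreal (fst (a n) x))) X"
        by (subst emeasure_density) simp_all
      finally show "emeasure (distr (P n) A fst) X = emeasure (density A (\<lambda>x. ennreal (fst (a n) x))) X" .
    qed simp
    have fin: "distr (P n) A (\<lambda>z. fst (\<phi> z)) = density A (\<lambda>x. ennreal (fst b x))"
      using takes[OF n] by (simp add: classical_takes_def cm_marginal_sys_def P_def A_def \<phi>_def)
    have m1[measurable]: "(\<lambda>z. fst (\<phi> z)) \<in> measurable (P n) A"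
      "fst \<in> measurable (P n) A" by measurable
    \<comment> \<open>Finite entropy means that \<open>ln\<close> of the density is integrable for
      the state itself; the marginals \<open>ini\<close> and \<open>fin\<close> then pull this back
      to the run.\<close>
    have log: "integrable (density A (\<lambda>x. ennreal (fst c x))) (\<lambda>x. ln (fst c x))"
      "(\<integral>x. ln (fst c x) \<partial>density A (\<lambda>x. ennreal (fst c x))) = (\<integral>x. fst c x * ln (fst c x) \<partial>A)"
      if c: "classical_state S c" "classical_entropy_finite S c" for c
    proof -
      note [measurable] = state(1)[OF c(1)]
      have "AE x in A. 0 \<le> fst c x" using state(2)[OF c(1)] by (rule AE_I2)
      moreover have "integrable A (\<lambda>x. fst c x * ln (fst c x))"
        using c(2) by (simp add: classical_entropy_finite_def A_def)
      ultimately show "integrable (density A (\<lambda>x. ennreal (fst c x))) (\<lambda>x. ln (fst c x))"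
        "(\<integral>x. ln (fst c x) \<partial>density A (\<lambda>x. ennreal (fst c x))) = (\<integral>x. fst c x * ln (fst c x) \<partial>A)"
        by (simp_all add: integrable_density integral_density)
    qed
    have la: "integrable (P n) (\<lambda>z. ln (fst (a n) (fst z)))"
      "(\<integral>z. ln (fst (a n) (fst z)) \<partial>P n) = (\<integral>x. fst (a n) x * ln (fst (a n) x) \<partial>A)"
      using log[OF a[OF n] sa[OF n]] unfolding ini[symmetric]
      by (simp_all add: integrable_distr_eq integral_distr)
    have lb: "integrable (P n) (\<lambda>z. ln (fst b (fst (\<phi> z))))"
      "(\<integral>z. ln (fst b (fst (\<phi> z))) \<partial>P n) = (\<integral>x. fst b x * ln (fst b x) \<partial>A)"
      using log[OF b sb] unfolding fin[symmetric]
      by (simp_all add: integrable_distr_eq integral_distr)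
    have H: "integrable (P n) (\<lambda>z. c_res_ham S i (snd (cm_flow M \<tau> z) i))"
      "(\<integral>z. c_res_ham S i (snd (cm_flow M \<tau> z) i) \<partial>P n) =
        (\<integral>x. c_res_ham S i x \<partial>cm_marginal_res k S M (a n) i \<tau>)"
      if i: "i \<in> I" and \<tau>: "\<tau> \<in> {cm_start M, cm_end M}" for i \<tau>
    proof -
      have "cm_flow M \<tau> \<in> measurable \<mu> \<mu>" using \<phi> \<tau> by (auto simp: \<phi>_def \<phi>0_def)
      from measurable_compose[OF this snd_m[OF i]]
      have m: "(\<lambda>z. snd (cm_flow M \<tau> z) i) \<in> measurable (P n) (liouville (c_res S i))"
        by (simp add: measurable_cong_sets[OF sets_P refl])
      have "integrable (cm_marginal_res k S M (a n) i \<tau>) (c_res_ham S i)"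
        using en[OF n] i \<tau> by (auto simp: classical_energies_finite_def I_def)
      then show "integrable (P n) (\<lambda>z. c_res_ham S i (snd (cm_flow M \<tau> z) i))"
        "(\<integral>z. c_res_ham S i (snd (cm_flow M \<tau> z) i) \<partial>P n) =
          (\<integral>x. c_res_ham S i x \<partial>cm_marginal_res k S M (a n) i \<tau>)"
        unfolding cm_marginal_res_def P_def[symmetric]
        by (simp_all add: integrable_distr_eq[OF m classical_settingD(3)[OF S]]
            integral_distr[OF m classical_settingD(3)[OF S]])
    qed
    \<comment> \<open>the logarithm of the initial density at \<open>z\<close> over \<open>gb (\<phi> z)\<close>; the partition functions cancel\<close>
    define W where "W z = ln (fst (a n) (fst z)) - ln (fst b (fst (\<phi> z)))
      + (\<Sum>i\<in>I. (c_res_ham S i (snd (\<phi> z) i) - c_res_ham S i (snd (\<phi>0 z) i)) / (k * c_temp S i))" for z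
    have intW: "(\<integral>z. W z \<partial>P n) = (\<integral>x. fst (a n) x * ln (fst (a n) x) \<partial>A) - (\<integral>x. fst b x * ln (fst b x) \<partial>A)
      + (\<Sum>i\<in>I. ((\<integral>x. c_res_ham S i x \<partial>cm_marginal_res k S M (a n) i (cm_end M))
          - (\<integral>x. c_res_ham S i x \<partial>cm_marginal_res k S M (a n) i (cm_start M))) / (k * c_temp S i))"
      and W: "integrable (P n) W"
      unfolding W_def \<phi>_def \<phi>0_def using la lb H by (simp_all add: \<phi>_def)
    have sigma: "(\<Sum>i\<in>I. ((\<integral>x. c_res_ham S i x \<partial>cm_marginal_res k S M (a n) i (cm_end M))
          - (\<integral>x. c_res_ham S i x \<partial>cm_marginal_res k S M (a n) i (cm_start M))) / (k * c_temp S i))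
        = - (classical_sigma k S M (a n) / k)"
      unfolding classical_sigma_def sum_divide_distrib sum_negf[symmetric] I_def
      by (rule sum.cong) (simp_all add: classical_heat_def mult.commute del: minus_diff_eq)
    have "ennreal (exp (classical_sigma k S M (a n) / k - (\<integral>x. fst (a n) x * ln (fst (a n) x) \<partial>A)
      + (\<integral>x. fst b x * ln (fst b x) \<partial>A))) = ennreal (exp (- (\<integral>z. W z \<partial>P n)))"
      unfolding intW sigma by (simp add: algebra_simps)
    also have "\<dots> \<le> (\<integral>\<^sup>+z. ennreal (exp (- W z)) \<partial>P n)"
      by (rule exp_jensen_integral[OF emP W])
    also have "\<dots> = (\<integral>\<^sup>+z. ennreal (fst (a n) (fst z)) * ennreal (G (snd z)) * ennreal (exp (- W z)) \<partial>\<mu>)"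
    proof -
      have "W \<in> borel_measurable \<mu>"
        using borel_measurable_integrable[OF W] by (simp add: measurable_cong_sets[OF sets_P refl])
      then show ?thesis
        unfolding P[OF n] by (subst nn_integral_density) auto
    qed
    also have "\<dots> \<le> x n"
      unfolding x_def
    proof (rule nn_integral_mono_AE)
      \<comment> \<open>The zeros of \<open>b\<close> form a null set for the final marginal, which
        is \<open>b\<close> itself, so the points where \<open>ln (fst b (fst (\<phi> z)))\<close>
        says nothing can be discarded.\<close>
      have "AE x in density A (\<lambda>x. ennreal (fst b x)). fst b x \<noteq> 0"
        by (subst AE_density) auto
      then have "AE z in P n. fst b (fst (\<phi> z)) \<noteq> 0"
        unfolding fin[symmetric] by (subst (asm) AE_distr_iff) auto
      then have "AE z in \<mu>. ennreal (fst (a n) (fst z)) * ennreal (G (snd z)) > 0 \<longrightarrow> fst b (fst (\<phi> z)) \<noteq> 0"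
        unfolding P[OF n] by (subst (asm) AE_density) auto
      then show "AE z in \<mu>. ennreal (fst (a n) (fst z)) * ennreal (G (snd z)) * ennreal (exp (- W z)) \<le>
          (if fst (a n) (fst z) > 0 then 1 else 0) * ennreal (gb (\<phi> z))"
      proof (rule AE_mp, intro AE_I2 impI)
        fix z assume z: "z \<in> space \<mu>"
          and bz: "ennreal (fst (a n) (fst z)) * ennreal (G (snd z)) > 0 \<longrightarrow> fst b (fst (\<phi> z)) \<noteq> 0"
        show "ennreal (fst (a n) (fst z)) * ennreal (G (snd z)) * ennreal (exp (- W z)) \<le>
          (if fst (a n) (fst z) > 0 then 1 else 0) * ennreal (gb (\<phi> z))"
        proof (cases "fst (a n) (fst z) > 0")
          case True
          then have "ennreal (fst (a n) (fst z)) * ennreal (G (snd z)) > 0"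
            using G0 by (simp add: ennreal_zero_less_mult_iff)
          with bz have "fst b (fst (\<phi> z)) > 0"
            using state(2)[OF b space(1)[OF space(2)[OF z]]] by simp
          then have "fst (a n) (fst z) * G (snd z) * exp (- W z) = gb (\<phi> z)"
            unfolding gb_def G_def bath_density_exp[OF S I] W_def id[OF z]
            using True
            by (simp add: exp_diff exp_add exp_minus sum_subtractf diff_divide_distrib sum_negf field_simps)
          then have "ennreal (fst (a n) (fst z)) * ennreal (G (snd z)) * ennreal (exp (- W z)) = ennreal (gb (\<phi> z))"
            using True G0 by (simp add: less_imp_le flip: ennreal_mult)
          then show ?thesis using True by simp
        qed (simp add: ennreal_neg)
      qed
    qed
    finally show ?thesis .
  qed

  have "ennreal (\<Sum>n\<in>N. exp (classical_sigma k S M (a n) / k - (\<integral>x. fst (a n) x * ln (fst (a n) x) \<partial>A)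
      + (\<integral>x. fst b x * ln (fst b x) \<partial>A))) \<le> (\<Sum>n\<in>N. x n)"
    by (subst sum_ennreal[symmetric]) (simp, intro sum_mono main)
  also have "\<dots> = (\<integral>\<^sup>+z. (\<Sum>n\<in>N. (if fst (a n) (fst z) > 0 then 1 else 0) * ennreal (gb (\<phi> z))) \<partial>\<mu>)"
    unfolding x_def
  proof (rule nn_integral_sum[symmetric])
    fix n assume "n \<in> N"
    note [measurable] = state(1)[OF a[OF this]]
    show "(\<lambda>z. (if fst (a n) (fst z) > 0 then 1 else 0) * ennreal (gb (\<phi> z))) \<in> borel_measurable \<mu>"
      by measurable
  qed
  also have "\<dots> \<le> (\<integral>\<^sup>+z. ennreal (gb (\<phi> z)) \<partial>\<mu>)"
  proof (rule nn_integral_mono_AE)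
    have "AE z in \<mu>. \<forall>m\<in>N. \<forall>n\<in>N. m \<noteq> n \<longrightarrow> fst (a m) (fst z) = 0 \<or> fst (a n) (fst z) = 0"
    proof (intro AE_finite_allI[OF N])
      fix m n assume mn: "m \<in> N" "n \<in> N"
      note [measurable] = state(1)[OF a[OF mn(1)], unfolded A_def] state(1)[OF a[OF mn(2)], unfolded A_def]
      show "AE z in \<mu>. m \<noteq> n \<longrightarrow> fst (a m) (fst z) = 0 \<or> fst (a n) (fst z) = 0"
      proof (cases "m = n")
        case False
        have "AE z in \<mu>. fst (a m) (fst z) = 0 \<or> fst (a n) (fst z) = 0"
          unfolding \<mu>_def
          by (rule AE_composite_fst[OF S I]) (use dist[OF mn False] in \<open>auto simp: classical_distinguishable_def\<close>)
        then show ?thesis by (rule AE_mp) auto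
      qed simp
    qed
    then show "AE z in \<mu>. (\<Sum>n\<in>N. (if fst (a n) (fst z) > 0 then 1 else 0) * ennreal (gb (\<phi> z))) \<le> ennreal (gb (\<phi> z))"
    proof (rule AE_mp, intro AE_I2 impI)
      fix z assume "z \<in> space \<mu>" and d: "\<forall>m\<in>N. \<forall>n\<in>N. m \<noteq> n \<longrightarrow> fst (a m) (fst z) = 0 \<or> fst (a n) (fst z) = 0"
      let ?N = "{n\<in>N. fst (a n) (fst z) > 0}"
      \<comment> \<open>Off the null set at most one initial density is positive at
        \<open>fst z\<close>, so the indicators add up to at most 1.\<close>
      have "card ?N \<le> 1"
        using d N by (subst card_le_Suc0_iff_eq[unfolded One_nat_def[symmetric]]) force+
      have "(\<Sum>n\<in>N. (if fst (a n) (fst z) > 0 then 1 else 0) * ennreal (gb (\<phi> z))) =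
          (\<Sum>n\<in>?N. ennreal (gb (\<phi> z)))"
        unfolding sum.inter_filter[OF N] by (rule sum.cong) auto
      also have "\<dots> = of_nat (card ?N) * ennreal (gb (\<phi> z))" by simp
      also have "\<dots> \<le> 1 * ennreal (gb (\<phi> z))"
        using \<open>card ?N \<le> 1\<close> by (intro mult_right_mono) (auto simp: of_nat_le_1_iff)
      finally show "(\<Sum>n\<in>N. (if fst (a n) (fst z) > 0 then 1 else 0) * ennreal (gb (\<phi> z))) \<le> ennreal (gb (\<phi> z))"
        by simp
    qed
  qed
  \<comment> \<open>Measure preservation removes \<open>\<phi>\<close>; what remains is the total
    mass of \<open>b\<close> times the canonical densities.\<close>
  also have "\<dots> = (\<integral>\<^sup>+z. ennreal (gb z) \<partial>distr \<mu> \<mu> \<phi>)"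
    by (subst nn_integral_distr) auto
  also have "\<dots> = (\<integral>\<^sup>+z. ennreal (fst b (fst z)) * ennreal (G (snd z)) \<partial>\<mu>)"
    unfolding \<mu>\<phi> gb_def using G0
    by (intro nn_integral_cong ennreal_mult state(2)[OF b] space(1)) (auto intro: less_imp_le)
  also have "\<dots> = 1"
    by (subst nn) (simp_all add: state(3)[OF b])
  finally show ?thesis
    by (simp add: A_def)
qed

section \<open>Unconditional sums\<close>

lemma has_sum_diff:
  fixes f g :: "'a \<Rightarrow> real"
  assumes "(f has_sum s) A" "(g has_sum t) A"
  shows "((\<lambda>a. f a - g a) has_sum s - t) A"
  using has_sum_add[OF assms(1) has_sum_uminusI[OF assms(2)]] by simp

lemma has_sum_sum:
  fixes f :: "'i \<Rightarrow> 'a \<Rightarrow> 'b::topological_comm_monoid_add"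
  assumes "\<And>i. i \<in> I \<Longrightarrow> (f i has_sum s i) A"
  shows "((\<lambda>a. \<Sum>i\<in>I. f i a) has_sum (\<Sum>i\<in>I. s i)) A"
  using assms by (induction I rule: infinite_finite_induct) (auto intro: has_sum_add)

lemma has_sum_Times:
  fixes f :: "'a \<Rightarrow> 'c::{banach,real_normed_field}"
  assumes "(f has_sum s) A" "(g has_sum t) B" "(\<lambda>x. norm (f x)) summable_on A" "(\<lambda>y. norm (g y)) summable_on B"
  shows "((\<lambda>(x, y). f x * g y) has_sum s * t) (A \<times> B)"
proof (rule has_sum_SigmaI)
  show "((\<lambda>y. case (x, y) of (x, y) \<Rightarrow> f x * g y) has_sum f x * t) B" for x
    using has_sum_cmult_right[OF assms(2)] by simp
  show "((\<lambda>x. f x * t) has_sum s * t) A"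
    by (rule has_sum_cmult_left[OF assms(1)])
  have "(\<lambda>p. norm (f (fst p) * g (snd p))) summable_on A \<times> B"
    unfolding norm_mult
  proof (rule summable_on_SigmaI)
    show "((\<lambda>y. norm (f (fst (x, y))) * norm (g (snd (x, y)))) has_sum
        norm (f x) * (\<Sum>\<^sub>\<infinity>y\<in>B. norm (g y))) B" for x
      unfolding fst_conv snd_conv by (rule has_sum_cmult_right[OF has_sum_infsum[OF assms(4)]])
  qed (rule summable_on_cmult_left[OF assms(3)], simp)
  then show "(\<lambda>(x, y). f x * g y) summable_on A \<times> B"
    unfolding case_prod_unfold by (rule abs_summable_summable)
qed

lemma has_sum_Times_real:
  fixes f :: "'a \<Rightarrow> real" and g :: "'b \<Rightarrow> real"
  assumes "(f has_sum s) A" "(g has_sum t) B"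
  shows "((\<lambda>(x, y). f x * g y) has_sum s * t) (A \<times> B)"
  by (intro has_sum_Times assms summable_on_iff_abs_summable_on_real[THEN iffD1]
      has_sum_imp_summable[OF assms(1)] has_sum_imp_summable[OF assms(2)])

lemma has_sum_Times_complex:
  fixes f :: "'a \<Rightarrow> complex" and g :: "'b \<Rightarrow> complex"
  assumes "(f has_sum s) A" "(g has_sum t) B"
  shows "((\<lambda>(x, y). f x * g y) has_sum s * t) (A \<times> B)"
  by (intro has_sum_Times assms summable_on_iff_abs_summable_on_complex[THEN iffD1]
      has_sum_imp_summable[OF assms(1)] has_sum_imp_summable[OF assms(2)])

lemma summable_on_Times_real:
  fixes f :: "'a \<Rightarrow> real" and g :: "'b \<Rightarrow> real"
  assumes "f summable_on A" "g summable_on B"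
  shows "(\<lambda>(x, y). f x * g y) summable_on A \<times> B"
  using has_sum_Times_real[OF has_sum_infsum[OF assms(1)] has_sum_infsum[OF assms(2)]]
  by (rule has_sum_imp_summable)

lemma has_sum_SigmaI_nonneg:
  fixes f :: "'a \<times> 'b \<Rightarrow> real"
  assumes "\<And>x. x \<in> A \<Longrightarrow> ((\<lambda>y. f (x, y)) has_sum g x) (B x)" "(g has_sum S) A"
    and "\<And>x y. x \<in> A \<Longrightarrow> y \<in> B x \<Longrightarrow> f (x, y) \<ge> 0"
  shows "(f has_sum S) (Sigma A B)"
  by (rule has_sum_SigmaI[OF assms(1,2)], assumption,
      rule summable_on_SigmaI[OF assms(1) has_sum_imp_summable[OF assms(2)] assms(3)])

text \<open>The common value is called \<open>infsum g A\<close> because in the applications one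
  iterated sum is an \<open>infsum\<close> by definition (an inner product, or an entry of
  \<open>mat_app\<close>) and the other one is to be computed.\<close>

lemma has_sum_Times_exchange:
  fixes f :: "'a \<times> 'b \<Rightarrow> 'c::banach"
  assumes "f summable_on A \<times> B"
    and "\<And>x. x \<in> A \<Longrightarrow> ((\<lambda>y. f (x, y)) has_sum g x) B"
    and "\<And>y. y \<in> B \<Longrightarrow> ((\<lambda>x. f (x, y)) has_sum h y) A"
  shows "(g has_sum infsum g A) A" "(h has_sum infsum g A) B"
proof -
  have f: "(f has_sum infsum f (A \<times> B)) (A \<times> B)"
    using assms(1) by (rule has_sum_infsum)
  then have g: "(g has_sum infsum f (A \<times> B)) A"
    using assms(2) by (rule has_sum_SigmaD)
  then show "(g has_sum infsum g A) A"
    by (simp add: has_sum_imp_summable)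
  from f have "((\<lambda>(y, x). f (x, y)) has_sum infsum f (A \<times> B)) (B \<times> A)"
    by (subst (asm) has_sum_swap)
  then have "(h has_sum infsum f (A \<times> B)) B"
    by (rule has_sum_SigmaD) (use assms(3) in simp)
  then show "(h has_sum infsum g A) B"
    using infsumI[OF g] by simp
qed

text \<open>The mean of a function of one component depends only on the marginal \<open>m\<close> of
  that component; \<open>\<gamma>\<close> splits a label into the component and the rest.
  Unconditional convergence of a real sum is absolute, so \<open>P \<ge> 0\<close> lets the
  convergence of the marginal sum control the full one.\<close>

lemma has_sum_disintegrate:
  fixes P :: "'a \<Rightarrow> real"
  assumes bij: "bij_betw \<gamma> (B \<times> C) A"
    and nonneg: "\<And>a. a \<in> A \<Longrightarrow> P a \<ge> 0"
    and h: "\<And>b c. b \<in> B \<Longrightarrow> c \<in> C \<Longrightarrow> h (\<gamma> (b, c)) = b"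
    and m: "\<And>b. b \<in> B \<Longrightarrow> ((\<lambda>c. P (\<gamma> (b, c))) has_sum m b) C"
    and s: "((\<lambda>b. m b * u b) has_sum s) B"
  shows "((\<lambda>a. P a * u (h a)) has_sum s) A"
proof -
  have P: "P (\<gamma> (b, c)) \<ge> 0" if "b \<in> B" "c \<in> C" for b c
    using that bij_betwE[OF bij] nonneg by blast
  have m0: "m b \<ge> 0" if "b \<in> B" for b
    using has_sum_nonneg[OF m[OF that]] P that by blast
  have abs: "(\<lambda>b. m b * \<bar>u b\<bar>) summable_on B"
    using has_sum_imp_summable[OF s] m0
    by (subst (asm) summable_on_iff_abs_summable_on_real) (simp add: abs_mult cong: summable_on_cong)
  have "(\<lambda>(b, c). P (\<gamma> (b, c)) * \<bar>u b\<bar>) summable_on B \<times> C"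
    using has_sum_cmult_left[OF m] P
    by (intro summable_on_SigmaI[where g = "\<lambda>b. m b * \<bar>u b\<bar>"] abs) auto
  then have "(\<lambda>(b, c). P (\<gamma> (b, c)) * u b) summable_on B \<times> C"
    by (subst summable_on_iff_abs_summable_on_real, subst summable_on_cong[where
          g = "\<lambda>(b, c). P (\<gamma> (b, c)) * \<bar>u b\<bar>"]) (auto simp: abs_mult P)
  then have "((\<lambda>(b, c). P (\<gamma> (b, c)) * u b) has_sum s) (B \<times> C)"
    using has_sum_cmult_left[OF m] by (intro has_sum_SigmaI[OF _ s]) auto
  then have "((\<lambda>p. P (\<gamma> p) * u (h (\<gamma> p))) has_sum s) (B \<times> C)"
    by (rule has_sum_cong[THEN iffD1, rotated]) (auto simp: h)
  then show ?thesis
    by (rule has_sum_reindex_bij_betw[OF bij, THEN iffD1])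
qed

text \<open>For joint laws on pairs of labels: here a component of the first label is singled out,
  in the next lemma one of the second, and the marginal is taken over the rest of that label
  together with the whole other label.\<close>

lemma has_sum_disintegrate_fst:
  fixes P :: "'z \<Rightarrow> 'd \<Rightarrow> real"
  assumes bij: "bij_betw \<beta> (B \<times> C) Z" and nonneg: "\<And>z d. z \<in> Z \<Longrightarrow> d \<in> D \<Longrightarrow> P z d \<ge> 0"
    and h: "\<And>b c. b \<in> B \<Longrightarrow> c \<in> C \<Longrightarrow> h (\<beta> (b, c)) = b"
    and m: "\<And>b. b \<in> B \<Longrightarrow> ((\<lambda>(c, d). P (\<beta> (b, c)) d) has_sum m b) (C \<times> D)"
    and s: "((\<lambda>b. m b * u b) has_sum s) B"
  shows "((\<lambda>(z, d). P z d * u (h z)) has_sum s) (Z \<times> D)"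
proof -
  have "bij_betw (\<lambda>(b, c, d). (\<beta> (b, c), d)) (B \<times> C \<times> D) (Z \<times> D)"
    using bij unfolding bij_betw_def inj_on_def by (auto simp: image_iff) blast+
  from has_sum_disintegrate[OF this, of "\<lambda>(z, d). P z d" "\<lambda>(z, d). h z" m u s] show ?thesis
    using nonneg h m s by (simp add: case_prod_unfold mem_Times_iff)
qed

lemma has_sum_disintegrate_snd:
  fixes P :: "'d \<Rightarrow> 'z \<Rightarrow> real"
  assumes bij: "bij_betw \<beta> (B \<times> C) Z" and nonneg: "\<And>d z. d \<in> D \<Longrightarrow> z \<in> Z \<Longrightarrow> P d z \<ge> 0"
    and h: "\<And>b c. b \<in> B \<Longrightarrow> c \<in> C \<Longrightarrow> h (\<beta> (b, c)) = b"
    and m: "\<And>b. b \<in> B \<Longrightarrow> ((\<lambda>(d, c). P d (\<beta> (b, c))) has_sum m b) (D \<times> C)"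
    and s: "((\<lambda>b. m b * u b) has_sum s) B"
  shows "((\<lambda>(d, z). P d z * u (h z)) has_sum s) (D \<times> Z)"
proof -
  have "bij_betw (\<lambda>(b, d, c). (d, \<beta> (b, c))) (B \<times> D \<times> C) (D \<times> Z)"
    using bij unfolding bij_betw_def inj_on_def by (auto simp: image_iff) blast+
  from has_sum_disintegrate[OF this, of "\<lambda>(d, z). P d z" "\<lambda>(d, z). h z" m u s] show ?thesis
    using nonneg h m s by (simp add: case_prod_unfold mem_Times_iff)
qed

lemma exp_jensen_has_sum:
  fixes P W :: "'a \<Rightarrow> real"
  assumes "(P has_sum 1) A" "((\<lambda>a. P a * W a) has_sum w) A" "(h has_sum x) A"
    and "\<And>a. a \<in> A \<Longrightarrow> P a \<ge> 0" "\<And>a. a \<in> A \<Longrightarrow> P a * exp (- W a) \<le> h a"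
  shows "exp (- w) \<le> x"
proof (rule has_sum_mono)
  have "((\<lambda>a. exp (- w) * (P a + - (P a * W a) + P a * w)) has_sum exp (- w) * (1 + - w + 1 * w)) A"
    by (intro has_sum_cmult_right has_sum_add has_sum_cmult_left)
      (use assms has_sum_uminus in \<open>auto simp: has_sum_uminus\<close>)
  then show "((\<lambda>a. exp (- w) * (P a + - (P a * W a) + P a * w)) has_sum exp (- w)) A"
    by simp
  show "exp (- w) * (P a + - (P a * W a) + P a * w) \<le> h a" if "a \<in> A" for a
  proof -
    have "exp (- w) * (1 + (w - W a)) \<le> exp (- w) * exp (w - W a)"
      by (intro mult_left_mono exp_ge_add_one_self) auto
    also have "\<dots> = exp (- W a)"
      by (simp flip: exp_add)
    finally have "P a * (exp (- w) * (1 + (w - W a))) \<le> P a * exp (- W a)"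
      using assms(4)[OF that] by (rule mult_left_mono)
    then show ?thesis
      using assms(5)[OF that] by (simp add: algebra_simps)
  qed
qed (use assms in auto)

lemma has_sum_complexI:
  fixes f :: "'a \<Rightarrow> complex"
  assumes "((\<lambda>a. Re (f a)) has_sum Re s) A" "((\<lambda>a. Im (f a)) has_sum Im s) A"
  shows "(f has_sum s) A"
proof -
  have "((\<lambda>a. complex_of_real (Re (f a)) + \<i> * complex_of_real (Im (f a))) has_sum
          complex_of_real (Re s) + \<i> * complex_of_real (Im s)) A"
    using assms by (intro has_sum_add has_sum_cmult_right has_sum_of_real)
  then show ?thesis
    by (simp flip: complex_eq)
qed

lemma summable_on_complex_comparison:
  fixes f :: "'a \<Rightarrow> complex"
  assumes "g summable_on A" "\<And>x. x \<in> A \<Longrightarrow> cmod (f x) \<le> g x"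
  shows "f summable_on A"
  by (rule abs_summable_summable, rule Infinite_Sum.abs_summable_on_comparison_test'[OF assms])

text \<open>Source of most majorants below: products of amplitudes are bounded by squares, which sum
  to norms or traces.\<close>

lemma mult_le_half_squares: "a * b \<le> (a\<^sup>2 + b\<^sup>2) / (2::real)"
  using sum_squares_bound[of a b] by simp

section \<open>Orthonormal bases of \<open>\<ell>\<^sup>2(X)\<close>\<close>

definition l2sq :: "'x set \<Rightarrow> ('x \<Rightarrow> complex) \<Rightarrow> real" where
  "l2sq X \<psi> = (\<Sum>\<^sub>\<infinity>x\<in>X. (cmod (\<psi> x))\<^sup>2)"

lemma ell2_has_sum: "\<psi> \<in> ell2 X \<Longrightarrow> ((\<lambda>x. (cmod (\<psi> x))\<^sup>2) has_sum l2sq X \<psi>) X"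
  by (simp add: ell2_def l2sq_def)

lemma l2sq_nonneg: "l2sq X \<psi> \<ge> 0"
  by (simp add: l2sq_def infsum_nonneg)

lemma l2inner_has_sum:
  assumes "\<psi> \<in> ell2 X" "\<phi> \<in> ell2 X"
  shows "((\<lambda>x. cnj (\<psi> x) * \<phi> x) has_sum l2inner X \<psi> \<phi>) X"
proof -
  have "(\<lambda>x. ((cmod (\<psi> x))\<^sup>2 + (cmod (\<phi> x))\<^sup>2) * (1 / 2)) summable_on X"
    using assms by (intro summable_on_cmult_left summable_on_add) (auto simp: ell2_def)
  then have "(\<lambda>x. cnj (\<psi> x) * \<phi> x) summable_on X"
    by (rule summable_on_complex_comparison) (use mult_le_half_squares in \<open>simp add: norm_mult\<close>)
  then show ?thesis
    by (simp add: l2inner_def)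
qed

lemma ell2_linear:
  assumes "\<psi> \<in> ell2 X" "\<phi> \<in> ell2 X"
  shows "(\<lambda>x. c * \<psi> x + \<phi> x) \<in> ell2 X"
proof -
  have "(\<lambda>x. 2 * ((cmod c)\<^sup>2 * (cmod (\<psi> x))\<^sup>2) + 2 * (cmod (\<phi> x))\<^sup>2) summable_on X"
    using assms by (intro summable_on_cmult_right summable_on_add) (auto simp: ell2_def)
  moreover have "(cmod (c * u + v))\<^sup>2 \<le> 2 * ((cmod c)\<^sup>2 * (cmod u)\<^sup>2) + 2 * (cmod v)\<^sup>2" for u v
  proof -
    have "(cmod (c * u + v))\<^sup>2 \<le> (cmod (c * u) + cmod v)\<^sup>2"
      by (intro power_mono norm_triangle_ineq) auto
    also have "\<dots> \<le> 2 * (cmod (c * u))\<^sup>2 + 2 * (cmod v)\<^sup>2"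
      using sum_squares_bound[of "cmod (c * u)" "cmod v"] by (simp add: power2_sum)
    finally show ?thesis by (simp add: norm_mult power_mult_distrib)
  qed
  ultimately have "(\<lambda>x. (cmod (c * \<psi> x + \<phi> x))\<^sup>2) summable_on X"
    by (rule summable_on_comparison_test) auto
  then show ?thesis
    using assms by (auto simp: ell2_def)
qed

lemma ell2_0 [simp]: "(\<lambda>x. 0) \<in> ell2 X"
  by (simp add: ell2_def)

lemma ell2_sum:
  assumes "finite F" "\<And>j. j \<in> F \<Longrightarrow> e j \<in> ell2 X"
  shows "(\<lambda>x. \<Sum>j\<in>F. c j * e j x) \<in> ell2 X"
  using assms by (induction F) (auto intro: ell2_linear)

lemma ell2_ket: "x \<in> X \<Longrightarrow> ket x \<in> ell2 X"
  using summable_on_cong_neutral[of "{x}" X "\<lambda>y. (cmod (ket x y))\<^sup>2" "\<lambda>y. (cmod (ket x y))\<^sup>2"]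
  by (auto simp: ell2_def ket_def)

lemma l2inner_cnj: "cnj (l2inner X \<psi> \<phi>) = l2inner X \<phi> \<psi>"
  by (simp add: l2inner_def mult.commute flip: infsum_cnj)

lemma l2inner_same: "\<psi> \<in> ell2 X \<Longrightarrow> l2inner X \<psi> \<psi> = complex_of_real (l2sq X \<psi>)"
  using has_sum_of_real[OF ell2_has_sum, of \<psi> X, where ?'a = complex]
  by (intro has_sum_unique[OF l2inner_has_sum]) (auto simp: complex_norm_square mult.commute simp flip: of_real_power)

lemma l2inner_linear_right:
  assumes "\<eta> \<in> ell2 X" "\<psi> \<in> ell2 X" "\<phi> \<in> ell2 X"
  shows "l2inner X \<eta> (\<lambda>x. c * \<psi> x + \<phi> x) = c * l2inner X \<eta> \<psi> + l2inner X \<eta> \<phi>"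
proof (rule has_sum_unique[OF l2inner_has_sum])
  show "((\<lambda>x. cnj (\<eta> x) * (c * \<psi> x + \<phi> x)) has_sum c * l2inner X \<eta> \<psi> + l2inner X \<eta> \<phi>) X"
    using has_sum_add[OF has_sum_cmult_right[OF l2inner_has_sum[OF assms(1,2)], of c]
        l2inner_has_sum[OF assms(1,3)]] by (simp add: algebra_simps)
qed (use assms ell2_linear in auto)

lemma l2inner_0_right [simp]: "l2inner X \<eta> (\<lambda>x. 0) = 0"
  by (simp add: l2inner_def)

lemma l2inner_cmult_right:
  assumes "\<eta> \<in> ell2 X" "\<psi> \<in> ell2 X"
  shows "l2inner X \<eta> (\<lambda>x. c * \<psi> x) = c * l2inner X \<eta> \<psi>"
  using l2inner_linear_right[OF assms ell2_0, of c] by simp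

lemma l2inner_sum_right:
  assumes "finite F" "\<And>j. j \<in> F \<Longrightarrow> e j \<in> ell2 X" "\<eta> \<in> ell2 X"
  shows "l2inner X \<eta> (\<lambda>x. \<Sum>j\<in>F. c j * e j x) = (\<Sum>j\<in>F. c j * l2inner X \<eta> (e j))"
  using assms(1,2) by (induction F) (auto simp: l2inner_linear_right assms(3) ell2_sum)

lemma l2inner_ket: "x \<in> X \<Longrightarrow> l2inner X (ket x) \<psi> = \<psi> x"
  using infsum_cong_neutral[of "{x}" X "\<lambda>y. cnj (ket x y) * \<psi> y" "\<lambda>y. cnj (ket x y) * \<psi> y"]
  by (auto simp: l2inner_def ket_def)

lemma cmod_linear_square:
  "(cmod (c * u + v))\<^sup>2 = (cmod c)\<^sup>2 * (cmod u)\<^sup>2 + (cmod v)\<^sup>2 + 2 * Re (c * (cnj v * u))"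
  by (simp only: cmod_power2) (simp add: power2_eq_square algebra_simps)

lemma l2sq_linear:
  assumes "\<psi> \<in> ell2 X" "\<phi> \<in> ell2 X"
  shows "l2sq X (\<lambda>x. c * \<psi> x + \<phi> x) =
    (cmod c)\<^sup>2 * l2sq X \<psi> + l2sq X \<phi> + 2 * Re (c * l2inner X \<phi> \<psi>)"
proof -
  have "((\<lambda>x. (cmod (c * \<psi> x + \<phi> x))\<^sup>2) has_sum
     (cmod c)\<^sup>2 * l2sq X \<psi> + l2sq X \<phi> + 2 * Re (c * l2inner X \<phi> \<psi>)) X"
    unfolding cmod_linear_square using assms
    by (intro has_sum_add has_sum_cmult_right has_sum_Re l2inner_has_sum ell2_has_sum)
  then show ?thesis
    using has_sum_unique[OF ell2_has_sum[OF ell2_linear[OF assms]]] by blast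
qed

text \<open>Completing the square in the coefficients. Taking
  \<open>c j = l2inner X (e j) \<psi>\<close> yields Bessel's inequality; leaving \<open>c\<close>
  arbitrary lets density of the span yield the converse estimate.\<close>

lemma l2sq_diff_sum:
  assumes F: "finite F" "\<And>j. j \<in> F \<Longrightarrow> e j \<in> ell2 X"
    and orth: "\<And>i j. i \<in> F \<Longrightarrow> j \<in> F \<Longrightarrow> l2inner X (e i) (e j) = (if i = j then 1 else 0)"
    and \<psi>: "\<psi> \<in> ell2 X"
  shows "l2sq X (\<lambda>x. \<psi> x - (\<Sum>j\<in>F. c j * e j x)) =
    l2sq X \<psi> - (\<Sum>j\<in>F. (cmod (l2inner X (e j) \<psi>))\<^sup>2) + (\<Sum>j\<in>F. (cmod (c j - l2inner X (e j) \<psi>))\<^sup>2)"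
proof -
  define \<phi> where "\<phi> = (\<lambda>x. \<Sum>j\<in>F. c j * e j x)"
  have \<phi>: "\<phi> \<in> ell2 X"
    unfolding \<phi>_def using F by (rule ell2_sum)
  have ej: "l2inner X (e j) \<phi> = c j" if "j \<in> F" for j
    unfolding \<phi>_def using F that by (subst l2inner_sum_right) (auto simp: orth if_distrib cong: if_cong)
  have "l2inner X \<phi> \<phi> = (\<Sum>j\<in>F. c j * cnj (l2inner X (e j) \<phi>))"
    unfolding l2inner_cnj by (subst (2) \<phi>_def, subst l2inner_sum_right) (use F \<phi> in auto)
  then have "complex_of_real (l2sq X \<phi>) = complex_of_real (\<Sum>j\<in>F. (cmod (c j))\<^sup>2)"
    using \<phi> by (simp add: ej l2inner_same complex_norm_square flip: of_real_power)
  then have norm: "l2sq X \<phi> = (\<Sum>j\<in>F. (cmod (c j))\<^sup>2)"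
    by (simp only: of_real_eq_iff)
  have cross: "l2inner X \<psi> \<phi> = (\<Sum>j\<in>F. c j * cnj (l2inner X (e j) \<psi>))"
    unfolding l2inner_cnj by (subst \<phi>_def, subst l2inner_sum_right) (use F \<psi> in auto)
  have "l2sq X (\<lambda>x. \<psi> x - \<phi> x) = l2sq X \<psi> + l2sq X \<phi> - 2 * Re (l2inner X \<psi> \<phi>)"
    using l2sq_linear[OF \<phi> \<psi>, of "-1"] by simp
  also have "\<dots> = l2sq X \<psi> + (\<Sum>j\<in>F. (cmod (c j))\<^sup>2 - 2 * Re (c j * cnj (l2inner X (e j) \<psi>)))"
    by (simp add: norm cross sum_subtractf sum_distrib_left)
  also have "\<dots> = l2sq X \<psi> + (\<Sum>j\<in>F. (cmod (c j - l2inner X (e j) \<psi>))\<^sup>2 - (cmod (l2inner X (e j) \<psi>))\<^sup>2)"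
  proof -
    have "(cmod u)\<^sup>2 - 2 * Re (u * cnj v) = (cmod (u - v))\<^sup>2 - (cmod v)\<^sup>2" for u v
      by (simp only: cmod_power2) (simp add: power2_eq_square algebra_simps)
    then show ?thesis by simp
  qed
  finally show ?thesis
    by (simp add: \<phi>_def sum_subtractf)
qed

lemma bessel:
  assumes "finite F" "\<And>j. j \<in> F \<Longrightarrow> e j \<in> ell2 X"
    and "\<And>i j. i \<in> F \<Longrightarrow> j \<in> F \<Longrightarrow> l2inner X (e i) (e j) = (if i = j then 1 else 0)"
    and "\<psi> \<in> ell2 X"
  shows "(\<Sum>j\<in>F. (cmod (l2inner X (e j) \<psi>))\<^sup>2) \<le> l2sq X \<psi>"
proof -
  let ?c = "\<lambda>j. l2inner X (e j) \<psi>"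
  have "0 \<le> l2sq X (\<lambda>x. \<psi> x - (\<Sum>j\<in>F. ?c j * e j x))"
    by (rule l2sq_nonneg)
  also have "\<dots> = l2sq X \<psi> - (\<Sum>j\<in>F. (cmod (?c j))\<^sup>2)"
    by (subst l2sq_diff_sum[OF assms]) auto
  finally show ?thesis by simp
qed

text \<open>Completeness is stated as Parseval's identity instead of density of the span, because in
  this form it passes to unitary images and to tensor products by manipulating nonnegative
  sums.\<close>

definition parseval_basis :: "'x set \<Rightarrow> ('x \<Rightarrow> 'x \<Rightarrow> complex) \<Rightarrow> bool" where
  "parseval_basis X e \<longleftrightarrow>
     (\<forall>j\<in>X. e j \<in> ell2 X) \<and>
     (\<forall>i\<in>X. \<forall>j\<in>X. l2inner X (e i) (e j) = (if i = j then 1 else 0)) \<and>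
     (\<forall>\<psi>\<in>ell2 X. ((\<lambda>j. (cmod (l2inner X (e j) \<psi>))\<^sup>2) has_sum l2sq X \<psi>) X)"

lemma parseval_basisD:
  assumes "parseval_basis X e"
  shows "j \<in> X \<Longrightarrow> e j \<in> ell2 X"
    and "i \<in> X \<Longrightarrow> j \<in> X \<Longrightarrow> l2inner X (e i) (e j) = (if i = j then 1 else 0)"
    and "\<psi> \<in> ell2 X \<Longrightarrow> ((\<lambda>j. (cmod (l2inner X (e j) \<psi>))\<^sup>2) has_sum l2sq X \<psi>) X"
  using assms by (auto simp: parseval_basis_def)

lemma orthonormal_basis_imp_parseval:
  assumes "orthonormal_basis X e"
  shows "parseval_basis X e"
proof -
  from assms have e: "\<And>j. j \<in> X \<Longrightarrow> e j \<in> ell2 X"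
    and orth: "\<And>i j. i \<in> X \<Longrightarrow> j \<in> X \<Longrightarrow> l2inner X (e i) (e j) = (if i = j then 1 else 0)"
    and dense: "l2dense X {(\<lambda>x. \<Sum>j\<in>F. c j * e j x) | F c. finite F \<and> F \<subseteq> X}"
    by (auto simp: orthonormal_basis_def)
  have "((\<lambda>j. (cmod (l2inner X (e j) \<psi>))\<^sup>2) has_sum l2sq X \<psi>) X" if \<psi>: "\<psi> \<in> ell2 X" for \<psi>
  proof -
    let ?f = "\<lambda>j. (cmod (l2inner X (e j) \<psi>))\<^sup>2"
    have le: "sum ?f F \<le> l2sq X \<psi>" if "finite F" "F \<subseteq> X" for F
      using that e orth \<psi> by (intro bessel) (auto simp: subset_iff)
    then have summ: "?f summable_on X"
      by (intro nonneg_bdd_above_summable_on) (auto intro!: bdd_aboveI2)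
    have "infsum ?f X \<le> l2sq X \<psi>"
      using summ le by (rule infsum_le_finite_sums)
    moreover have "l2sq X \<psi> \<le> infsum ?f X"
    proof (rule field_le_epsilon)
      fix \<epsilon> :: real assume "\<epsilon> > 0"
      then obtain \<phi> where "\<phi> \<in> {(\<lambda>x. \<Sum>j\<in>F. c j * e j x) | F c. finite F \<and> F \<subseteq> X}"
        and "l2sq X (\<lambda>x. \<psi> x - \<phi> x) < \<epsilon>"
        using dense \<psi> unfolding l2dense_def l2sq_def by meson
      then obtain F c where F: "finite F" "F \<subseteq> X"
        and "l2sq X (\<lambda>x. \<psi> x - (\<Sum>j\<in>F. c j * e j x)) < \<epsilon>"
        by blast
      moreover have "\<And>j. j \<in> F \<Longrightarrow> e j \<in> ell2 X"
        using F e by auto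
      ultimately have "l2sq X \<psi> - sum ?f F + (\<Sum>j\<in>F. (cmod (c j - l2inner X (e j) \<psi>))\<^sup>2) < \<epsilon>"
        using l2sq_diff_sum[of F e X \<psi> c] \<psi> F orth by (simp add: subset_iff)
      moreover have "(\<Sum>j\<in>F. (cmod (c j - l2inner X (e j) \<psi>))\<^sup>2) \<ge> 0"
        by (intro sum_nonneg) auto
      moreover have "sum ?f F \<le> infsum ?f X"
        using summ F by (intro finite_sum_le_infsum) auto
      ultimately show "l2sq X \<psi> \<le> infsum ?f X + \<epsilon>" by linarith
    qed
    ultimately show ?thesis
      using summ by (metis antisym has_sum_infsum)
  qed
  with e orth show ?thesis
    by (simp add: parseval_basis_def)
qed

text \<open>By polarization, one phase \<open>c\<close> giving the real part and another the imaginary part.\<close>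

lemma parseval_inner:
  assumes e: "parseval_basis X e" and \<psi>: "\<psi> \<in> ell2 X" and \<phi>: "\<phi> \<in> ell2 X"
  shows "((\<lambda>j. l2inner X \<psi> (e j) * l2inner X (e j) \<phi>) has_sum l2inner X \<psi> \<phi>) X"
proof -
  have re: "((\<lambda>j. Re (c * (l2inner X \<psi> (e j) * l2inner X (e j) \<phi>))) has_sum
      Re (c * l2inner X \<psi> \<phi>)) X" for c
  proof -
    define S where "S \<xi> = (\<lambda>j. (cmod (l2inner X (e j) \<xi>))\<^sup>2)" for \<xi>
    have S: "(S \<xi> has_sum l2sq X \<xi>) X" if "\<xi> \<in> ell2 X" for \<xi>
      unfolding S_def using parseval_basisD(3)[OF e that] .
    let ?\<xi> = "\<lambda>x. c * \<phi> x + \<psi> x"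
    have "((\<lambda>j. (S ?\<xi> j + - ((cmod c)\<^sup>2 * S \<phi> j) + - S \<psi> j) * (1 / 2)) has_sum
        (l2sq X ?\<xi> + - ((cmod c)\<^sup>2 * l2sq X \<phi>) + - l2sq X \<psi>) * (1 / 2)) X"
      using S[OF ell2_linear[OF \<phi> \<psi>]] S[OF \<phi>] S[OF \<psi>]
      by (intro has_sum_cmult_left has_sum_add has_sum_uminusI has_sum_cmult_right)
    moreover have "(S ?\<xi> j + - ((cmod c)\<^sup>2 * S \<phi> j) + - S \<psi> j) * (1 / 2) =
        Re (c * (l2inner X \<psi> (e j) * l2inner X (e j) \<phi>))" if "j \<in> X" for j
      unfolding S_def l2inner_linear_right[OF parseval_basisD(1)[OF e that] \<phi> \<psi>] cmod_linear_square
      by (simp add: l2inner_cnj[of X "e j" \<psi>, symmetric])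
    ultimately have "((\<lambda>j. Re (c * (l2inner X \<psi> (e j) * l2inner X (e j) \<phi>))) has_sum
        (l2sq X ?\<xi> + - ((cmod c)\<^sup>2 * l2sq X \<phi>) + - l2sq X \<psi>) * (1 / 2)) X"
      by (subst (asm) has_sum_cong) (simp_all del: minus_mult_left minus_mult_right)
    also have "(l2sq X ?\<xi> + - ((cmod c)\<^sup>2 * l2sq X \<phi>) + - l2sq X \<psi>) * (1 / 2) = Re (c * l2inner X \<psi> \<phi>)"
      unfolding l2sq_linear[OF \<phi> \<psi>] by argo
    finally show ?thesis .
  qed
  show ?thesis
    using re[of 1] re[of "- \<i>"] by (intro has_sum_complexI) (auto simp: add.commute)
qed

lemma l2sq_ge_term: "\<psi> \<in> ell2 X \<Longrightarrow> x \<in> X \<Longrightarrow> (cmod (\<psi> x))\<^sup>2 \<le> l2sq X \<psi>"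
  using finite_sum_le_has_sum[OF ell2_has_sum, of \<psi> X "{x}"] by simp

lemma parseval_l2sq: "parseval_basis X e \<Longrightarrow> j \<in> X \<Longrightarrow> l2sq X (e j) = 1"
  using l2inner_same[of "e j" X] parseval_basisD(1,2)[of X e j] parseval_basisD(2)[of X e j j]
  by (metis of_real_eq_1_iff)

lemma parseval_le_1:
  assumes "parseval_basis X e" "j \<in> X" "x \<in> X"
  shows "cmod (e j x) \<le> 1"
  using l2sq_ge_term[OF parseval_basisD(1)[OF assms(1,2)] assms(3)] parseval_l2sq[OF assms(1,2)]
  by (simp add: abs_square_le_1)

text \<open>Bessel's inequality for the family consisting of \<open>f\<close> alone.\<close>

lemma unit_cauchy_schwarz:
  assumes "f \<in> ell2 X" "l2sq X f = 1" "\<psi> \<in> ell2 X"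
  shows "(cmod (l2inner X f \<psi>))\<^sup>2 \<le> l2sq X \<psi>"
  using bessel[of "{f}" "\<lambda>f. f" X \<psi>] assms by (simp add: l2inner_same)

section \<open>Mixtures of vectors, and operators with a spectral decomposition\<close>

lemma has_sum_jensen_square:
  fixes l w :: "'a \<Rightarrow> real"
  assumes "\<And>j. j \<in> A \<Longrightarrow> l j \<ge> 0" "(l has_sum 1) A"
    and "((\<lambda>j. l j * w j) has_sum m) A" "((\<lambda>j. l j * (w j)\<^sup>2) has_sum s) A"
  shows "m\<^sup>2 \<le> s"
proof -
  have "((\<lambda>j. l j * (w j)\<^sup>2 + - (2 * m) * (l j * w j) + m\<^sup>2 * l j) has_sum
      (s + - (2 * m) * m + m\<^sup>2 * 1)) A"
    using assms by (intro has_sum_add has_sum_cmult_right)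
  moreover have "0 \<le> l j * (w j)\<^sup>2 + - (2 * m) * (l j * w j) + m\<^sup>2 * l j" if "j \<in> A" for j
  proof -
    have "0 \<le> l j * (w j - m)\<^sup>2" using assms(1)[OF that] by simp
    then show ?thesis by (simp add: power2_eq_square algebra_simps)
  qed
  ultimately have "0 \<le> s + - (2 * m) * m + m\<^sup>2 * 1"
    by (rule has_sum_nonneg)
  then show ?thesis by (simp add: power2_eq_square)
qed

lemma weighted_unit_vectors_has_sum:
  assumes l: "\<And>j. j \<in> A \<Longrightarrow> l j \<ge> 0" "(l has_sum 1) A"
    and v: "\<And>j. j \<in> A \<Longrightarrow> v j \<in> ell2 X" "\<And>j. j \<in> A \<Longrightarrow> l2sq X (v j) = 1"
  shows "((\<lambda>(j, x). l j * (cmod (v j x))\<^sup>2) has_sum 1) (A \<times> X)"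
proof (rule has_sum_SigmaI_nonneg)
  show "((\<lambda>y. case (j, y) of (j, x) \<Rightarrow> l j * (cmod (v j x))\<^sup>2) has_sum l j) X" if "j \<in> A" for j
    using has_sum_cmult_right[OF ell2_has_sum[OF v(1)[OF that]], of "l j"] v(2)[OF that] by simp
qed (use l in auto)

text \<open>Jensen's inequality for the weights \<open>l\<close> bounds the square of
  \<open>cmod (\<xi> x)\<close> by \<open>C\<^sup>2\<close> times the sum over \<open>j\<close> of
  \<open>l j * (cmod (v j x))\<^sup>2\<close>, which is summable in \<open>x\<close> because the
  \<open>v j\<close> are unit vectors. Inner products then pass under the sum by a dominated
  exchange. Only coordinatewise and weak sums occur, never convergence in norm.\<close>

lemma vector_mixture:
  assumes l: "\<And>j. j \<in> A \<Longrightarrow> l j \<ge> 0" "(l has_sum 1) A"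
    and v: "\<And>j. j \<in> A \<Longrightarrow> v j \<in> ell2 X" "\<And>j. j \<in> A \<Longrightarrow> l2sq X (v j) = 1"
    and c: "\<And>j. j \<in> A \<Longrightarrow> cmod (c j) \<le> C" and "C \<ge> 0"
    and \<xi>: "\<And>x. x \<in> X \<Longrightarrow> ((\<lambda>j. complex_of_real (l j) * c j * v j x) has_sum \<xi> x) A"
    and \<xi>0: "\<And>x. x \<notin> X \<Longrightarrow> \<xi> x = 0"
  shows "\<xi> \<in> ell2 X"
    and "a \<in> ell2 X \<Longrightarrow> ((\<lambda>j. complex_of_real (l j) * c j * l2inner X a (v j)) has_sum l2inner X a \<xi>) A"
proof -
  have "((\<lambda>(x, j). l j * (cmod (v j x))\<^sup>2) has_sum 1) (X \<times> A)"
    using weighted_unit_vectors_has_sum[OF l v] by (subst has_sum_swap) simp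
  then have sv: "(\<lambda>(x, j). l j * (cmod (v j x))\<^sup>2) summable_on X \<times> A"
    by (rule has_sum_imp_summable)
  define s where "s x = (\<Sum>\<^sub>\<infinity>j\<in>A. l j * (cmod (v j x))\<^sup>2)" for x
  have s: "((\<lambda>j. l j * (cmod (v j x))\<^sup>2) has_sum s x) A" if "x \<in> X" for x
    using summable_on_SigmaD1[OF sv that] by (simp add: s_def)
  have "s summable_on X"
    using summable_on_Sigma_banach[OF sv] by (simp add: s_def[abs_def])
  then have "(\<lambda>x. C\<^sup>2 * s x) summable_on X"
    by (rule summable_on_cmult_right)
  moreover have "(cmod (\<xi> x))\<^sup>2 \<le> C\<^sup>2 * s x" if x: "x \<in> X" for x
  proof -
    have v1: "cmod (v j x) \<le> 1" if "j \<in> A" for j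
      using l2sq_ge_term[OF v(1)[OF that] x] v(2)[OF that] by (simp add: abs_square_le_1)
    have "(\<lambda>j. l j * cmod (v j x)) summable_on A"
      using has_sum_imp_summable[OF l(2)] by (rule summable_on_comparison_test)
        (use l(1) v1 in \<open>auto intro: mult_left_le\<close>)
    then obtain m where m: "((\<lambda>j. l j * cmod (v j x)) has_sum m) A"
      by (auto simp: summable_on_def)
    have "cmod (\<xi> x) \<le> C * m"
    proof -
      have Cm: "((\<lambda>j. C * (l j * cmod (v j x))) has_sum C * m) A"
        by (rule has_sum_cmult_right[OF m])
      have le: "cmod (complex_of_real (l j) * c j * v j x) \<le> C * (l j * cmod (v j x))" if "j \<in> A" for j
        using mult_right_mono[OF c[OF that], of "l j * cmod (v j x)"] l(1)[OF that]
        by (simp add: norm_mult mult.assoc mult.left_commute)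
      have "(\<lambda>j. cmod (complex_of_real (l j) * c j * v j x)) summable_on A"
        using has_sum_imp_summable[OF Cm] le by (rule summable_on_comparison_test) auto
      then obtain n where n: "((\<lambda>j. cmod (complex_of_real (l j) * c j * v j x)) has_sum n) A"
        by (auto simp: summable_on_def)
      show "cmod (\<xi> x) \<le> C * m"
        using norm_has_sum_bound[OF n \<xi>[OF x]] has_sum_mono[OF n Cm le] by linarith
    qed
    then have "(cmod (\<xi> x))\<^sup>2 \<le> (C * m)\<^sup>2"
      by (rule power_mono) simp
    also have "\<dots> \<le> C\<^sup>2 * s x"
      using has_sum_jensen_square[OF l m s[OF x]] by (simp add: power_mult_distrib mult_left_mono)
    finally show ?thesis .
  qed
  ultimately have "(\<lambda>x. (cmod (\<xi> x))\<^sup>2) summable_on X"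
    by (rule summable_on_comparison_test) auto
  with \<xi>0 show \<xi>2: "\<xi> \<in> ell2 X"
    by (auto simp: ell2_def)
  show "((\<lambda>j. complex_of_real (l j) * c j * l2inner X a (v j)) has_sum l2inner X a \<xi>) A"
    if a: "a \<in> ell2 X"
  proof -
    let ?f = "\<lambda>(x, j). complex_of_real (l j) * c j * (cnj (a x) * v j x)"
    let ?g = "\<lambda>(x, j). C / 2 * ((cmod (a x))\<^sup>2 * l j + l j * (cmod (v j x))\<^sup>2)"
    have "(\<lambda>(x, j). (cmod (a x))\<^sup>2 * l j) summable_on X \<times> A"
      using a has_sum_imp_summable[OF l(2)] by (intro summable_on_Times_real) (auto simp: ell2_def)
    from summable_on_cmult_right[OF summable_on_add[OF this sv], of "C / 2"]
    have "?g summable_on X \<times> A"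
      by (simp add: case_prod_unfold)
    then have f: "?f summable_on X \<times> A"
    proof (rule summable_on_complex_comparison)
      show "cmod (?f p) \<le> ?g p" if "p \<in> X \<times> A" for p
      proof -
        obtain x j where p: "p = (x, j)" "x \<in> X" "j \<in> A" using \<open>p \<in> X \<times> A\<close> by auto
        have "cmod (c j) * (l j * (cmod (a x) * cmod (v j x))) \<le>
            C * (l j * (((cmod (a x))\<^sup>2 + (cmod (v j x))\<^sup>2) / 2))"
          using c[OF p(3)] l(1)[OF p(3)] \<open>C \<ge> 0\<close>
          by (intro mult_mono mult_le_half_squares) auto
        then show ?thesis
          using l(1)[OF p(3)] by (simp add: p norm_mult algebra_simps)
      qed
    qed
    have rows: "((\<lambda>j. ?f (x, j)) has_sum cnj (a x) * \<xi> x) A" if "x \<in> X" for x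
      using has_sum_cmult_right[OF \<xi>[OF that], of "cnj (a x)"] by (simp add: mult_ac)
    have cols: "((\<lambda>x. ?f (x, j)) has_sum complex_of_real (l j) * c j * l2inner X a (v j)) X" if "j \<in> A" for j
      using has_sum_cmult_right[OF l2inner_has_sum[OF a v(1)[OF that]]] by simp
    show ?thesis
      using has_sum_Times_exchange(2)[OF f rows cols] by (simp add: l2inner_def)
  qed
qed

text \<open>The sum of \<open>l j\<close> times the projection on \<open>e j\<close>, taken entry by
  entry, with \<open>l\<close> a probability distribution. This notion replaces density operators
  from here on, since it is stable under unitary conjugation and tensor products. The basis is
  labelled by the coordinates \<open>X\<close> themselves, as in
  \<open>orthonormal_basis\<close>.\<close>

definition spectral_mixture ::
  "'x set \<Rightarrow> ('x \<Rightarrow> 'x \<Rightarrow> complex) \<Rightarrow> ('x \<Rightarrow> real) \<Rightarrow> ('x \<Rightarrow> 'x \<Rightarrow> complex) \<Rightarrow> bool" where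
  "spectral_mixture X e l R \<longleftrightarrow>
     parseval_basis X e \<and> (\<forall>j\<in>X. l j \<ge> 0) \<and> (l has_sum 1) X \<and>
     (\<forall>x\<in>X. \<forall>y\<in>X. ((\<lambda>j. complex_of_real (l j) * e j x * cnj (e j y)) has_sum R x y) X)"

lemma spectral_mixtureD:
  assumes "spectral_mixture X e l R"
  shows "parseval_basis X e" "j \<in> X \<Longrightarrow> l j \<ge> 0" "(l has_sum 1) X"
    and "x \<in> X \<Longrightarrow> y \<in> X \<Longrightarrow> ((\<lambda>j. complex_of_real (l j) * e j x * cnj (e j y)) has_sum R x y) X"
  using assms by (auto simp: spectral_mixture_def)

text \<open>An exchange of sums writes \<open>mat_app X R \<psi>\<close> as the mixture of the
  \<open>e j\<close> with coefficients \<open>l2inner X (e j) \<psi>\<close>. These are bounded by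
  Cauchy-Schwarz, so \<open>vector_mixture\<close> applies.\<close>

lemma spectral_mixture_apply:
  assumes sp: "spectral_mixture X e l R" and \<psi>: "\<psi> \<in> ell2 X"
  shows "mat_app X R \<psi> \<in> ell2 X"
    and "a \<in> ell2 X \<Longrightarrow>
      ((\<lambda>j. complex_of_real (l j) * l2inner X (e j) \<psi> * l2inner X a (e j)) has_sum
        l2inner X a (mat_app X R \<psi>)) X"
proof -
  note pb = spectral_mixtureD(1)[OF sp] and l = spectral_mixtureD(2,3)[OF sp]
  note v = parseval_basisD(1)[OF pb] parseval_l2sq[OF pb]
  have sv: "(\<lambda>(x, j). l j * (cmod (e j x))\<^sup>2) summable_on X \<times> X"
    using weighted_unit_vectors_has_sum[where v = e, OF l v] has_sum_swap has_sum_imp_summable by fastforce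
  have c: "cmod (l2inner X (e j) \<psi>) \<le> sqrt (l2sq X \<psi>)" if "j \<in> X" for j
    using unit_cauchy_schwarz[OF v(1,2) \<psi>] that by (simp add: real_le_rsqrt)
  have pt: "((\<lambda>j. complex_of_real (l j) * l2inner X (e j) \<psi> * e j x) has_sum mat_app X R \<psi> x) X"
    if x: "x \<in> X" for x
  proof -
    let ?f = "\<lambda>(y, j). complex_of_real (l j) * e j x * (cnj (e j y) * \<psi> y)"
    let ?g = "\<lambda>(y, j). 1 / 2 * ((cmod (\<psi> y))\<^sup>2 * l j + l j * (cmod (e j y))\<^sup>2)"
    have "(\<lambda>(y, j). (cmod (\<psi> y))\<^sup>2 * l j) summable_on X \<times> X"
      using \<psi> has_sum_imp_summable[OF l(2)] by (intro summable_on_Times_real) (auto simp: ell2_def)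
    from summable_on_cmult_right[OF summable_on_add[OF this sv], of "1 / 2"]
    have "?g summable_on X \<times> X"
      by (simp add: case_prod_unfold)
    then have f: "?f summable_on X \<times> X"
    proof (rule summable_on_complex_comparison)
      show "cmod (?f p) \<le> ?g p" if "p \<in> X \<times> X" for p
      proof -
        obtain y j where p: "p = (y, j)" "y \<in> X" "j \<in> X" using \<open>p \<in> X \<times> X\<close> by auto
        have "cmod (e j x) * (l j * (cmod (\<psi> y) * cmod (e j y))) \<le>
            1 * (l j * (((cmod (\<psi> y))\<^sup>2 + (cmod (e j y))\<^sup>2) / 2))"
          using parseval_le_1[OF pb p(3) x] l(1)[OF p(3)]
          by (intro mult_mono mult_le_half_squares) auto
        then show ?thesis
          using l(1)[OF p(3)] by (simp add: p norm_mult algebra_simps)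
      qed
    qed
    have rows: "((\<lambda>j. ?f (y, j)) has_sum R x y * \<psi> y) X" if "y \<in> X" for y
      using has_sum_cmult_left[OF spectral_mixtureD(4)[OF sp x that], of "\<psi> y"] by (simp add: mult_ac)
    have cols: "((\<lambda>y. ?f (y, j)) has_sum complex_of_real (l j) * e j x * l2inner X (e j) \<psi>) X" if "j \<in> X" for j
      using has_sum_cmult_right[OF l2inner_has_sum[OF v(1)[OF that] \<psi>]] by simp
    show ?thesis
      using has_sum_Times_exchange(2)[OF f rows cols] x by (simp add: mat_app_def mult_ac)
  qed
  have 0: "mat_app X R \<psi> x = 0" if "x \<notin> X" for x
    using that by (simp add: mat_app_def)
  show "mat_app X R \<psi> \<in> ell2 X"
    by (rule vector_mixture(1)[OF l v c _ pt 0]) (auto simp: l2sq_nonneg)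
  show "((\<lambda>j. complex_of_real (l j) * l2inner X (e j) \<psi> * l2inner X a (e j)) has_sum
        l2inner X a (mat_app X R \<psi>)) X" if "a \<in> ell2 X"
    by (rule vector_mixture(2)[OF l v c _ pt 0 that]) (auto simp: l2sq_nonneg)
qed

lemma unitary_operatorD:
  assumes "unitary_operator X U"
  shows "\<psi> \<in> ell2 X \<Longrightarrow> U \<psi> \<in> ell2 X"
    and "\<psi> \<in> ell2 X \<Longrightarrow> \<phi> \<in> ell2 X \<Longrightarrow> l2inner X (U \<psi>) (U \<phi>) = l2inner X \<psi> \<phi>"
    and "\<psi> \<in> ell2 X \<Longrightarrow> inv_into (ell2 X) U \<psi> \<in> ell2 X"
    and "\<psi> \<in> ell2 X \<Longrightarrow> U (inv_into (ell2 X) U \<psi>) = \<psi>"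
  using assms inv_into_into[of \<psi> U "ell2 X"] f_inv_into_f[of \<psi> U "ell2 X"]
  by (auto simp: unitary_operator_def)

text \<open>The entries of the conjugated matrix are inner products of \<open>R\<close> between the
  preimages of two kets, and unitarity moves \<open>U\<close> from the kets onto the
  eigenvectors.\<close>

lemma spectral_mixture_conjugate:
  assumes U: "unitary_operator X U" and sp: "spectral_mixture X e l R"
  shows "spectral_mixture X (\<lambda>j. U (e j)) l (conjugate_by X U R)"
proof -
  note pb = spectral_mixtureD(1)[OF sp] and l = spectral_mixtureD(2,3)[OF sp]
  note e = parseval_basisD(1)[OF pb] and UD = unitary_operatorD[OF U]
  define V where "V = inv_into (ell2 X) U"
  have l2sq: "l2sq X (U \<phi>) = l2sq X \<phi>" if "\<phi> \<in> ell2 X" for \<phi>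
    using UD(2)[OF that that] that by (simp add: l2inner_same UD(1))
  have "((\<lambda>j. (cmod (l2inner X (U (e j)) \<psi>))\<^sup>2) has_sum l2sq X \<psi>) X" if \<psi>: "\<psi> \<in> ell2 X" for \<psi>
  proof -
    have "l2inner X (U (e j)) \<psi> = l2inner X (e j) (V \<psi>)" if "j \<in> X" for j
      using UD(2)[OF e[OF that] UD(3)[OF \<psi>]] UD(4)[OF \<psi>] by (simp add: V_def)
    moreover have "l2sq X (V \<psi>) = l2sq X \<psi>"
      using l2sq[OF UD(3)[OF \<psi>]] UD(4)[OF \<psi>] by (simp add: V_def)
    ultimately show ?thesis
      using parseval_basisD(3)[OF pb UD(3)[OF \<psi>]] has_sum_cong[of X
          "\<lambda>j. (cmod (l2inner X (U (e j)) \<psi>))\<^sup>2" "\<lambda>j. (cmod (l2inner X (e j) (V \<psi>)))\<^sup>2"]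
      by (simp add: V_def)
  qed
  then have "parseval_basis X (\<lambda>j. U (e j))"
    using parseval_basisD(2)[OF pb] e UD(1,2) by (simp add: parseval_basis_def)
  moreover have "((\<lambda>j. complex_of_real (l j) * U (e j) x * cnj (U (e j) y)) has_sum conjugate_by X U R x y) X"
    if x: "x \<in> X" and y: "y \<in> X" for x y
  proof -
    have V: "V (ket x) \<in> ell2 X" "U (V (ket x)) = ket x" "V (ket y) \<in> ell2 X" "U (V (ket y)) = ket y"
      by (simp_all add: V_def UD(3,4) ell2_ket x y)
    have 1: "l2inner X (V (ket x)) (e j) = U (e j) x" if "j \<in> X" for j
      using UD(2)[OF V(1) e[OF that]] V(2) x by (simp add: l2inner_ket)
    have 2: "l2inner X (e j) (V (ket y)) = cnj (U (e j) y)" if "j \<in> X" for j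
      using UD(2)[OF e[OF that] V(3)] V(4) y l2inner_cnj[of X "ket y" "U (e j)"] by (simp add: l2inner_ket)
    have R: "l2inner X (V (ket x)) (mat_app X R (V (ket y))) = conjugate_by X U R x y"
      using UD(2)[OF V(1) spectral_mixture_apply(1)[OF sp V(3)]] V(2) x
      by (simp add: l2inner_ket conjugate_by_def V_def)
    show ?thesis
      using spectral_mixture_apply(2)[OF sp V(3,1)] unfolding R
      by (rule has_sum_cong[THEN iffD1, rotated]) (simp add: 1 2)
  qed
  ultimately show ?thesis
    using l by (simp add: spectral_mixture_def)
qed

section \<open>Tensor products and partial traces\<close>

text \<open>
  The bijection \<open>\<beta>\<close> reads \<open>\<ell>\<^sup>2(Z)\<close> as \<open>\<ell>\<^sup>2(X) \<otimes> \<ell>\<^sup>2(Y)\<close>. It is kept general because a composite is split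
  both as system times reservoirs and as one reservoir times everything else.
\<close>

definition slice :: "('x \<times> 'y \<Rightarrow> 'z) \<Rightarrow> 'x set \<Rightarrow> ('z \<Rightarrow> complex) \<Rightarrow> 'y \<Rightarrow> 'x \<Rightarrow> complex" where
  "slice \<beta> X \<Psi> y = (\<lambda>x. if x \<in> X then \<Psi> (\<beta> (x, y)) else 0)"

text \<open>The partial inner product with \<open>f\<close> in the factor \<open>X\<close>: the
  adjoint of the map that sends \<open>g\<close> to the product vector of \<open>f\<close> and
  \<open>g\<close>.\<close>

definition contract ::
  "('x \<times> 'y \<Rightarrow> 'z) \<Rightarrow> 'x set \<Rightarrow> 'y set \<Rightarrow> ('x \<Rightarrow> complex) \<Rightarrow> ('z \<Rightarrow> complex) \<Rightarrow> 'y \<Rightarrow> complex" where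
  "contract \<beta> X Y f \<Psi> = (\<lambda>y. if y \<in> Y then l2inner X f (slice \<beta> X \<Psi> y) else 0)"

lemma
  assumes bij: "bij_betw \<beta> (X \<times> Y) Z" and \<Psi>: "\<Psi> \<in> ell2 Z"
  shows slice_ell2: "y \<in> Y \<Longrightarrow> slice \<beta> X \<Psi> y \<in> ell2 X"
    and slice_has_sum: "((\<lambda>y. l2sq X (slice \<beta> X \<Psi> y)) has_sum l2sq Z \<Psi>) Y"
proof -
  have "((\<lambda>p. (cmod (\<Psi> (\<beta> p)))\<^sup>2) has_sum l2sq Z \<Psi>) (X \<times> Y)"
    using ell2_has_sum[OF \<Psi>] by (rule has_sum_reindex_bij_betw[OF bij, THEN iffD2])
  then have s: "((\<lambda>(y, x). (cmod (\<Psi> (\<beta> (x, y))))\<^sup>2) has_sum l2sq Z \<Psi>) (Y \<times> X)"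
    by (subst (asm) has_sum_swap)
  have *: "(\<lambda>x. (cmod (slice \<beta> X \<Psi> y x))\<^sup>2) summable_on X" if "y \<in> Y" for y
    using summable_on_SigmaD1[OF has_sum_imp_summable[OF s] that]
    by (rule summable_on_cong[THEN iffD1, rotated]) (simp add: slice_def)
  then show e: "slice \<beta> X \<Psi> y \<in> ell2 X" if "y \<in> Y" for y
    using that by (simp add: ell2_def) (simp add: slice_def)
  show "((\<lambda>y. l2sq X (slice \<beta> X \<Psi> y)) has_sum l2sq Z \<Psi>) Y"
    using s
  proof (rule has_sum_SigmaD)
    show "((\<lambda>x. case (y, x) of (y, x) \<Rightarrow> (cmod (\<Psi> (\<beta> (x, y))))\<^sup>2) has_sum l2sq X (slice \<beta> X \<Psi> y)) X"
      if "y \<in> Y" for y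
      using ell2_has_sum[OF e[OF that]]
      by (rule has_sum_cong[THEN iffD1, rotated]) (simp add: slice_def)
  qed
qed

lemma contract_ell2:
  assumes "bij_betw \<beta> (X \<times> Y) Z" "\<Psi> \<in> ell2 Z" "f \<in> ell2 X" "l2sq X f = 1"
  shows "contract \<beta> X Y f \<Psi> \<in> ell2 Y" "l2sq Y (contract \<beta> X Y f \<Psi>) \<le> l2sq Z \<Psi>"
proof -
  have le: "(cmod (contract \<beta> X Y f \<Psi> y))\<^sup>2 \<le> l2sq X (slice \<beta> X \<Psi> y)" if "y \<in> Y" for y
    using unit_cauchy_schwarz[OF assms(3,4) slice_ell2[OF assms(1,2) that]] that
    by (simp add: contract_def)
  have "(\<lambda>y. (cmod (contract \<beta> X Y f \<Psi> y))\<^sup>2) summable_on Y"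
    using has_sum_imp_summable[OF slice_has_sum[OF assms(1,2)]] le
    by (rule summable_on_comparison_test) auto
  then show "contract \<beta> X Y f \<Psi> \<in> ell2 Y"
    by (simp add: ell2_def) (simp add: contract_def)
  from has_sum_mono[OF ell2_has_sum[OF this] slice_has_sum[OF assms(1,2)] le]
  show "l2sq Y (contract \<beta> X Y f \<Psi>) \<le> l2sq Z \<Psi>" .
qed

lemma product_vector_ell2:
  assumes bij: "bij_betw \<beta> (X \<times> Y) Z" and f: "f \<in> ell2 X" and g: "g \<in> ell2 Y"
    and F: "\<And>x y. x \<in> X \<Longrightarrow> y \<in> Y \<Longrightarrow> F (\<beta> (x, y)) = f x * g y" "\<And>z. z \<notin> Z \<Longrightarrow> F z = 0"
  shows "F \<in> ell2 Z"
proof -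
  have "(\<lambda>(x, y). (cmod (f x))\<^sup>2 * (cmod (g y))\<^sup>2) summable_on X \<times> Y"
    using f g by (intro summable_on_Times_real) (auto simp: ell2_def)
  then have "(\<lambda>p. (cmod (F (\<beta> p)))\<^sup>2) summable_on X \<times> Y"
    by (rule summable_on_cong[THEN iffD1, rotated]) (auto simp: F norm_mult power_mult_distrib)
  then have "(\<lambda>z. (cmod (F z))\<^sup>2) summable_on Z"
    by (rule summable_on_reindex_bij_betw[OF bij, THEN iffD1])
  then show ?thesis using F(2) by (simp add: ell2_def)
qed

lemma l2inner_product_vector:
  assumes bij: "bij_betw \<beta> (X \<times> Y) Z" and f: "f \<in> ell2 X" and g: "g \<in> ell2 Y"
    and F: "\<And>x y. x \<in> X \<Longrightarrow> y \<in> Y \<Longrightarrow> F (\<beta> (x, y)) = f x * g y" "\<And>z. z \<notin> Z \<Longrightarrow> F z = 0"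
    and \<Psi>: "\<Psi> \<in> ell2 Z"
  shows "l2inner Z F \<Psi> = l2inner Y g (contract \<beta> X Y f \<Psi>)"
proof -
  have "((\<lambda>p. cnj (F (\<beta> p)) * \<Psi> (\<beta> p)) has_sum l2inner Z F \<Psi>) (X \<times> Y)"
    using l2inner_has_sum[OF product_vector_ell2[OF bij f g F] \<Psi>]
    by (rule has_sum_reindex_bij_betw[OF bij, THEN iffD2])
  then have "((\<lambda>(y, x). cnj (F (\<beta> (x, y))) * \<Psi> (\<beta> (x, y))) has_sum l2inner Z F \<Psi>) (Y \<times> X)"
    by (subst (asm) has_sum_swap)
  then have "((\<lambda>y. cnj (g y) * contract \<beta> X Y f \<Psi> y) has_sum l2inner Z F \<Psi>) Y"
  proof (rule has_sum_SigmaD)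
    fix y assume y: "y \<in> Y"
    show "((\<lambda>x. case (y, x) of (y, x) \<Rightarrow> cnj (F (\<beta> (x, y))) * \<Psi> (\<beta> (x, y))) has_sum
        cnj (g y) * contract \<beta> X Y f \<Psi> y) X"
      using has_sum_cmult_right[OF l2inner_has_sum[OF f slice_ell2[OF bij \<Psi> y]], of "cnj (g y)"]
      unfolding contract_def if_P[OF y]
      by (rule has_sum_cong[THEN iffD1, rotated]) (simp add: slice_def F(1) y mult_ac)
  qed
  then show ?thesis
    unfolding l2inner_def[of Y] by (rule infsumI[symmetric])
qed

lemma l2inner_product_vectors:
  assumes bij: "bij_betw \<beta> (X \<times> Y) Z"
    and ell: "f \<in> ell2 X" "f' \<in> ell2 X" "g \<in> ell2 Y" "g' \<in> ell2 Y"
    and F: "\<And>x y. x \<in> X \<Longrightarrow> y \<in> Y \<Longrightarrow> F (\<beta> (x, y)) = f x * g y"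
    and F': "\<And>x y. x \<in> X \<Longrightarrow> y \<in> Y \<Longrightarrow> F' (\<beta> (x, y)) = f' x * g' y"
  shows "l2inner Z F F' = l2inner X f f' * l2inner Y g g'"
proof -
  have "((\<lambda>(x, y). (cnj (f x) * f' x) * (cnj (g y) * g' y)) has_sum l2inner X f f' * l2inner Y g g') (X \<times> Y)"
    by (intro has_sum_Times_complex l2inner_has_sum ell)
  then have "((\<lambda>p. cnj (F (\<beta> p)) * F' (\<beta> p)) has_sum l2inner X f f' * l2inner Y g g') (X \<times> Y)"
    by (rule has_sum_cong[THEN iffD1, rotated]) (auto simp: F F')
  from has_sum_reindex_bij_betw[OF bij, THEN iffD1, OF this] show ?thesis
    unfolding l2inner_def[of Z] by (rule infsumI)
qed

text \<open>Parseval's identity in the factor \<open>X\<close> for every slice, followed by an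
  exchange of nonnegative sums.\<close>

lemma parseval_contract:
  assumes "bij_betw \<beta> (X \<times> Y) Z" "parseval_basis X e" "\<Psi> \<in> ell2 Z"
  shows "((\<lambda>i. l2sq Y (contract \<beta> X Y (e i) \<Psi>)) has_sum l2sq Z \<Psi>) X"
proof -
  have "((\<lambda>(y, i). (cmod (l2inner X (e i) (slice \<beta> X \<Psi> y)))\<^sup>2) has_sum l2sq Z \<Psi>) (Y \<times> X)"
    by (rule has_sum_SigmaI_nonneg[OF _ slice_has_sum[OF assms(1,3)]])
      (simp_all add: parseval_basisD(3)[OF assms(2) slice_ell2[OF assms(1,3)]])
  then have "((\<lambda>(i, y). (cmod (l2inner X (e i) (slice \<beta> X \<Psi> y)))\<^sup>2) has_sum l2sq Z \<Psi>) (X \<times> Y)"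
    by (subst has_sum_swap) simp
  then show ?thesis
  proof (rule has_sum_SigmaD)
    fix i assume i: "i \<in> X"
    have "contract \<beta> X Y (e i) \<Psi> \<in> ell2 Y"
      using contract_ell2(1)[OF assms(1,3) parseval_basisD(1)[OF assms(2) i] parseval_l2sq[OF assms(2) i]] .
    from ell2_has_sum[OF this]
    show "((\<lambda>y. case (i, y) of (i, y) \<Rightarrow> (cmod (l2inner X (e i) (slice \<beta> X \<Psi> y)))\<^sup>2) has_sum
        l2sq Y (contract \<beta> X Y (e i) \<Psi>)) Y"
      by (rule has_sum_cong[THEN iffD1, rotated]) (simp add: contract_def)
  qed
qed

text \<open>Completeness is Parseval's identity used twice, first in \<open>X\<close> for the slices
  of a vector and then in \<open>Y\<close> for its contractions.\<close>

lemma parseval_basis_product: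
  assumes bij: "bij_betw \<beta> (X \<times> Y) Z" and e: "parseval_basis X e" and f: "parseval_basis Y f"
    and E: "\<And>i j x y. i \<in> X \<Longrightarrow> j \<in> Y \<Longrightarrow> x \<in> X \<Longrightarrow> y \<in> Y \<Longrightarrow>
        E (\<beta> (i, j)) (\<beta> (x, y)) = e i x * f j y"
      "\<And>k z. k \<in> Z \<Longrightarrow> z \<notin> Z \<Longrightarrow> E k z = 0"
  shows "parseval_basis Z E"
proof -
  have mem: "\<beta> (i, j) \<in> Z" if "i \<in> X" "j \<in> Y" for i j
    using bij_betwE[OF bij] that by blast
  have Z: "\<exists>i\<in>X. \<exists>j\<in>Y. k = \<beta> (i, j)" if "k \<in> Z" for k
    using bij that by (force simp: bij_betw_def)
  have inj: "\<beta> (i, j) = \<beta> (i', j') \<longleftrightarrow> i = i' \<and> j = j'" if "i \<in> X" "j \<in> Y" "i' \<in> X" "j' \<in> Y" for i j i' j'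
    using bij that by (auto simp: bij_betw_def inj_on_def)
  note eD = parseval_basisD(1,2)[OF e] and fD = parseval_basisD(1,2)[OF f]
  have ell2: "E (\<beta> (i, j)) \<in> ell2 Z" if "i \<in> X" "j \<in> Y" for i j
    using product_vector_ell2[OF bij eD(1)[OF that(1)] fD(1)[OF that(2)], of "E (\<beta> (i, j))"] that
    by (simp add: E mem)
  have inner: "l2inner Z (E (\<beta> (i, j))) \<Psi> = l2inner Y (f j) (contract \<beta> X Y (e i) \<Psi>)"
    if "i \<in> X" "j \<in> Y" "\<Psi> \<in> ell2 Z" for i j \<Psi>
    using that by (intro l2inner_product_vector[OF bij eD(1) fD(1)] E mem)
  have orth: "l2inner Z (E (\<beta> (i, j))) (E (\<beta> (i', j'))) = (if \<beta> (i, j) = \<beta> (i', j') then 1 else 0)"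
    if ij: "i \<in> X" "j \<in> Y" "i' \<in> X" "j' \<in> Y" for i j i' j'
  proof -
    have "l2inner Z (E (\<beta> (i, j))) (E (\<beta> (i', j'))) = l2inner X (e i) (e i') * l2inner Y (f j) (f j')"
      using ij by (intro l2inner_product_vectors[OF bij] eD(1) fD(1) E(1))
    then show ?thesis
      using ij by (simp add: eD(2) fD(2) inj)
  qed
  have "((\<lambda>k. (cmod (l2inner Z (E k) \<Psi>))\<^sup>2) has_sum l2sq Z \<Psi>) Z" if \<Psi>: "\<Psi> \<in> ell2 Z" for \<Psi>
  proof -
    have "((\<lambda>p. (cmod (l2inner Z (E (\<beta> p)) \<Psi>))\<^sup>2) has_sum l2sq Z \<Psi>) (X \<times> Y)"
    proof (rule has_sum_SigmaI_nonneg[OF _ parseval_contract[OF bij e \<Psi>]])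
      fix i assume i: "i \<in> X"
      have "contract \<beta> X Y (e i) \<Psi> \<in> ell2 Y"
        using contract_ell2(1)[OF bij \<Psi> eD(1)[OF i] parseval_l2sq[OF e i]] .
      from parseval_basisD(3)[OF f this]
      show "((\<lambda>j. (cmod (l2inner Z (E (\<beta> (i, j))) \<Psi>))\<^sup>2) has_sum
          l2sq Y (contract \<beta> X Y (e i) \<Psi>)) Y"
        by (rule has_sum_cong[THEN iffD1, rotated]) (simp add: inner i \<Psi>)
    qed simp
    then show ?thesis
      by (rule has_sum_reindex_bij_betw[OF bij, THEN iffD1])
  qed
  moreover have "E k \<in> ell2 Z" if "k \<in> Z" for k
    using Z[OF that] ell2 by auto
  moreover have "l2inner Z (E k) (E k') = (if k = k' then 1 else 0)" if "k \<in> Z" "k' \<in> Z" for k k'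
    using Z[OF that(1)] Z[OF that(2)] orth by blast
  ultimately show ?thesis
    unfolding parseval_basis_def by simp
qed

lemma spectral_mixture_product:
  assumes bij: "bij_betw \<beta> (X \<times> Y) Z"
    and sX: "spectral_mixture X e l R" and sY: "spectral_mixture Y f m S"
    and E: "\<And>i j x y. i \<in> X \<Longrightarrow> j \<in> Y \<Longrightarrow> x \<in> X \<Longrightarrow> y \<in> Y \<Longrightarrow>
        E (\<beta> (i, j)) (\<beta> (x, y)) = e i x * f j y"
      "\<And>k z. k \<in> Z \<Longrightarrow> z \<notin> Z \<Longrightarrow> E k z = 0"
    and L: "\<And>i j. i \<in> X \<Longrightarrow> j \<in> Y \<Longrightarrow> L (\<beta> (i, j)) = l i * m j"
    and T: "\<And>x y x' y'. x \<in> X \<Longrightarrow> y \<in> Y \<Longrightarrow> x' \<in> X \<Longrightarrow> y' \<in> Y \<Longrightarrow>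
        T (\<beta> (x, y)) (\<beta> (x', y')) = R x x' * S y y'"
  shows "spectral_mixture Z E L T"
proof -
  have Z: "\<exists>i\<in>X. \<exists>j\<in>Y. k = \<beta> (i, j)" if "k \<in> Z" for k
    using bij that by (force simp: bij_betw_def)
  note sXD = spectral_mixtureD[OF sX] and sYD = spectral_mixtureD[OF sY]
  have "parseval_basis Z E"
    using bij sXD(1) sYD(1) E by (rule parseval_basis_product)
  moreover have "L k \<ge> 0" if "k \<in> Z" for k
    using Z[OF that] sXD(2) sYD(2) by (auto simp: L)
  moreover have "(L has_sum 1) Z"
  proof -
    have "((\<lambda>(i, j). l i * m j) has_sum 1) (X \<times> Y)"
      using has_sum_Times_real[OF sXD(3) sYD(3)] by simp
    then have "((\<lambda>p. L (\<beta> p)) has_sum 1) (X \<times> Y)"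
      by (rule has_sum_cong[THEN iffD1, rotated]) (auto simp: L)
    then show ?thesis by (rule has_sum_reindex_bij_betw[OF bij, THEN iffD1])
  qed
  moreover have "((\<lambda>j. complex_of_real (L j) * E j z * cnj (E j z')) has_sum T z z') Z"
    if z: "z \<in> Z" "z' \<in> Z" for z z'
  proof -
    obtain x y x' y' where xy: "x \<in> X" "y \<in> Y" "x' \<in> X" "y' \<in> Y"
      and eq: "z = \<beta> (x, y)" "z' = \<beta> (x', y')"
      using Z[OF z(1)] Z[OF z(2)] by blast
    have "((\<lambda>(i, j). (complex_of_real (l i) * e i x * cnj (e i x')) *
        (complex_of_real (m j) * f j y * cnj (f j y'))) has_sum R x x' * S y y') (X \<times> Y)"
      by (intro has_sum_Times_complex sXD(4) sYD(4) xy)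
    then have "((\<lambda>p. complex_of_real (L (\<beta> p)) * E (\<beta> p) z * cnj (E (\<beta> p) z')) has_sum T z z') (X \<times> Y)"
      unfolding T[OF xy, folded eq]
      by (rule has_sum_cong[THEN iffD1, rotated]) (auto simp: L E eq xy)
    then show ?thesis by (rule has_sum_reindex_bij_betw[OF bij, THEN iffD1])
  qed
  ultimately show ?thesis
    by (simp add: spectral_mixture_def)
qed

text \<open>Here \<open>m\<close> is the partial trace of \<open>R\<close> over \<open>Y\<close>.
  Its mean in \<open>f\<close> equals the sum over \<open>k\<close> of \<open>l k\<close> times the
  squared norm of the contraction of \<open>V k\<close> with \<open>f\<close>, and Parseval's
  identity in any basis \<open>g\<close> of \<open>Y\<close> resolves that norm into transition
  probabilities. This is what identifies marginals of the joint law with diagonals of reduced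
  states.\<close>

lemma partial_trace_expectation:
  assumes bij: "bij_betw \<beta> (X \<times> Y) Z" and sp: "spectral_mixture Z V l R"
    and f: "f \<in> ell2 X" "l2sq X f = 1" and g: "parseval_basis Y g"
    and F: "\<And>j x y. j \<in> Y \<Longrightarrow> x \<in> X \<Longrightarrow> y \<in> Y \<Longrightarrow> F j (\<beta> (x, y)) = f x * g j y"
      "\<And>j z. j \<in> Y \<Longrightarrow> z \<notin> Z \<Longrightarrow> F j z = 0"
    and m: "\<And>x x'. x \<in> X \<Longrightarrow> x' \<in> X \<Longrightarrow> m x x' = (\<Sum>\<^sub>\<infinity>y\<in>Y. R (\<beta> (x, y)) (\<beta> (x', y)))"
  shows "((\<lambda>(k, j). l k * (cmod (l2inner Z (F j) (V k)))\<^sup>2) has_sum Re (l2inner X f (mat_app X m f))) (Z \<times> Y)"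
proof -
  note pb = spectral_mixtureD(1)[OF sp] and l = spectral_mixtureD(2,3)[OF sp]
  note V = parseval_basisD(1)[OF pb] parseval_l2sq[OF pb]
  have mem: "\<beta> (i, j) \<in> Z" if "i \<in> X" "j \<in> Y" for i j
    using bij_betwE[OF bij] that by blast
  define v where "v k x y = V k (\<beta> (x, y))" for k x y
  define w where "w k = contract \<beta> X Y f (V k)" for k
  have w: "w k \<in> ell2 Y" "l2sq Y (w k) \<le> 1" if "k \<in> Z" for k
    using contract_ell2[OF bij V(1)[OF that] f] V(2)[OF that] by (simp_all add: w_def)
  have q: "(\<lambda>(x, y, k). l k * (cmod (v k x y))\<^sup>2) summable_on X \<times> Y \<times> Z"
  proof -
    have "(\<lambda>(z, k). l k * (cmod (V k z))\<^sup>2) summable_on Z \<times> Z"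
      using weighted_unit_vectors_has_sum[where v = V, OF l V] has_sum_swap has_sum_imp_summable
      by fastforce
    moreover have "bij_betw (\<lambda>(x, y, k). (\<beta> (x, y), k)) (X \<times> Y \<times> Z) (Z \<times> Z)"
      using bij unfolding bij_betw_def inj_on_def by (auto simp: image_iff) blast+
    ultimately show ?thesis
      using summable_on_reindex_bij_betw[of "\<lambda>(x, y, k). (\<beta> (x, y), k)" "X \<times> Y \<times> Z" "Z \<times> Z"
          "\<lambda>(z, k). l k * (cmod (V k z))\<^sup>2"]
      by (simp add: case_prod_unfold v_def)
  qed
  \<comment> \<open>All four indices at once: summing over \<open>y\<close> and \<open>k\<close>
    first produces the entries of \<open>m\<close>, summing over \<open>x\<close> and
    \<open>x'\<close> first produces the squared entries of \<open>w k\<close>.\<close>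
  define G where "G = (\<lambda>((x, x'), (y, k)).
    complex_of_real (l k) * ((cnj (f x) * v k x y) * cnj (cnj (f x') * v k x' y)))"
  have G: "G summable_on (X \<times> X) \<times> (Y \<times> Z)"
  proof -
    have "(\<lambda>x. (cmod (f x))\<^sup>2) summable_on X" using f(1) by (simp add: ell2_def)
    from summable_on_Times_real[OF this q]
    have s: "(\<lambda>(x, x', y, k). (cmod (f x))\<^sup>2 * (l k * (cmod (v k x' y))\<^sup>2)) summable_on X \<times> X \<times> Y \<times> Z"
      by (simp add: case_prod_unfold)
    have s1: "(\<lambda>((x, x'), (y, k)). (cmod (f x))\<^sup>2 * (l k * (cmod (v k x' y))\<^sup>2)) summable_on (X \<times> X) \<times> (Y \<times> Z)"
      by (rule summable_on_reindex_bij_witness[where j = "\<lambda>((x, x'), p). (x, x', p)"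
            and i = "\<lambda>(x, x', p). ((x, x'), p)", THEN iffD2, OF _ _ _ _ _ s]) auto
    have s2: "(\<lambda>((x, x'), (y, k)). (cmod (f x'))\<^sup>2 * (l k * (cmod (v k x y))\<^sup>2)) summable_on (X \<times> X) \<times> (Y \<times> Z)"
      by (rule summable_on_reindex_bij_witness[where j = "\<lambda>((x, x'), p). (x', x, p)"
            and i = "\<lambda>(x, x', p). ((x', x), p)", THEN iffD2, OF _ _ _ _ _ s]) auto
    show ?thesis
      using summable_on_cmult_right[OF summable_on_add[OF s1 s2], of "1 / 2"]
    proof (rule summable_on_complex_comparison)
      fix p assume "p \<in> (X \<times> X) \<times> (Y \<times> Z)"
      then obtain x x' y k where p: "p = ((x, x'), (y, k))" "k \<in> Z" by auto
      \<comment> \<open>The factors are paired crosswise, \<open>f x\<close> with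
        \<open>v k x' y\<close>. Pairing \<open>f x\<close> with \<open>v k x y\<close> would leave
        a term independent of \<open>x'\<close>, hence a divergent majorant on an infinite
        \<open>X\<close>.\<close>
      have "l k * ((cmod (f x) * cmod (v k x' y)) * (cmod (f x') * cmod (v k x y))) \<le>
          l k * (((cmod (f x) * cmod (v k x' y))\<^sup>2 + (cmod (f x') * cmod (v k x y))\<^sup>2) / 2)"
        using l(1)[OF p(2)] by (intro mult_left_mono mult_le_half_squares)
      then show "cmod (G p) \<le> 1 / 2 * ((\<lambda>((x, x'), (y, k)). (cmod (f x))\<^sup>2 * (l k * (cmod (v k x' y))\<^sup>2)) p +
          (\<lambda>((x, x'), (y, k)). (cmod (f x'))\<^sup>2 * (l k * (cmod (v k x y))\<^sup>2)) p)"
        using l(1)[OF p(2)] by (simp add: p(1) G_def norm_mult algebra_simps power_mult_distrib)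
    qed
  qed
  have rows: "((\<lambda>q. G (p, q)) has_sum (case p of (x, x') \<Rightarrow> cnj (f x) * (m x x' * f x'))) (Y \<times> Z)"
    if "p \<in> X \<times> X" for p
  proof -
    obtain x x' where p: "p = (x, x')" "x \<in> X" "x' \<in> X" using \<open>p \<in> X \<times> X\<close> by auto
    define K where "K = (\<lambda>(y, k). complex_of_real (l k) * v k x y * cnj (v k x' y))"
    have "K summable_on Y \<times> Z"
      using summable_on_cmult_right[OF summable_on_add[OF
          summable_on_SigmaD1[OF q p(2)] summable_on_SigmaD1[OF q p(3)]], of "1 / 2"]
    proof (rule summable_on_complex_comparison)
      fix r assume "r \<in> Y \<times> Z"
      then obtain y k where r: "r = (y, k)" "k \<in> Z" by auto
      have "l k * (cmod (v k x y) * cmod (v k x' y)) \<le> l k * (((cmod (v k x y))\<^sup>2 + (cmod (v k x' y))\<^sup>2) / 2)"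
        using l(1)[OF r(2)] by (intro mult_left_mono mult_le_half_squares)
      then show "cmod (K r) \<le> 1 / 2 * ((case r of (y, k) \<Rightarrow> l k * (cmod (v k x y))\<^sup>2) +
          (case r of (y, k) \<Rightarrow> l k * (cmod (v k x' y))\<^sup>2))"
        using l(1)[OF r(2)] by (simp add: r(1) K_def norm_mult algebra_simps)
    qed
    then have K: "(K has_sum infsum K (Y \<times> Z)) (Y \<times> Z)" by simp
    have "((\<lambda>y. R (\<beta> (x, y)) (\<beta> (x', y))) has_sum infsum K (Y \<times> Z)) Y"
      by (rule has_sum_SigmaD[OF K])
        (use spectral_mixtureD(4)[OF sp mem mem] p(2,3) in \<open>simp add: K_def v_def\<close>)
    then have "m x x' = infsum K (Y \<times> Z)"
      using m[OF p(2,3)] by (simp add: infsumI)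
    with has_sum_cmult_right[OF K, of "cnj (f x) * f x'"]
    show ?thesis by (simp add: G_def K_def p(1) case_prod_unfold mult_ac)
  qed
  have cols: "((\<lambda>p. G (p, q)) has_sum (case q of (y, k) \<Rightarrow> complex_of_real (l k * (cmod (w k y))\<^sup>2))) (X \<times> X)"
    if "q \<in> Y \<times> Z" for q
  proof -
    obtain y k where q: "q = (y, k)" "y \<in> Y" "k \<in> Z" using \<open>q \<in> Y \<times> Z\<close> by auto
    have s: "((\<lambda>x. cnj (f x) * v k x y) has_sum w k y) X"
      using l2inner_has_sum[OF f(1) slice_ell2[OF bij V(1)[OF q(3)] q(2)]]
      unfolding w_def contract_def if_P[OF q(2)]
      by (rule has_sum_cong[THEN iffD1, rotated]) (simp add: slice_def v_def)
    have "((\<lambda>(x, x'). (cnj (f x) * v k x y) * cnj (cnj (f x') * v k x' y)) has_sum w k y * cnj (w k y)) (X \<times> X)"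
      by (rule has_sum_Times_complex[OF s has_sum_cnj_iff[THEN iffD2, OF s]])
    from has_sum_cmult_right[OF this, of "complex_of_real (l k)"] show ?thesis
      by (simp add: q(1) G_def case_prod_unfold complex_norm_square del: of_real_power)
  qed
  let ?H = "\<lambda>(x, x'). cnj (f x) * (m x x' * f x')"
  have H: "(?H has_sum infsum ?H (X \<times> X)) (X \<times> X)"
    using has_sum_Times_exchange(1)[OF G rows cols] .
  have "infsum ?H (X \<times> X) = (\<Sum>\<^sub>\<infinity>x\<in>X. \<Sum>\<^sub>\<infinity>x'\<in>X. cnj (f x) * (m x x' * f x'))"
    using infsum_Sigma_banach[OF has_sum_imp_summable[OF H]] by simp
  also have "\<dots> = (\<Sum>\<^sub>\<infinity>x\<in>X. cnj (f x) * mat_app X m f x)"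
    by (intro infsum_cong) (simp add: mat_app_def infsum_cmult_right')
  finally have tot: "infsum ?H (X \<times> X) = l2inner X f (mat_app X m f)"
    by (simp add: l2inner_def)
  from has_sum_Times_exchange(2)[OF G rows cols]
  have "((\<lambda>(y, k). complex_of_real (l k * (cmod (w k y))\<^sup>2)) has_sum l2inner X f (mat_app X m f)) (Y \<times> Z)"
    by (simp add: tot)
  from has_sum_Re[OF this]
  have yk: "((\<lambda>(y, k). l k * (cmod (w k y))\<^sup>2) has_sum Re (l2inner X f (mat_app X m f))) (Y \<times> Z)"
    by (simp add: case_prod_unfold)
  then have "((\<lambda>(k, y). l k * (cmod (w k y))\<^sup>2) has_sum Re (l2inner X f (mat_app X m f))) (Z \<times> Y)"
    by (subst has_sum_swap) simp
  then have k: "((\<lambda>k. l k * l2sq Y (w k)) has_sum Re (l2inner X f (mat_app X m f))) Z"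
    by (rule has_sum_SigmaD) (use has_sum_cmult_right[OF ell2_has_sum[OF w(1)]] in simp)
  show ?thesis
  proof (rule has_sum_SigmaI_nonneg[OF _ k])
    fix k assume kZ: "k \<in> Z"
    have "l2inner Z (F j) (V k) = l2inner Y (g j) (w k)" if "j \<in> Y" for j
      unfolding w_def using that
      by (intro l2inner_product_vector[OF bij f(1) parseval_basisD(1)[OF g]] F V(1) kZ)
    then show "((\<lambda>j. case (k, j) of (k, j) \<Rightarrow> l k * (cmod (l2inner Z (F j) (V k)))\<^sup>2) has_sum l k * l2sq Y (w k)) Y"
      using has_sum_cmult_right[OF parseval_basisD(3)[OF g w(1)[OF kZ]], of "l k"]
      by (simp cong: has_sum_cong)
  qed (use l in auto)
qed

section \<open>Density operators and canonical states\<close>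

lemma density_operator_form:
  assumes "density_operator X \<rho>" "x \<in> X" "y \<in> X" "x \<noteq> y"
  shows "cnj a * \<rho> x x * a + cnj a * \<rho> x y * b + cnj b * \<rho> y x * a + cnj b * \<rho> y y * b \<in> \<real>\<^sub>\<ge>\<^sub>0"
proof -
  let ?c = "\<lambda>z. if z = x then a else b"
  have "(\<Sum>u\<in>{x, y}. \<Sum>v\<in>{x, y}. cnj (?c u) * \<rho> u v * ?c v) \<in> \<real>\<^sub>\<ge>\<^sub>0"
    using assms(1)[unfolded density_operator_def, THEN conjunct1, rule_format, of "{x, y}" ?c] assms(2,3)
    by blast
  then show ?thesis using assms(4) by (simp add: add.assoc)
qed

lemma density_operator_diag:
  assumes "density_operator X \<rho>" "x \<in> X"
  shows "Re (\<rho> x x) \<ge> 0" "\<rho> x x = complex_of_real (Re (\<rho> x x))"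
proof -
  have "(\<Sum>u\<in>{x}. \<Sum>v\<in>{x}. cnj 1 * \<rho> u v * 1) \<in> \<real>\<^sub>\<ge>\<^sub>0"
    using assms(1)[unfolded density_operator_def, THEN conjunct1, rule_format, of "{x}" "\<lambda>_. 1"] assms(2)
    by blast
  then show "Re (\<rho> x x) \<ge> 0" "\<rho> x x = complex_of_real (Re (\<rho> x x))"
    by (auto simp: complex_nonneg_Reals_iff complex_eq_iff)
qed

text \<open>A nonnegative form is in particular real: the test vector (1, 1) makes the sum of the
  two off-diagonal entries real, and (1, i) makes their difference imaginary.\<close>

lemma density_operator_hermitian:
  assumes "density_operator X \<rho>" "x \<in> X" "y \<in> X"
  shows "\<rho> y x = cnj (\<rho> x y)"
proof (cases "x = y")
  case True
  then show ?thesis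
    using density_operator_diag(2)[OF assms(1,2)] by (metis complex_cnj_complex_of_real)
next
  case False
  have "Im (\<rho> x x) = 0" "Im (\<rho> y y) = 0"
    using density_operator_diag(2)[OF assms(1)] assms(2,3) by (metis Im_complex_of_real)+
  then show ?thesis
    using density_operator_form[OF assms False, of 1 1] density_operator_form[OF assms False, of 1 \<i>]
    by (auto simp: complex_nonneg_Reals_iff complex_eq_iff)
qed

lemma density_operator_cauchy_schwarz:
  assumes \<rho>: "density_operator X \<rho>" and x: "x \<in> X" and y: "y \<in> X"
  shows "(cmod (\<rho> x y))\<^sup>2 \<le> Re (\<rho> x x) * Re (\<rho> y y)"
proof (cases "x = y")
  case True
  then show ?thesis
    using density_operator_diag[OF \<rho> x] by (metis norm_of_real order_refl power2_abs power2_eq_square)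
next
  case False
  let ?A = "Re (\<rho> x x)" and ?B = "Re (\<rho> y y)" and ?r = "(cmod (\<rho> x y))\<^sup>2"
  note d = density_operator_diag[OF \<rho> x] density_operator_diag[OF \<rho> y]
  \<comment> \<open>positivity on the vector with entries \<open>- t \<rho> x y\<close> at \<open>x\<close> and \<open>1\<close> at \<open>y\<close>\<close>
  have quad: "t\<^sup>2 * ?r * ?A - 2 * t * ?r + ?B \<ge> 0" for t :: real
  proof -
    have "Re (cnj (- complex_of_real t * \<rho> x y) * \<rho> x x * (- complex_of_real t * \<rho> x y)
      + cnj (- complex_of_real t * \<rho> x y) * \<rho> x y * 1 + cnj 1 * \<rho> y x * (- complex_of_real t * \<rho> x y)
      + cnj 1 * \<rho> y y * 1) \<ge> 0"
      using density_operator_form[OF \<rho> x y False] by (simp only: complex_nonneg_Reals_iff)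
    moreover have "Re (cnj (- complex_of_real t * w) * complex_of_real A * (- complex_of_real t * w)
      + cnj (- complex_of_real t * w) * w * 1 + cnj 1 * cnj w * (- complex_of_real t * w)
      + cnj 1 * complex_of_real B * 1) = t\<^sup>2 * (cmod w)\<^sup>2 * A - 2 * t * (cmod w)\<^sup>2 + B" for w A B
      by (simp only: cmod_power2) (simp add: power2_eq_square algebra_simps)
    ultimately show ?thesis
      using d(2,4) density_operator_hermitian[OF \<rho> x y] by metis
  qed
  show ?thesis
  proof (cases "?A = 0")
    case True
    have "?r = 0"
    proof (rule ccontr)
      assume "?r \<noteq> 0"
      \<comment> \<open>Without its quadratic term the form is linear in \<open>t\<close>; this
        \<open>t\<close> gives it the value -1.\<close>
      then show False using quad[of "(?B + 1) / (2 * ?r)"] True by simp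
    qed
    then show ?thesis using True by simp
  next
    case False
    then have "?A > 0" using d(1) by simp
    then show ?thesis
      using quad[of "1 / ?A"] by (simp add: power2_eq_square field_simps)
  qed
qed

text \<open>The entries come from Parseval's identity applied to a row of \<open>\<rho>\<close> and
  a ket, the normalization from the trace. The delicate point is \<open>p j \<ge> 0\<close>:
  positivity of \<open>\<rho>\<close> is given on finitely supported vectors only, whereas
  \<open>e j\<close> may have infinite support, so it must be carried through a limit of finite
  sums.\<close>

lemma density_operator_spectral_mixture:
  assumes \<rho>: "density_operator X \<rho>" and eb: "eigenbasis X (mat_operator X \<rho>) e p"
  shows "spectral_mixture X e p \<rho>"
proof -
  have pb: "parseval_basis X e"
    using eb by (simp add: eigenbasis_def orthonormal_basis_imp_parseval)
  note e = parseval_basisD(1)[OF pb]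
  have eig: "(\<Sum>\<^sub>\<infinity>y\<in>X. \<rho> x y * e j y) = complex_of_real (p j) * e j x" if "j \<in> X" "x \<in> X" for j x
  proof -
    have "mat_app X \<rho> (e j) x = complex_of_real (p j) * e j x"
      using eb that(1) by (simp add: eigenbasis_def mat_operator_def)
    then show ?thesis using that(2) by (simp add: mat_app_def)
  qed
  have "((\<lambda>x. \<rho> x x) has_sum 1) X" using \<rho> by (simp add: density_operator_def)
  from has_sum_Re[OF this] have tr: "((\<lambda>x. Re (\<rho> x x)) has_sum 1) X" by simp
  note diag = density_operator_diag[OF \<rho>] and cs = density_operator_cauchy_schwarz[OF \<rho>]
  have R: "((\<lambda>j. complex_of_real (p j) * e j x * cnj (e j y)) has_sum \<rho> x y) X"
    if x: "x \<in> X" and y: "y \<in> X" for x y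
  proof -
    \<comment> \<open>The conjugate of row \<open>x\<close> of \<open>\<rho>\<close>. It is square
      summable because the squared entry is at most the product of the two diagonal entries and the
      trace is finite.\<close>
    define r where "r = (\<lambda>y. if y \<in> X then \<rho> y x else 0)"
    have "(\<lambda>y. (cmod (r y))\<^sup>2) summable_on X"
    proof (rule summable_on_comparison_test)
      show "(\<lambda>y. Re (\<rho> y y) * Re (\<rho> x x)) summable_on X"
        using tr by (intro summable_on_cmult_left) (rule has_sum_imp_summable)
    qed (use cs x in \<open>auto simp: r_def\<close>)
    then have r: "r \<in> ell2 X" by (simp add: ell2_def r_def)
    have "cnj (r z) = \<rho> x z" if "z \<in> X" for z
      using density_operator_hermitian[OF \<rho> x that] that by (simp add: r_def)
    then have "l2inner X r \<psi> = (\<Sum>\<^sub>\<infinity>z\<in>X. \<rho> x z * \<psi> z)" for \<psi>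
      by (simp add: l2inner_def cong: infsum_cong)
    then have 1: "l2inner X r (e j) = complex_of_real (p j) * e j x" if "j \<in> X" for j
      using eig[OF that x] by simp
    have 2: "l2inner X (e j) (ket y) = cnj (e j y)" for j
      using l2inner_ket[OF y, of "e j"] l2inner_cnj[of X "ket y" "e j"] by simp
    have "l2inner X r (ket y) = cnj (\<rho> y x)"
      using l2inner_ket[OF y, of r] l2inner_cnj[of X "ket y" r] y by (simp add: r_def)
    then have 3: "l2inner X r (ket y) = \<rho> x y"
      using density_operator_hermitian[OF \<rho> x y] by simp
    show ?thesis
      using parseval_inner[OF pb r ell2_ket[OF y]] unfolding 3
      by (rule has_sum_cong[THEN iffD1, rotated]) (simp add: 1 2)
  qed
  have p: "p j \<ge> 0" if j: "j \<in> X" for j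
  proof -
    \<comment> \<open>The terms of the quadratic form at the eigenvector \<open>e j\<close>; they
      are shown to sum to \<open>p j\<close>.\<close>
    let ?Q = "\<lambda>(x, y). cnj (e j x) * \<rho> x y * e j y"
    have "(\<lambda>x. (cmod (e j x))\<^sup>2) summable_on X" using e[OF j] by (simp add: ell2_def)
    from summable_on_Times_real[OF this has_sum_imp_summable[OF tr]]
    have s1: "(\<lambda>(x, y). (cmod (e j x))\<^sup>2 * Re (\<rho> y y)) summable_on X \<times> X" .
    then have s2: "(\<lambda>(x, y). (cmod (e j y))\<^sup>2 * Re (\<rho> x x)) summable_on X \<times> X"
      by (subst summable_on_swap) simp
    have "?Q summable_on X \<times> X"
      using summable_on_cmult_right[OF summable_on_add[OF s1 s2], of "1 / 2"]
    proof (rule summable_on_complex_comparison)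
      fix q assume "q \<in> X \<times> X"
      then obtain x y where q: "q = (x, y)" "x \<in> X" "y \<in> X" by auto
      have "cmod (\<rho> x y) \<le> sqrt (Re (\<rho> x x)) * sqrt (Re (\<rho> y y))"
        using real_le_rsqrt[OF cs[OF q(2,3)]] by (simp add: real_sqrt_mult)
      then have "cmod (e j x) * cmod (e j y) * cmod (\<rho> x y) \<le>
          cmod (e j x) * cmod (e j y) * (sqrt (Re (\<rho> x x)) * sqrt (Re (\<rho> y y)))"
        by (intro mult_left_mono) auto
      also have "\<dots> = (cmod (e j x) * sqrt (Re (\<rho> y y))) * (cmod (e j y) * sqrt (Re (\<rho> x x)))"
        by simp
      also have "\<dots> \<le> ((cmod (e j x) * sqrt (Re (\<rho> y y)))\<^sup>2 + (cmod (e j y) * sqrt (Re (\<rho> x x)))\<^sup>2) / 2"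
        by (rule mult_le_half_squares)
      finally show "cmod (?Q q) \<le> 1 / 2 * ((case q of (x, y) \<Rightarrow> (cmod (e j x))\<^sup>2 * Re (\<rho> y y)) +
          (case q of (x, y) \<Rightarrow> (cmod (e j y))\<^sup>2 * Re (\<rho> x x)))"
        using diag(1) q by (simp add: norm_mult power_mult_distrib mult_ac)
    qed
    then have Q: "(?Q has_sum infsum ?Q (X \<times> X)) (X \<times> X)" by simp
    have "infsum ?Q (X \<times> X) = (\<Sum>\<^sub>\<infinity>x\<in>X. \<Sum>\<^sub>\<infinity>y\<in>X. cnj (e j x) * (\<rho> x y * e j y))"
      using infsum_Sigma_banach[OF has_sum_imp_summable[OF Q]] by (simp add: mult.assoc)
    also have "\<dots> = (\<Sum>\<^sub>\<infinity>x\<in>X. complex_of_real (p j) * (cnj (e j x) * e j x))"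
      by (intro infsum_cong) (simp only: infsum_cmult_right' eig[OF j], simp)
    also have "\<dots> = complex_of_real (p j)"
      using parseval_basisD(2)[OF pb j j] by (simp add: infsum_cmult_right' l2inner_def)
    finally have "(?Q has_sum complex_of_real (p j)) (X \<times> X)" using Q by simp
    from has_sum_Re[OF this] have Q: "((\<lambda>q. Re (?Q q)) has_sum p j) (X \<times> X)" by simp
    show ?thesis
    proof (rule ccontr)
      assume "\<not> p j \<ge> 0"
      then have "eventually (\<lambda>F. dist (\<Sum>q\<in>F. Re (?Q q)) (p j) < - p j) (finite_subsets_at_top (X \<times> X))"
        using Q by (intro tendstoD) (auto simp: has_sum_def)
      then obtain F where F': "finite F \<and> F \<subseteq> X \<times> X \<and>
          (\<forall>G. finite G \<and> F \<subseteq> G \<and> G \<subseteq> X \<times> X \<longrightarrow> dist (\<Sum>q\<in>G. Re (?Q q)) (p j) < - p j)"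
        unfolding eventually_finite_subsets_at_top by (rule exE)
      note F = F'[THEN conjunct1] F'[THEN conjunct2, THEN conjunct1]
        and FG = F'[THEN conjunct2, THEN conjunct2, rule_format]
      \<comment> \<open>A finite set of pairs with sum near \<open>p j\<close> is enlarged to a
        square \<open>G \<times> G\<close>, where the partial sum is a value of the form at a
        finitely supported vector. It cannot be negative.\<close>
      define G where "G = fst ` F \<union> snd ` F"
      have G: "finite G" "G \<subseteq> X" "F \<subseteq> G \<times> G"
        using F by (force simp: G_def)+
      have "(\<Sum>x\<in>G. \<Sum>y\<in>G. cnj (e j x) * \<rho> x y * e j y) \<in> \<real>\<^sub>\<ge>\<^sub>0"
        using \<rho> G by (simp add: density_operator_def)
      then have "Re (\<Sum>q\<in>G \<times> G. ?Q q) \<ge> 0"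
        by (simp add: sum.cartesian_product complex_nonneg_Reals_iff)
      moreover have "dist (\<Sum>q\<in>G \<times> G. Re (?Q q)) (p j) < - p j"
        using G by (intro FG conjI) auto
      ultimately show False
        by (simp add: dist_real_def abs_less_iff)
    qed
  qed
  \<comment> \<open>One double sum in two orders: over \<open>j\<close> first it gives the diagonal
    of \<open>\<rho>\<close>, hence the total 1; over \<open>x\<close> first it gives
    \<open>p\<close>.\<close>
  have "((\<lambda>(x, j). p j * (cmod (e j x))\<^sup>2) has_sum 1) (X \<times> X)"
  proof (rule has_sum_SigmaI_nonneg[OF _ tr])
    fix x assume x: "x \<in> X"
    show "((\<lambda>j. case (x, j) of (x, j) \<Rightarrow> p j * (cmod (e j x))\<^sup>2) has_sum Re (\<rho> x x)) X"
      using has_sum_Re[OF R[OF x x]]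
      by (rule has_sum_cong[THEN iffD1, rotated]) (simp add: cmod_power2, simp add: power2_eq_square algebra_simps)
  qed (use p in auto)
  then have "((\<lambda>(j, x). p j * (cmod (e j x))\<^sup>2) has_sum 1) (X \<times> X)"
    by (subst has_sum_swap) simp
  then have "(p has_sum 1) X"
  proof (rule has_sum_SigmaD)
    fix j assume j: "j \<in> X"
    show "((\<lambda>x. case (j, x) of (j, x) \<Rightarrow> p j * (cmod (e j x))\<^sup>2) has_sum p j) X"
      using has_sum_cmult_right[OF ell2_has_sum[OF e[OF j]], of "p j"] parseval_l2sq[OF pb j] by simp
  qed
  then show ?thesis
    using pb p R by (simp add: spectral_mixture_def)
qed

section \<open>Canonical states and the choice of an eigenbasis\<close>

lemma eigenbasis_eigenvalue_unique:
  assumes H: "symmetric_operator X H" and e: "eigenbasis X H e E" and e': "eigenbasis X H e' E'"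
    and ij: "i \<in> X" "j \<in> X" "l2inner X (e i) (e' j) \<noteq> 0"
  shows "E i = E' j"
proof -
  have ell: "e i \<in> ell2 X" "e' j \<in> ell2 X"
    using e e' ij by (auto simp: eigenbasis_def orthonormal_basis_def)
  have "l2inner X (e i) (op_app H (e' j)) = l2inner X (op_app H (e i)) (e' j)"
  proof -
    have "e i \<in> op_dom H" "e' j \<in> op_dom H"
      using e e' ij by (simp_all add: eigenbasis_def)
    then show ?thesis
      using H by (simp add: symmetric_operator_def)
  qed
  also have "op_app H (e i) = (\<lambda>x. complex_of_real (E i) * e i x)"
    using e ij by (simp add: eigenbasis_def)
  also have "l2inner X \<dots> (e' j) = cnj (l2inner X (e' j) (\<lambda>x. complex_of_real (E i) * e i x))"
    by (simp only: l2inner_cnj)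
  also have "\<dots> = complex_of_real (E i) * l2inner X (e i) (e' j)"
    by (simp add: l2inner_cmult_right ell l2inner_cnj)
  also have "op_app H (e' j) = (\<lambda>x. complex_of_real (E' j) * e' j x)"
    using e' ij by (simp add: eigenbasis_def)
  also have "l2inner X (e i) \<dots> = complex_of_real (E' j) * l2inner X (e i) (e' j)"
    by (simp add: l2inner_cmult_right ell)
  finally show ?thesis using ij(3) by simp
qed

text \<open>
  Needed since \<open>has_canonical\<close> speaks of some eigenbasis, whereas \<open>eigensystem\<close> may choose another one.
\<close>

lemma eigenbasis_summable_transfer:
  assumes H: "symmetric_operator X H" and e: "eigenbasis X H e E" and e': "eigenbasis X H e' E'"
    and u: "\<And>x. u x \<ge> (0::real)" and s: "(\<lambda>j. u (E j)) summable_on X"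
  shows "(\<lambda>j. u (E' j)) summable_on X"
proof -
  have pb: "parseval_basis X e" "parseval_basis X e'"
    using e e' by (auto simp: eigenbasis_def orthonormal_basis_imp_parseval)
  \<comment> \<open>The squared overlaps of the two bases sum to 1 along rows and columns and
    connect equal eigenvalues only. Weighted by \<open>u\<close>, they therefore have both sums as
    iterated sums.\<close>
  have "((\<lambda>(i, j). u (E i) * (cmod (l2inner X (e i) (e' j)))\<^sup>2) has_sum (\<Sum>\<^sub>\<infinity>j\<in>X. u (E j))) (X \<times> X)"
  proof (rule has_sum_SigmaI_nonneg[OF _ has_sum_infsum[OF s]])
    fix i assume i: "i \<in> X"
    have "cmod (l2inner X (e' j) (e i)) = cmod (l2inner X (e i) (e' j))" for j
      by (metis complex_mod_cnj l2inner_cnj)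
    then show "((\<lambda>j. case (i, j) of (i, j) \<Rightarrow> u (E i) * (cmod (l2inner X (e i) (e' j)))\<^sup>2) has_sum u (E i)) X"
      using has_sum_cmult_right[OF parseval_basisD(3)[OF pb(2) parseval_basisD(1)[OF pb(1) i]], of "u (E i)"]
        parseval_l2sq[OF pb(1) i] by simp
  qed (use u in auto)
  then have "((\<lambda>(j, i). u (E i) * (cmod (l2inner X (e i) (e' j)))\<^sup>2) has_sum (\<Sum>\<^sub>\<infinity>j\<in>X. u (E j))) (X \<times> X)"
    by (subst has_sum_swap) simp
  then have "((\<lambda>j. u (E' j)) has_sum (\<Sum>\<^sub>\<infinity>j\<in>X. u (E j))) X"
  proof (rule has_sum_SigmaD)
    fix j assume j: "j \<in> X"
    have eq: "u (E i) * (cmod (l2inner X (e i) (e' j)))\<^sup>2 = u (E' j) * (cmod (l2inner X (e i) (e' j)))\<^sup>2"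
      if "i \<in> X" for i
      using eigenbasis_eigenvalue_unique[OF H e e' that j]
      by (cases "l2inner X (e i) (e' j) = 0") auto
    show "((\<lambda>i. case (j, i) of (j, i) \<Rightarrow> u (E i) * (cmod (l2inner X (e i) (e' j)))\<^sup>2) has_sum u (E' j)) X"
      using has_sum_cmult_right[OF parseval_basisD(3)[OF pb(1) parseval_basisD(1)[OF pb(2) j]], of "u (E' j)"]
      unfolding parseval_l2sq[OF pb(2) j] mult_1_right
      by (rule has_sum_cong[THEN iffD1, rotated]) (simp add: eq)
  qed
  then show ?thesis by (rule has_sum_imp_summable)
qed

lemma canonical_operator_spectral_mixture:
  assumes H: "selfadjoint_operator X H" and can: "has_canonical k X T H" and "X \<noteq> {}"
    and sys: "eigensystem X H = (e, E)"
  shows "spectral_mixture X e (\<lambda>j. exp (- E j / (k * T)) / quantum_partition_function k X T H)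
      (canonical_operator k X T H)"
    and "quantum_partition_function k X T H > 0"
proof -
  let ?Z = "quantum_partition_function k X T H"
  let ?w = "\<lambda>j. exp (- E j / (k * T)) / ?Z"
  obtain e' E' where e': "eigenbasis X H e' E'" "(\<lambda>j. exp (- E' j / (k * T))) summable_on X"
    using can by (auto simp: has_canonical_def)
  then have "\<exists>p. (case p of (e, E) \<Rightarrow> eigenbasis X H e E)" by auto
  from someI_ex[OF this] have eb: "eigenbasis X H e E"
    using sys by (simp add: eigensystem_def)
  have pb: "parseval_basis X e"
    using eb by (simp add: eigenbasis_def orthonormal_basis_imp_parseval)
  have "(\<lambda>j. exp (- E j / (k * T))) summable_on X"
    using H e'(2)
    by (intro eigenbasis_summable_transfer[OF _ e'(1) eb, of "\<lambda>x. exp (- x / (k * T))"])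
      (auto simp: selfadjoint_operator_def)
  then have Z: "((\<lambda>j. exp (- E j / (k * T))) has_sum ?Z) X"
    by (simp add: quantum_partition_function_def sys)
  obtain x0 where "x0 \<in> X" using \<open>X \<noteq> {}\<close> by auto
  with finite_sum_le_has_sum[OF Z, of "{x0}"] have "exp (- E x0 / (k * T)) \<le> ?Z" by simp
  then show Z0: "?Z > 0" using exp_gt_zero less_le_trans by blast
  have w: "(?w has_sum 1) X"
    using has_sum_cmult_left[OF Z, of "1 / ?Z"] Z0 by simp
  have "((\<lambda>j. complex_of_real (?w j) * e j x * cnj (e j y)) has_sum canonical_operator k X T H x y) X"
    if xy: "x \<in> X" "y \<in> X" for x y
  proof -
    have "(\<lambda>j. complex_of_real (?w j) * e j x * cnj (e j y)) summable_on X"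
      using has_sum_imp_summable[OF w]
    proof (rule summable_on_complex_comparison)
      fix j assume j: "j \<in> X"
      have "cmod (e j x) * cmod (e j y) \<le> 1"
        using parseval_le_1[OF pb j] xy by (intro mult_le_one) auto
      then have "?w j * (cmod (e j x) * cmod (e j y)) \<le> ?w j"
        using Z0 by (intro mult_left_le) auto
      then show "cmod (complex_of_real (?w j) * e j x * cnj (e j y)) \<le> ?w j"
        using Z0 by (simp add: norm_mult norm_divide mult.assoc)
    qed
    then show ?thesis
      by (simp add: canonical_operator_def sys)
  qed
  with pb w Z0 show "spectral_mixture X e ?w (canonical_operator k X T H)"
    by (simp add: spectral_mixture_def)
qed

section \<open>The quantum bound\<close>

definition res_vec :: "('a, 'i, 'b) quantum_setting \<Rightarrow> 'i \<Rightarrow> 'b \<Rightarrow> 'b \<Rightarrow> complex" where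
  "res_vec S i = fst (eigensystem (q_res S i) (q_res_ham S i))"

definition res_energy :: "('a, 'i, 'b) quantum_setting \<Rightarrow> 'i \<Rightarrow> 'b \<Rightarrow> real" where
  "res_energy S i = snd (eigensystem (q_res S i) (q_res_ham S i))"

definition res_weight :: "real \<Rightarrow> ('a, 'i, 'b) quantum_setting \<Rightarrow> 'i \<Rightarrow> 'b \<Rightarrow> real" where
  "res_weight k S i j = exp (- res_energy S i j / (k * q_temp S i)) /
     quantum_partition_function k (q_res S i) (q_temp S i) (q_res_ham S i)"

definition comp_vec ::
  "('a, 'i, 'b) quantum_setting \<Rightarrow> 'i set \<Rightarrow> ('a \<Rightarrow> 'a \<Rightarrow> complex) \<Rightarrow>
   'a \<times> ('i \<Rightarrow> 'b) \<Rightarrow> 'a \<times> ('i \<Rightarrow> 'b) \<Rightarrow> complex" where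
  "comp_vec S I e J z =
     (if z \<in> q_comp S I then e (fst J) (fst z) * (\<Prod>i\<in>I. res_vec S i (snd J i) (snd z i)) else 0)"

definition comp_weight ::
  "real \<Rightarrow> ('a, 'i, 'b) quantum_setting \<Rightarrow> 'i set \<Rightarrow> ('a \<Rightarrow> real) \<Rightarrow> 'a \<times> ('i \<Rightarrow> 'b) \<Rightarrow> real" where
  "comp_weight k S I p J = p (fst J) * (\<Prod>i\<in>I. res_weight k S i (snd J i))"

text \<open>The matrix \<open>qm_initial\<close> detached from a manipulation, with the set of
  reservoirs as a parameter so that single reservoirs can be split off.\<close>

definition comp_density ::
  "real \<Rightarrow> ('a, 'i, 'b) quantum_setting \<Rightarrow> 'i set \<Rightarrow> ('a \<Rightarrow> 'a \<Rightarrow> complex) \<Rightarrow>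
   'a \<times> ('i \<Rightarrow> 'b) \<Rightarrow> 'a \<times> ('i \<Rightarrow> 'b) \<Rightarrow> complex" where
  "comp_density k S I \<rho> z w = \<rho> (fst z) (fst w) *
     (\<Prod>i\<in>I. canonical_operator k (q_res S i) (q_temp S i) (q_res_ham S i) (snd z i) (snd w i))"

definition bath_vec :: "('a, 'i, 'b) quantum_setting \<Rightarrow> 'i set \<Rightarrow> ('i \<Rightarrow> 'b) \<Rightarrow> ('i \<Rightarrow> 'b) \<Rightarrow> complex" where
  "bath_vec S I J y = (if y \<in> (\<Pi>\<^sub>E i\<in>I. q_res S i) then \<Prod>i\<in>I. res_vec S i (J i) (y i) else 0)"

lemma res_spectral_mixture:
  assumes "quantum_setting k S"
  shows "spectral_mixture (q_res S i) (res_vec S i) (res_weight k S i)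
      (canonical_operator k (q_res S i) (q_temp S i) (q_res_ham S i))"
    and "quantum_partition_function k (q_res S i) (q_temp S i) (q_res_ham S i) > 0"
proof -
  have "selfadjoint_operator (q_res S i) (q_res_ham S i)"
    "has_canonical k (q_res S i) (q_temp S i) (q_res_ham S i)" "q_res S i \<noteq> {}"
    using assms by (simp_all add: quantum_setting_def)
  note c = canonical_operator_spectral_mixture[OF this, of "res_vec S i" "res_energy S i"]
  show "spectral_mixture (q_res S i) (res_vec S i) (res_weight k S i)
      (canonical_operator k (q_res S i) (q_temp S i) (q_res_ham S i))"
    using c(1) by (simp add: res_vec_def res_energy_def res_weight_def[abs_def])
  show "quantum_partition_function k (q_res S i) (q_temp S i) (q_res_ham S i) > 0"
    using c(2) by (simp add: res_vec_def res_energy_def)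
qed

text \<open>The empty tensor product, on which the induction over the reservoirs starts:
  \<open>PiE\<close> over the empty set consists of one function, constantly
  \<open>undefined\<close>.\<close>

lemma spectral_mixture_singleton:
  "spectral_mixture {u} (\<lambda>_ y. if y = u then 1 else 0) (\<lambda>_. 1) (\<lambda>_ _. 1)"
  by (auto simp: spectral_mixture_def parseval_basis_def ell2_def l2inner_def l2sq_def intro!: has_sum_finiteI)

lemma bath_spectral_mixture:
  assumes "quantum_setting k S" "finite I"
  shows "spectral_mixture (\<Pi>\<^sub>E i\<in>I. q_res S i) (bath_vec S I) (\<lambda>J. \<Prod>i\<in>I. res_weight k S i (J i))
    (\<lambda>y y'. \<Prod>i\<in>I. canonical_operator k (q_res S i) (q_temp S i) (q_res_ham S i) (y i) (y' i))"
  using assms(2)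
proof (induction I rule: finite_induct)
  case empty
  then show ?case
    using spectral_mixture_singleton[of "\<lambda>_. undefined"] by (simp add: bath_vec_def[abs_def] cong: if_cong)
next
  case (insert i I)
  have mem: "(\<lambda>j. if j = i then v else y j) \<in> (\<Pi>\<^sub>E i\<in>insert i I. q_res S i)"
    if "v \<in> q_res S i" "y \<in> (\<Pi>\<^sub>E i\<in>I. q_res S i)" for v y
    using PiE_fun_upd[OF that] by (simp add: fun_upd_def)
  have ne: "j \<noteq> i" if "j \<in> I" for j
    using insert.hyps(2) that by auto
  have bij: "bij_betw (\<lambda>(v, y). y(i := v)) (q_res S i \<times> (\<Pi>\<^sub>E i\<in>I. q_res S i)) (\<Pi>\<^sub>E i\<in>insert i I. q_res S i)"
    using inj_combinator[OF insert.hyps(2)] by (simp add: bij_betw_def PiE_insert_eq)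
  show ?case
    by (rule spectral_mixture_product[OF bij res_spectral_mixture(1)[OF assms(1)] insert.IH])
      (simp_all add: bath_vec_def insert.hyps ne mem cong: prod.cong)
qed

lemma bij_betw_q_comp: "bij_betw (\<lambda>p. p) (q_sys S \<times> (\<Pi>\<^sub>E i\<in>I. q_res S i)) (q_comp S I)"
  by (simp add: bij_betw_def q_comp_def)

lemma comp_spectral_mixture:
  assumes "quantum_setting k S" "finite I" "spectral_mixture (q_sys S) e p \<rho>"
  shows "spectral_mixture (q_comp S I) (comp_vec S I e) (comp_weight k S I p) (comp_density k S I \<rho>)"
  by (rule spectral_mixture_product[OF bij_betw_q_comp assms(3) bath_spectral_mixture[OF assms(1,2)]])
    (auto simp: comp_vec_def bath_vec_def comp_weight_def comp_density_def q_comp_def)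

text \<open>The splitting behind \<open>qm_marginal_res\<close>: one reservoir coordinate
  \<open>v\<close> against everything else, where \<open>y\<close> is \<open>undefined\<close> at
  \<open>i\<close> until \<open>v\<close> is inserted.\<close>

lemma bij_betw_q_comp_remove:
  assumes "i \<in> I"
  shows "bij_betw (\<lambda>(v, x, y). (x, y(i := v))) (q_res S i \<times> q_comp S (I - {i})) (q_comp S I)"
proof -
  have bij: "bij_betw (\<lambda>(v, y). y(i := v)) (q_res S i \<times> (\<Pi>\<^sub>E i\<in>I - {i}. q_res S i)) (\<Pi>\<^sub>E i\<in>I. q_res S i)"
    using inj_combinator[of i "I - {i}" "q_res S"] PiE_insert_eq[of i "I - {i}" "q_res S"]
    by (simp add: bij_betw_def insert_absorb[OF assms])
  show ?thesis
    unfolding q_comp_def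
  proof (rule bij_betw_imageI)
    show "inj_on (\<lambda>(v, x, y). (x, y(i := v))) (q_res S i \<times> q_sys S \<times> (\<Pi>\<^sub>E i\<in>I - {i}. q_res S i))"
      using bij_betw_imp_inj_on[OF bij] unfolding inj_on_def by fastforce
    show "(\<lambda>(v, x, y). (x, y(i := v))) ` (q_res S i \<times> q_sys S \<times> (\<Pi>\<^sub>E i\<in>I - {i}. q_res S i)) =
        q_sys S \<times> (\<Pi>\<^sub>E i\<in>I. q_res S i)"
      unfolding bij_betw_imp_surj_on[OF bij, symmetric]
    proof (intro equalityI subsetI)
      fix z assume "z \<in> q_sys S \<times> (\<lambda>(v, y). y(i := v)) ` (q_res S i \<times> (\<Pi>\<^sub>E i\<in>I - {i}. q_res S i))"
      then obtain x v y where "z = (x, y(i := v))" "(v, x, y) \<in> q_res S i \<times> q_sys S \<times> (\<Pi>\<^sub>E i\<in>I - {i}. q_res S i)"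
        by (auto simp del: PiE_iff)
      then show "z \<in> (\<lambda>(v, x, y). (x, y(i := v))) ` (q_res S i \<times> q_sys S \<times> (\<Pi>\<^sub>E i\<in>I - {i}. q_res S i))"
        by (intro image_eqI[of _ _ "(v, x, y)"]) simp_all
    qed auto
  qed
qed

lemma comp_remove:
  assumes "finite I" "i \<in> I"
  shows "v' \<in> q_res S i \<Longrightarrow> (x', y') \<in> q_comp S (I - {i}) \<Longrightarrow>
      comp_vec S I e (x, y(i := v)) (x', y'(i := v')) = res_vec S i v v' * comp_vec S (I - {i}) e (x, y) (x', y')"
    and "comp_weight k S I p (x, y(i := v)) = res_weight k S i v * comp_weight k S (I - {i}) p (x, y)"
proof -
  have "(\<Prod>j\<in>I - {i}. h j ((y(i := v)) j) ((y'(i := v')) j)) = (\<Prod>j\<in>I - {i}. h j (y j) (y' j))"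
    for h :: "_ \<Rightarrow> _ \<Rightarrow> _ \<Rightarrow> complex" and y' v'
    by (intro prod.cong) auto
  moreover have "(x', y'(i := v')) \<in> q_comp S I"
    if "v' \<in> q_res S i" "(x', y') \<in> q_comp S (I - {i})"
    using bij_betwE[OF bij_betw_q_comp_remove[OF assms(2), of S], rule_format, of "(v', x', y')"] that by simp
  ultimately show "comp_vec S I e (x, y(i := v)) (x', y'(i := v')) =
      res_vec S i v v' * comp_vec S (I - {i}) e (x, y) (x', y')"
    if "v' \<in> q_res S i" "(x', y') \<in> q_comp S (I - {i})"
    using that assms by (simp add: comp_vec_def prod.remove[of I i] del: fun_upd_apply) (simp)
  have "(\<Prod>j\<in>I - {i}. res_weight k S j ((y(i := v)) j)) = (\<Prod>j\<in>I - {i}. res_weight k S j (y j))"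
    by (intro prod.cong) auto
  then show "comp_weight k S I p (x, y(i := v)) = res_weight k S i v * comp_weight k S (I - {i}) p (x, y)"
    using assms by (simp add: comp_weight_def prod.remove[of I i])
qed

section \<open>The joint law of initial and final eigenvectors\<close>

definition transition ::
  "('a, 'i, 'b) quantum_setting \<Rightarrow> 'i set \<Rightarrow> (('a \<times> ('i \<Rightarrow> 'b) \<Rightarrow> complex) \<Rightarrow> 'a \<times> ('i \<Rightarrow> 'b) \<Rightarrow> complex) \<Rightarrow>
   ('a \<Rightarrow> 'a \<Rightarrow> complex) \<Rightarrow> ('a \<Rightarrow> 'a \<Rightarrow> complex) \<Rightarrow> 'a \<times> ('i \<Rightarrow> 'b) \<Rightarrow> 'a \<times> ('i \<Rightarrow> 'b) \<Rightarrow> real" where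
  "transition S I U e f J K = (cmod (l2inner (q_comp S I) (comp_vec S I f K) (U (comp_vec S I e J))))\<^sup>2"

lemma transition_nonneg: "transition S I U e f J K \<ge> 0"
  by (simp add: transition_def)

context
  fixes k :: real and S :: "('a, 'i, 'b) quantum_setting" and I :: "'i set"
    and U :: "('a \<times> ('i \<Rightarrow> 'b) \<Rightarrow> complex) \<Rightarrow> 'a \<times> ('i \<Rightarrow> 'b) \<Rightarrow> complex"
    and e f :: "'a \<Rightarrow> 'a \<Rightarrow> complex" and p q :: "'a \<Rightarrow> real" and \<rho> \<rho>' :: "'a \<Rightarrow> 'a \<Rightarrow> complex"
  assumes S: "quantum_setting k S" and I: "finite I" and U: "unitary_operator (q_comp S I) U"
    and e: "spectral_mixture (q_sys S) e p \<rho>" and f: "spectral_mixture (q_sys S) f q \<rho>'"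
begin

private abbreviation (input) "Z \<equiv> q_comp S I"
private abbreviation (input) "P J K \<equiv> comp_weight k S I p J * transition S I U e f J K"

private lemmas comp_spectral_final = spectral_mixture_conjugate[OF U comp_spectral_mixture[OF S I e]]

lemma transition_sum_final: "J \<in> Z \<Longrightarrow> (transition S I U e f J has_sum 1) Z"
  using parseval_basisD(3)[OF spectral_mixtureD(1)[OF comp_spectral_mixture[OF S I f]]
      parseval_basisD(1)[OF spectral_mixtureD(1)[OF comp_spectral_final]], of J]
    parseval_l2sq[OF spectral_mixtureD(1)[OF comp_spectral_final], of J]
  by (simp add: transition_def[abs_def])

lemma joint_nonneg: "J \<in> Z \<Longrightarrow> P J K \<ge> 0"
  using spectral_mixtureD(2)[OF comp_spectral_mixture[OF S I e]] by (simp add: transition_nonneg)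

text \<open>The transition probabilities out of a label sum to 1, so summing over all final labels
  leaves the initial weights. The map \<open>h\<close> covers both cases needed: all labels, and the
  labels with one component fixed.\<close>

lemma joint_initial_marginal:
  assumes "\<And>c. c \<in> C \<Longrightarrow> h c \<in> Z" "((\<lambda>c. comp_weight k S I p (h c)) has_sum s) C"
  shows "((\<lambda>(c, K). P (h c) K) has_sum s) (C \<times> Z)"
  by (rule has_sum_SigmaI_nonneg[OF _ assms(2)])
    (use has_sum_cmult_right[OF transition_sum_final[OF assms(1)]] assms(1) joint_nonneg in auto)

lemma joint_total: "((\<lambda>(J, K). P J K) has_sum 1) (Z \<times> Z)"
  using joint_initial_marginal[of Z "\<lambda>J. J"] spectral_mixtureD(3)[OF comp_spectral_mixture[OF S I e]]
  by simp

lemma joint_sys_initial: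
  assumes "((\<lambda>j. p j * u j) has_sum s) (q_sys S)"
  shows "((\<lambda>(J, K). P J K * u (fst J)) has_sum s) (Z \<times> Z)"
proof (rule has_sum_disintegrate_fst[OF bij_betw_q_comp joint_nonneg _ _ assms])
  fix j assume j: "j \<in> q_sys S"
  have "((\<lambda>y. comp_weight k S I p (j, y)) has_sum p j * 1) (\<Pi>\<^sub>E i\<in>I. q_res S i)"
    using has_sum_cmult_right[OF spectral_mixtureD(3)[OF bath_spectral_mixture[OF S I]], of "p j"]
    by (simp add: comp_weight_def)
  then show "((\<lambda>(y, K). P (j, y) K) has_sum p j) ((\<Pi>\<^sub>E i\<in>I. q_res S i) \<times> Z)"
    using j by (intro joint_initial_marginal) (auto simp: q_comp_def)
qed auto

lemma joint_res_initial:
  assumes i: "i \<in> I" and s: "((\<lambda>v. res_weight k S i v * u v) has_sum s) (q_res S i)"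
  shows "((\<lambda>(J, K). P J K * u (snd J i)) has_sum s) (Z \<times> Z)"
proof (rule has_sum_disintegrate_fst[OF bij_betw_q_comp_remove[OF i] joint_nonneg _ _ s])
  fix v assume v: "v \<in> q_res S i"
  have "((\<lambda>r. comp_weight k S I p (case (v, r) of (v, x, y) \<Rightarrow> (x, y(i := v)))) has_sum res_weight k S i v * 1)
      (q_comp S (I - {i}))"
    using has_sum_cmult_right[OF spectral_mixtureD(3)[OF comp_spectral_mixture[OF S _ e]], of "I - {i}" "res_weight k S i v"] I
    by (simp add: case_prod_unfold comp_remove(2)[OF I i])
  then show "((\<lambda>(r, K). P (case (v, r) of (v, x, y) \<Rightarrow> (x, y(i := v))) K) has_sum res_weight k S i v)
      (q_comp S (I - {i}) \<times> Z)"
    using bij_betwE[OF bij_betw_q_comp_remove[OF i, of S]] v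
    by (intro joint_initial_marginal) auto
qed auto

text \<open>The final label of the system follows the diagonal, in the basis \<open>f\<close>, of
  the reduced final state. It stands apart from \<open>joint_sys_final\<close> because it also shows
  that labels of reference weight zero are never reached.\<close>

lemma joint_sys_final_fibre:
  assumes m: "\<And>x x'. x \<in> q_sys S \<Longrightarrow> x' \<in> q_sys S \<Longrightarrow>
      m x x' = (\<Sum>\<^sub>\<infinity>y\<in>(\<Pi>\<^sub>E i\<in>I. q_res S i). conjugate_by Z U (comp_density k S I \<rho>) (x, y) (x', y))"
    and v: "v \<in> q_sys S"
  shows "((\<lambda>(J, y). P J (v, y)) has_sum Re (l2inner (q_sys S) (f v) (mat_app (q_sys S) m (f v))))
      (Z \<times> (\<Pi>\<^sub>E i\<in>I. q_res S i))"
  unfolding transition_def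
proof (rule partial_trace_expectation[OF bij_betw_q_comp comp_spectral_final])
  show "f v \<in> ell2 (q_sys S)" "l2sq (q_sys S) (f v) = 1"
    using spectral_mixtureD(1)[OF f] v by (auto intro: parseval_basisD parseval_l2sq)
  show "parseval_basis (\<Pi>\<^sub>E i\<in>I. q_res S i) (bath_vec S I)"
    by (rule spectral_mixtureD(1)[OF bath_spectral_mixture[OF S I]])
qed (auto simp: m comp_vec_def bath_vec_def q_comp_def)

lemma joint_sys_final:
  assumes m: "\<And>x x'. x \<in> q_sys S \<Longrightarrow> x' \<in> q_sys S \<Longrightarrow>
      m x x' = (\<Sum>\<^sub>\<infinity>y\<in>(\<Pi>\<^sub>E i\<in>I. q_res S i). conjugate_by Z U (comp_density k S I \<rho>) (x, y) (x', y))"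
    and s: "((\<lambda>v. Re (l2inner (q_sys S) (f v) (mat_app (q_sys S) m (f v))) * u v) has_sum s) (q_sys S)"
  shows "((\<lambda>(J, K). P J K * u (fst K)) has_sum s) (Z \<times> Z)"
  by (rule has_sum_disintegrate_snd[OF bij_betw_q_comp joint_nonneg _ _ s])
    (use joint_sys_final_fibre[OF m] in auto)

text \<open>The partial trace over everything except reservoir \<open>i\<close>. It is applied to
  the final evolution and, through \<open>initial_res_expectation\<close>, to the evolution at the
  starting time.\<close>

lemma joint_res_final_fibre:
  assumes i: "i \<in> I" and v: "v \<in> q_res S i"
    and m: "\<And>x x'. x \<in> q_res S i \<Longrightarrow> x' \<in> q_res S i \<Longrightarrow>
      m x x' = (\<Sum>\<^sub>\<infinity>(x0, y)\<in>q_comp S (I - {i}). conjugate_by Z U (comp_density k S I \<rho>) (x0, y(i := x)) (x0, y(i := x')))"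
  shows "((\<lambda>(J, r). P J (case (v, r) of (v, x, y) \<Rightarrow> (x, y(i := v)))) has_sum
      Re (l2inner (q_res S i) (res_vec S i v) (mat_app (q_res S i) m (res_vec S i v))))
      (Z \<times> q_comp S (I - {i}))"
  unfolding transition_def
proof (rule partial_trace_expectation[OF bij_betw_q_comp_remove[OF i] comp_spectral_final])
  note r = spectral_mixtureD(1)[OF res_spectral_mixture(1)[OF S]]
  show "res_vec S i v \<in> ell2 (q_res S i)" "l2sq (q_res S i) (res_vec S i v) = 1"
    using r v by (auto intro: parseval_basisD parseval_l2sq)
  show "parseval_basis (q_comp S (I - {i})) (comp_vec S (I - {i}) f)"
    using I by (intro spectral_mixtureD(1)[OF comp_spectral_mixture[OF S _ f]]) simp
  show "comp_vec S I f (case (v, r) of (v, x, y) \<Rightarrow> (x, y(i := v))) (case (x, y) of (v, x, y) \<Rightarrow> (x, y(i := v))) =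
      res_vec S i v x * comp_vec S (I - {i}) f r y"
    if "x \<in> q_res S i" "y \<in> q_comp S (I - {i})" for r x y
    using comp_remove(1)[OF I i that(1), of "fst y" "snd y" f "fst r" "snd r" v] that(2)
    by (simp add: case_prod_unfold)
qed (auto simp: m comp_vec_def case_prod_unfold)

lemma joint_res_final:
  assumes i: "i \<in> I"
    and m: "\<And>x x'. x \<in> q_res S i \<Longrightarrow> x' \<in> q_res S i \<Longrightarrow>
      m x x' = (\<Sum>\<^sub>\<infinity>(x0, y)\<in>q_comp S (I - {i}). conjugate_by Z U (comp_density k S I \<rho>) (x0, y(i := x)) (x0, y(i := x')))"
    and s: "((\<lambda>v. Re (l2inner (q_res S i) (res_vec S i v) (mat_app (q_res S i) m (res_vec S i v))) * u v) has_sum s) (q_res S i)"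
  shows "((\<lambda>(J, K). P J K * u (snd K i)) has_sum s) (Z \<times> Z)"
  by (rule has_sum_disintegrate_snd[OF bij_betw_q_comp_remove[OF i] joint_nonneg _ _ s])
    (use joint_res_final_fibre[OF i _ m] in auto)

end

text \<open>The heat refers to the reduced state at the starting time as well. There
  \<open>U\<close> is the identity, so the final fibre lemma with \<open>e\<close> in both roles has
  Kronecker deltas as transition probabilities, and the diagonal of the reduced state collapses to
  the canonical weight.\<close>

lemma initial_res_expectation:
  assumes S: "quantum_setting k S" and I: "finite I" and U: "unitary_operator (q_comp S I) U"
    and e: "spectral_mixture (q_sys S) e p \<rho>"
    and id: "\<And>\<psi>. \<psi> \<in> ell2 (q_comp S I) \<Longrightarrow> U \<psi> = \<psi>"
    and i: "i \<in> I" and v: "v \<in> q_res S i"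
    and m: "\<And>x x'. x \<in> q_res S i \<Longrightarrow> x' \<in> q_res S i \<Longrightarrow>
      m x x' = (\<Sum>\<^sub>\<infinity>(x0, y)\<in>q_comp S (I - {i}). conjugate_by (q_comp S I) U (comp_density k S I \<rho>) (x0, y(i := x)) (x0, y(i := x')))"
  shows "Re (l2inner (q_res S i) (res_vec S i v) (mat_app (q_res S i) m (res_vec S i v))) = res_weight k S i v"
proof -
  let ?Z = "q_comp S I" and ?\<beta> = "\<lambda>r. (fst r, (snd r)(i := v))"
  note sp = comp_spectral_mixture[OF S I e]
  note pb = spectral_mixtureD(1)[OF sp]
  have mem: "?\<beta> r \<in> ?Z" if "r \<in> q_comp S (I - {i})" for r
    using bij_betwE[OF bij_betw_q_comp_remove[OF i, of S], rule_format, of "(v, r)"] v that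
    by (simp add: case_prod_unfold)
  have T: "transition S I U e e J K = (if J = K then 1 else 0)" if "J \<in> ?Z" "K \<in> ?Z" for J K
    using parseval_basisD(1,2)[OF pb] that by (simp add: transition_def id)
  have "((\<lambda>(J, r). comp_weight k S I p J * transition S I U e e J (?\<beta> r)) has_sum
      Re (l2inner (q_res S i) (res_vec S i v) (mat_app (q_res S i) m (res_vec S i v)))) (?Z \<times> q_comp S (I - {i}))"
    using joint_res_final_fibre[OF S I U e e i v m] by (simp add: case_prod_unfold)
  then have *: "((\<lambda>(r, J). comp_weight k S I p J * transition S I U e e J (?\<beta> r)) has_sum
      Re (l2inner (q_res S i) (res_vec S i v) (mat_app (q_res S i) m (res_vec S i v)))) (q_comp S (I - {i}) \<times> ?Z)"
    by (subst has_sum_swap) simp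
  have "((\<lambda>r. comp_weight k S I p (?\<beta> r)) has_sum
      Re (l2inner (q_res S i) (res_vec S i v) (mat_app (q_res S i) m (res_vec S i v)))) (q_comp S (I - {i}))"
  proof (rule has_sum_SigmaD[OF *])
    fix r assume r: "r \<in> q_comp S (I - {i})"
    show "((\<lambda>J. case (r, J) of (r, J) \<Rightarrow> comp_weight k S I p J * transition S I U e e J (?\<beta> r)) has_sum
        comp_weight k S I p (?\<beta> r)) ?Z"
      by (rule has_sum_finite_neutralI[of "{?\<beta> r}"]) (use mem[OF r] T in auto)
  qed
  moreover have "((\<lambda>r. comp_weight k S I p (?\<beta> r)) has_sum res_weight k S i v * 1) (q_comp S (I - {i}))"
    using has_sum_cmult_right[OF spectral_mixtureD(3)[OF comp_spectral_mixture[OF S _ e]], of "I - {i}" "res_weight k S i v"] I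
    by (simp add: comp_remove(2)[OF I i])
  ultimately show ?thesis
    using has_sum_unique by fastforce
qed

section \<open>Orthogonality of supports and the estimate for all initial states\<close>

lemma spectral_mixture_eigen_left:
  assumes sp: "spectral_mixture X e p \<rho>" and i: "i \<in> X" and \<psi>: "\<psi> \<in> ell2 X"
  shows "l2inner X (e i) (mat_app X \<rho> \<psi>) = complex_of_real (p i) * l2inner X (e i) \<psi>"
proof -
  note pb = parseval_basisD(1,2)[OF spectral_mixtureD(1)[OF sp]]
  have "((\<lambda>j. complex_of_real (p j) * l2inner X (e j) \<psi> * l2inner X (e i) (e j)) has_sum
      complex_of_real (p i) * l2inner X (e i) \<psi>) X"
    by (rule has_sum_finite_neutralI[of "{i}"]) (auto simp: i pb)
  with spectral_mixture_apply(2)[OF sp \<psi> pb(1)[OF i]] show ?thesis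
    by (rule has_sum_unique)
qed

lemma spectral_mixture_eigen_right:
  assumes sp: "spectral_mixture X e p \<rho>" and i: "i \<in> X" and a: "a \<in> ell2 X"
  shows "l2inner X a (mat_app X \<rho> (e i)) = complex_of_real (p i) * l2inner X a (e i)"
proof -
  note pb = parseval_basisD(1,2)[OF spectral_mixtureD(1)[OF sp]]
  have "((\<lambda>j. complex_of_real (p j) * l2inner X (e j) (e i) * l2inner X a (e j)) has_sum
      complex_of_real (p i) * l2inner X a (e i)) X"
    by (rule has_sum_finite_neutralI[of "{i}"]) (auto simp: i pb)
  with spectral_mixture_apply(2)[OF sp pb(1)[OF i] a] show ?thesis
    by (rule has_sum_unique)
qed

text \<open>Between the two eigenvectors the product \<open>\<rho> \<rho>'\<close> has the matrix
  element \<open>p i * p' j\<close> times their inner product, and both weights are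
  positive.\<close>

lemma orthogonal_mixtures:
  assumes sp: "spectral_mixture X e p \<rho>" "spectral_mixture X e' p' \<rho>'"
    and orth: "\<And>\<psi>. \<psi> \<in> ell2 X \<Longrightarrow> mat_app X \<rho> (mat_app X \<rho>' \<psi>) = (\<lambda>x. 0)"
    and ij: "i \<in> X" "j \<in> X" "p i > 0" "p' j > 0"
  shows "l2inner X (e i) (e' j) = 0"
proof -
  have e: "e i \<in> ell2 X" "e' j \<in> ell2 X"
    using parseval_basisD(1)[OF spectral_mixtureD(1)[OF sp(1)] ij(1)]
      parseval_basisD(1)[OF spectral_mixtureD(1)[OF sp(2)] ij(2)] by auto
  have "complex_of_real (p i) * (complex_of_real (p' j) * l2inner X (e i) (e' j)) =
      l2inner X (e i) (mat_app X \<rho> (mat_app X \<rho>' (e' j)))"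
    by (simp add: spectral_mixture_eigen_left[OF sp(1) ij(1) spectral_mixture_apply(1)[OF sp(2) e(2)]]
        spectral_mixture_eigen_right[OF sp(2) ij(2) e(1)])
  then show ?thesis
    using orth[OF e(2)] ij by simp
qed

lemma comp_vec_orthogonal:
  assumes S: "quantum_setting k S" "finite I"
    and e: "e (fst J) \<in> ell2 (q_sys S)" "e' (fst J') \<in> ell2 (q_sys S)"
      "l2inner (q_sys S) (e (fst J)) (e' (fst J')) = 0"
    and J: "J \<in> q_comp S I" "J' \<in> q_comp S I"
  shows "l2inner (q_comp S I) (comp_vec S I e J) (comp_vec S I e' J') = 0"
proof -
  note b = parseval_basisD(1)[OF spectral_mixtureD(1)[OF bath_spectral_mixture[OF S]]]
  have "snd J \<in> (\<Pi>\<^sub>E i\<in>I. q_res S i)" "snd J' \<in> (\<Pi>\<^sub>E i\<in>I. q_res S i)"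
    using J by (auto simp: q_comp_def)
  then have "l2inner (q_comp S I) (comp_vec S I e J) (comp_vec S I e' J') =
      l2inner (q_sys S) (e (fst J)) (e' (fst J')) *
      l2inner (\<Pi>\<^sub>E i\<in>I. q_res S i) (bath_vec S I (snd J)) (bath_vec S I (snd J'))"
    by (intro l2inner_product_vectors[OF bij_betw_q_comp] e b) (auto simp: comp_vec_def bath_vec_def q_comp_def)
  then show ?thesis using e(3) by simp
qed

lemma comp_weight_exp:
  assumes S: "quantum_setting k S" and p: "p (fst J) > 0"
  shows "comp_weight k S I p J = exp (ln (p (fst J)) + (\<Sum>i\<in>I. - res_energy S i (snd J i) / (k * q_temp S i)
    - ln (quantum_partition_function k (q_res S i) (q_temp S i) (q_res_ham S i))))"
proof (cases "finite I")
  case True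
  then show ?thesis
    using p res_spectral_mixture(2)[OF S]
    by (simp add: comp_weight_def exp_add exp_sum exp_diff res_weight_def)
next
  case False
  then show ?thesis using p by (simp add: comp_weight_def)
qed

text \<open>The states enter through chosen eigendecompositions; \<open>sa n\<close> and
  \<open>sb\<close> are minus the entropies divided by \<open>k\<close>, so each exponent is minus
  the mean of W.\<close>

lemma quantum_dissipation_bound:
  assumes k: "k > 0" and S: "quantum_setting k S" and M: "quantum_manipulation hbar S M"
    and N: "finite N"
    and a: "\<And>n. n \<in> N \<Longrightarrow> spectral_mixture (q_sys S) (e n) (p n) (fst (a n))"
    and b: "spectral_mixture (q_sys S) f q (fst b)"
    and sa: "\<And>n. n \<in> N \<Longrightarrow> ((\<lambda>j. p n j * ln (p n j)) has_sum sa n) (q_sys S)"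
    and sb: "((\<lambda>j. q j * ln (q j)) has_sum sb) (q_sys S)"
    and dist: "\<And>m n. m \<in> N \<Longrightarrow> n \<in> N \<Longrightarrow> m \<noteq> n \<Longrightarrow> quantum_distinguishable S (a m) (a n)"
    and takes: "\<And>n. n \<in> N \<Longrightarrow> quantum_takes k S M (a n) b"
    and en: "\<And>n. n \<in> N \<Longrightarrow> quantum_energies_finite k S M (a n)"
  shows "(\<Sum>n\<in>N. exp (quantum_sigma k S M (a n) / k - sa n + sb)) \<le> 1"
proof -
  define I where "I = qm_res M"
  define Z where "Z = q_comp S I"
  define U where "U = qm_evol M (qm_end M)"
  define U0 where "U0 = qm_evol M (qm_start M)"
  define T where "T n = transition S I U (e n) f" for n
  define g where "g = comp_weight k S I q"
  \<comment> \<open>Reference weight times transition probability, restricted to initial labels in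
    the support of \<open>a n\<close>: the majorant for Jensen's inequality.\<close>
  define h where "h n J K = (if p n (fst J) > 0 then g K * T n J K else 0)" for n J K
  have I: "finite I" and U: "unitary_operator (q_comp S I) U" and U0: "unitary_operator (q_comp S I) U0"
    and id: "\<And>\<psi>. \<psi> \<in> ell2 (q_comp S I) \<Longrightarrow> U0 \<psi> = \<psi>"
    using M by (auto simp: quantum_manipulation_def unitary_evolution_def I_def U_def U0_def)
  have T0: "T n J K \<ge> 0" for n J K by (simp add: T_def transition_nonneg)
  note fsp = comp_spectral_mixture[OF S I b]
  have g: "g K \<ge> 0" if "K \<in> Z" for K
    using spectral_mixtureD(2)[OF fsp] that by (simp add: g_def Z_def)
  have gsum: "(g has_sum 1) Z"
    using spectral_mixtureD(3)[OF fsp] by (simp add: g_def Z_def)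
  have init: "qm_initial k S M c = comp_density k S I (fst c)" for c
    by (intro ext) (simp add: qm_initial_def comp_density_def I_def)

  \<comment> \<open>The squared norm of the projection of the reference vector \<open>K\<close> onto
    the evolved support of \<open>a n\<close> with its reservoirs. It plays the part of the
    classical indicator of a support.\<close>
  define t where "t n K = (\<Sum>\<^sub>\<infinity>J\<in>Z. if p n (fst J) > 0 then T n J K else 0)" for n K
  have V: "parseval_basis Z (\<lambda>J. U (comp_vec S I (e n) J))" if "n \<in> N" for n
    unfolding Z_def
    by (rule spectral_mixtureD(1)[OF spectral_mixture_conjugate[OF U comp_spectral_mixture[OF S I a[OF that]]]])
  have F: "comp_vec S I f K \<in> ell2 Z" "l2sq Z (comp_vec S I f K) = 1" if "K \<in> Z" for K
    using spectral_mixtureD(1)[OF fsp] that unfolding Z_def by (auto intro: parseval_basisD parseval_l2sq)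
  have T_alt: "T n J K = (cmod (l2inner Z (U (comp_vec S I (e n) J)) (comp_vec S I f K)))\<^sup>2" for n J K
    unfolding T_def transition_def Z_def by (metis complex_mod_cnj l2inner_cnj)
  have t: "((\<lambda>J. if p n (fst J) > 0 then T n J K else 0) has_sum t n K) Z" if n: "n \<in> N" and K: "K \<in> Z" for n K
  proof -
    have "(\<lambda>J. T n J K) summable_on Z"
      unfolding T_alt using parseval_basisD(3)[OF V[OF n] F(1)[OF K]] by (rule has_sum_imp_summable)
    then have "(\<lambda>J. if p n (fst J) > 0 then T n J K else 0) summable_on Z"
      by (rule summable_on_comparison_test) (auto simp: T0)
    then show ?thesis by (simp add: t_def)
  qed
  have t_nonneg: "t n K \<ge> 0" for n K
    unfolding t_def by (rule infsum_nonneg) (simp add: T0)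
  \<comment> \<open>The pairs (state, label in its support) index one orthonormal family: inside a
    state by unitarity, across states by distinguishability.\<close>
  have orth: "l2inner Z (U (comp_vec S I (e m) J)) (U (comp_vec S I (e n) J')) = (if (m, J) = (n, J') then 1 else 0)"
    if mn: "m \<in> N" "n \<in> N" and J: "J \<in> Z" "J' \<in> Z" and pos: "p m (fst J) > 0" "p n (fst J') > 0" for m n J J'
  proof (cases "m = n")
    case True
    then show ?thesis using parseval_basisD(2)[OF V[OF mn(1)] J] by simp
  next
    case False
    have fJ: "fst J \<in> q_sys S" "fst J' \<in> q_sys S"
      using J by (auto simp: Z_def q_comp_def)
    have "l2inner (q_sys S) (e m (fst J)) (e n (fst J')) = 0"
      using dist[OF mn False] fJ pos
      by (intro orthogonal_mixtures[OF a[OF mn(1)] a[OF mn(2)]]) (auto simp: quantum_distinguishable_def)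
    then have "l2inner Z (comp_vec S I (e m) J) (comp_vec S I (e n) J') = 0"
      unfolding Z_def
      using parseval_basisD(1)[OF spectral_mixtureD(1)[OF a]] mn fJ J
      by (intro comp_vec_orthogonal[OF S I]) (auto simp: Z_def)
    moreover have "comp_vec S I (e m) J \<in> ell2 Z" "comp_vec S I (e n) J' \<in> ell2 Z"
      using parseval_basisD(1)[OF spectral_mixtureD(1)[OF comp_spectral_mixture[OF S I a]]] mn J
      by (auto simp: Z_def)
    ultimately show ?thesis
      using False unitary_operatorD(2)[OF U, folded Z_def] by simp
  qed
  have t1: "(\<Sum>n\<in>N. t n K) \<le> 1" if K: "K \<in> Z" for K
  proof (rule has_sum_le_finite_sums)
    show "((\<lambda>J. \<Sum>n\<in>N. if p n (fst J) > 0 then T n J K else 0) has_sum (\<Sum>n\<in>N. t n K)) Z"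
      using t K by (intro has_sum_sum)
    fix G assume G: "finite G" "G \<subseteq> Z"
    \<comment> \<open>A finite piece of that family. Bessel's inequality for the unit vector
      \<open>K\<close> bounds the projections onto all evolved supports together by 1.\<close>
    define A where "A = (SIGMA n:N. {J\<in>G. p n (fst J) > 0})"
    have A: "finite A" using N G by (simp add: A_def)
    have "(\<Sum>J\<in>G. \<Sum>n\<in>N. if p n (fst J) > 0 then T n J K else 0) =
        (\<Sum>n\<in>N. \<Sum>J\<in>{J\<in>G. p n (fst J) > 0}. T n J K)"
      by (subst sum.swap) (simp only: sum.inter_filter[OF G(1)])
    also have "\<dots> = (\<Sum>(n, J)\<in>A. T n J K)"
      unfolding A_def using N G by (subst sum.Sigma) auto
    also have "\<dots> = (\<Sum>r\<in>A. (cmod (l2inner Z (case r of (n, J) \<Rightarrow> U (comp_vec S I (e n) J)) (comp_vec S I f K)))\<^sup>2)"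
      by (simp add: T_alt case_prod_unfold)
    also have "\<dots> \<le> l2sq Z (comp_vec S I f K)"
    proof (rule bessel[OF A _ _ F(1)[OF K]])
      show "(case r of (n, J) \<Rightarrow> U (comp_vec S I (e n) J)) \<in> ell2 Z" if "r \<in> A" for r
        using that G parseval_basisD(1)[OF V] by (auto simp: A_def)
      show "l2inner Z (case r of (n, J) \<Rightarrow> U (comp_vec S I (e n) J)) (case r' of (n, J) \<Rightarrow> U (comp_vec S I (e n) J)) =
          (if r = r' then 1 else 0)" if "r \<in> A" "r' \<in> A" for r r'
      proof -
        obtain m J n J' where r: "r = (m, J)" "r' = (n, J')" by (meson surj_pair)
        show ?thesis
          using that orth[of m n J J'] subsetD[OF G(2), of J] subsetD[OF G(2), of J'] unfolding r A_def by auto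
      qed
    qed
    finally show "(\<Sum>J\<in>G. \<Sum>n\<in>N. if p n (fst J) > 0 then T n J K else 0) \<le> 1"
      using F(2)[OF K] by simp
  qed

  define x where "x n = (\<Sum>\<^sub>\<infinity>K\<in>Z. g K * t n K)" for n
  have x: "((\<lambda>K. g K * t n K) has_sum x n) Z" if n: "n \<in> N" for n
  proof -
    have le: "t n K \<le> 1" if "K \<in> Z" for K
      using member_le_sum[of n N "\<lambda>n. t n K"] t1[OF that] n N t_nonneg by simp
    have "(\<lambda>K. g K * t n K) summable_on Z"
      using has_sum_imp_summable[OF gsum]
      by (rule summable_on_comparison_test) (simp_all add: g t_nonneg mult_left_le le)
    then show ?thesis by (simp add: x_def)
  qed
  have hx: "((\<lambda>(J, K). h n J K) has_sum x n) (Z \<times> Z)" if n: "n \<in> N" for n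
  proof -
    have "((\<lambda>(K, J). h n J K) has_sum x n) (Z \<times> Z)"
    proof (rule has_sum_SigmaI_nonneg[OF _ x[OF n]])
      fix K assume K: "K \<in> Z"
      show "((\<lambda>J. case (K, J) of (K, J) \<Rightarrow> h n J K) has_sum g K * t n K) Z"
        using has_sum_cmult_right[OF t[OF n K], of "g K"]
        by (rule has_sum_cong[THEN iffD1, rotated]) (simp add: h_def)
    qed (simp add: h_def g T0)
    then show ?thesis by (subst has_sum_swap) simp
  qed

  have main: "exp (quantum_sigma k S M (a n) / k - sa n + sb) \<le> x n" if n: "n \<in> N" for n
  proof -
    let ?P = "\<lambda>J K. comp_weight k S I (p n) J * T n J K"
    \<comment> \<open>the logarithm of \<open>comp_weight k S I (p n) J / g K\<close>, in which the partition functions cancel\<close>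
    define W where "W = (\<lambda>(J, K). ln (p n (fst J)) - ln (q (fst K))
      + (\<Sum>i\<in>I. (res_energy S i (snd K i) - res_energy S i (snd J i)) / (k * q_temp S i)))"
    define E where "E i \<tau> = expectation (q_res S i) (q_res_ham S i) (qm_marginal_res k S M (a n) i \<tau>)" for i \<tau>
    have marg: "qm_marginal_res k S M (a n) i \<tau> v v' =
        (\<Sum>\<^sub>\<infinity>(x0, y)\<in>q_comp S (I - {i}). conjugate_by (q_comp S I) (qm_evol M \<tau>) (comp_density k S I (fst (a n)))
          (x0, y(i := v)) (x0, y(i := v')))" for i \<tau> v v'
      by (simp add: qm_marginal_res_def qm_state_at_def init I_def)
    have en: "((\<lambda>v. Re (l2inner (q_res S i) (res_vec S i v) (mat_app (q_res S i) (qm_marginal_res k S M (a n) i \<tau>) (res_vec S i v)))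
        * res_energy S i v) has_sum E i \<tau>) (q_res S i)" if "i \<in> I" "\<tau> \<in> {qm_start M, qm_end M}" for i \<tau>
      using en[OF n] that
      by (auto simp add: quantum_energies_finite_def expectation_finite_def expectation_def E_def case_prod_unfold
          res_vec_def res_energy_def I_def Let_def mult.commute)
    have "((\<lambda>(J, K). ?P J K * ln (p n (fst J))) has_sum sa n) (Z \<times> Z)"
      unfolding Z_def T_def using joint_sys_initial[OF S I U a[OF n] b sa[OF n]] .
    moreover have "((\<lambda>(J, K). ?P J K * ln (q (fst K))) has_sum sb) (Z \<times> Z)"
      and zero: "J \<in> Z \<Longrightarrow> K \<in> Z \<Longrightarrow> q (fst K) = 0 \<Longrightarrow> ?P J K = 0" for J K
    proof -
      let ?m = "qm_marginal_sys k S M (a n) (qm_end M)"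
      have m: "?m x x' = (\<Sum>\<^sub>\<infinity>y\<in>(\<Pi>\<^sub>E i\<in>I. q_res S i). conjugate_by (q_comp S I) U (comp_density k S I (fst (a n))) (x, y) (x', y))"
        for x x'
        by (simp add: qm_marginal_sys_def qm_state_at_def init I_def U_def)
      have q: "Re (l2inner (q_sys S) (f v) (mat_app (q_sys S) ?m (f v))) = q v" if v: "v \<in> q_sys S" for v
      proof -
        have "mat_app (q_sys S) ?m (f v) = mat_app (q_sys S) (fst b) (f v)"
          using takes[OF n] by (auto simp: mat_app_def quantum_takes_def intro!: ext infsum_cong)
        moreover have "f v \<in> ell2 (q_sys S)"
          using parseval_basisD(1)[OF spectral_mixtureD(1)[OF b] v] .
        ultimately show ?thesis
          using parseval_basisD(2)[OF spectral_mixtureD(1)[OF b] v v] spectral_mixture_eigen_right[OF b v] by simp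
      qed
      have "((\<lambda>v. Re (l2inner (q_sys S) (f v) (mat_app (q_sys S) ?m (f v))) * ln (q v)) has_sum sb) (q_sys S)"
        using sb by (rule has_sum_cong[THEN iffD1, rotated]) (simp add: q)
      from joint_sys_final[OF S I U a[OF n] b m this]
      show "((\<lambda>(J, K). ?P J K * ln (q (fst K))) has_sum sb) (Z \<times> Z)"
        unfolding Z_def T_def .
      assume JK: "J \<in> Z" "K \<in> Z" "q (fst K) = 0"
      then have K: "fst K \<in> q_sys S" "snd K \<in> (\<Pi>\<^sub>E i\<in>I. q_res S i)"
        by (auto simp: Z_def q_comp_def)
      \<comment> \<open>All joint weights over the final label \<open>fst K\<close> are nonnegative
        and sum to \<open>q (fst K) = 0\<close>, so each vanishes. This settles the pairs for which
        \<open>ln (q (fst K))\<close> says nothing.\<close>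
      have "((\<lambda>(J, y). ?P J (fst K, y)) has_sum q (fst K)) (Z \<times> (\<Pi>\<^sub>E i\<in>I. q_res S i))"
        using joint_sys_final_fibre[OF S I U a[OF n] b m K(1)] q[OF K(1)] unfolding Z_def T_def by simp
      from nonneg_has_sum_le_0D[OF this, of "(J, snd K)"] show "?P J K = 0"
        using JK K joint_nonneg[OF S I U a[OF n] b] by (auto simp: Z_def T_def)
    qed
    moreover have "((\<lambda>(J, K). ?P J K * res_energy S i (snd K i)) has_sum E i (qm_end M)) (Z \<times> Z)" if "i \<in> I" for i
      unfolding Z_def T_def
      using joint_res_final[OF S I U a[OF n] b that marg[of _ "qm_end M", folded U_def] en[OF that]] by simp
    moreover have "((\<lambda>(J, K). ?P J K * res_energy S i (snd J i)) has_sum E i (qm_start M)) (Z \<times> Z)" if i: "i \<in> I" for i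
      unfolding Z_def T_def
    proof (rule joint_res_initial[OF S I U a[OF n] b i])
      show "((\<lambda>v. res_weight k S i v * res_energy S i v) has_sum E i (qm_start M)) (q_res S i)"
        using en[OF i, of "qm_start M"]
        by (rule has_sum_cong[THEN iffD1, rotated, OF _ ])
          (simp_all add: initial_res_expectation[OF S I U0 a[OF n] id i _ marg[of _ "qm_start M", folded U0_def]])
    qed
    ultimately have "((\<lambda>r. (\<lambda>(J, K). ?P J K * ln (p n (fst J))) r - (\<lambda>(J, K). ?P J K * ln (q (fst K))) r
       + (\<Sum>i\<in>I. ((\<lambda>(J, K). ?P J K * res_energy S i (snd K i)) r - (\<lambda>(J, K). ?P J K * res_energy S i (snd J i)) r)
          * (1 / (k * q_temp S i)))) has_sum
       (sa n - sb + (\<Sum>i\<in>I. (E i (qm_end M) - E i (qm_start M)) * (1 / (k * q_temp S i))))) (Z \<times> Z)"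
      by (intro has_sum_add has_sum_diff has_sum_sum has_sum_cmult_left) auto
    also have "sa n - sb + (\<Sum>i\<in>I. (E i (qm_end M) - E i (qm_start M)) * (1 / (k * q_temp S i))) =
        - (quantum_sigma k S M (a n) / k - sa n + sb)"
    proof -
      have "(\<Sum>i\<in>I. (E i (qm_end M) - E i (qm_start M)) * (1 / (k * q_temp S i))) = - (quantum_sigma k S M (a n) / k)"
        unfolding quantum_sigma_def sum_divide_distrib sum_negf[symmetric] I_def
        by (rule sum.cong) (simp_all add: quantum_heat_def E_def mult.commute del: minus_diff_eq)
      then show ?thesis by simp
    qed
    finally have PW: "((\<lambda>r. (\<lambda>(J, K). ?P J K) r * W r) has_sum - (quantum_sigma k S M (a n) / k - sa n + sb)) (Z \<times> Z)"
      by (rule has_sum_cong[THEN iffD1, rotated])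
        (auto simp: W_def algebra_simps sum_distrib_left diff_divide_distrib sum_subtractf)
    have "exp (- (- (quantum_sigma k S M (a n) / k - sa n + sb))) \<le> x n"
    proof (rule exp_jensen_has_sum[OF _ PW hx[OF n]])
      show "((\<lambda>(J, K). ?P J K) has_sum 1) (Z \<times> Z)"
        unfolding Z_def T_def by (rule joint_total[OF S I U a[OF n] b])
      fix r assume "r \<in> Z \<times> Z"
      then obtain J K where r: "r = (J, K)" and JK: "J \<in> Z" "K \<in> Z" by auto
      show "(\<lambda>(J, K). ?P J K) r \<ge> 0"
        using joint_nonneg[OF S I U a[OF n] b] JK by (simp add: r Z_def T_def)
      show "(\<lambda>(J, K). ?P J K) r * exp (- W r) \<le> (\<lambda>(J, K). h n J K) r"
      \<comment> \<open>Where both weights are positive the two sides agree; on all other pairs the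
        left side is 0.\<close>
      proof (cases "p n (fst J) > 0 \<and> q (fst K) > 0")
        case True
        have "comp_weight k S I (p n) J * exp (- W r) = g K"
          unfolding g_def comp_weight_exp[where p = "p n", OF S True[THEN conjunct1]]
            comp_weight_exp[where p = q, OF S True[THEN conjunct2]]
            exp_add[symmetric]
          by (simp add: W_def r sum_subtractf diff_divide_distrib sum_negf)
        then show ?thesis
          using True by (simp add: r h_def mult.commute mult.left_commute)
      next
        case False
        have "p n (fst J) \<ge> 0" "q (fst K) \<ge> 0"
          using spectral_mixtureD(2)[OF a[OF n]] spectral_mixtureD(2)[OF b] JK by (auto simp: Z_def q_comp_def)
        with False have "p n (fst J) = 0 \<or> q (fst K) = 0" by auto
        then have "?P J K = 0"
          using zero[OF JK] by (auto simp: comp_weight_def)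
        then show ?thesis
          using mult_nonneg_nonneg[OF g[OF JK(2)] T0[of n J K]] by (auto simp: r h_def)
      qed
    qed
    then show ?thesis by (simp only: minus_minus)
  qed

  have "(\<Sum>n\<in>N. exp (quantum_sigma k S M (a n) / k - sa n + sb)) \<le> (\<Sum>n\<in>N. x n)"
    by (rule sum_mono) (rule main)
  also have "\<dots> \<le> 1"
  proof (rule has_sum_mono[OF has_sum_sum gsum])
    show "((\<lambda>K. g K * t n K) has_sum x n) Z" if "n \<in> N" for n
      by (rule x[OF that])
    show "(\<Sum>n\<in>N. g K * t n K) \<le> g K" if "K \<in> Z" for K
      using mult_left_mono[OF t1[OF that] g[OF that]] by (simp add: sum_distrib_left)
  qed
  finally show ?thesis .
qed

section \<open>Dissipation\<close>

text \<open>Dissipation contains a supremum over reverse manipulations. Any uniform bound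
  \<open>s n\<close> on it turns minus the dissipation into at most
  \<open>s n + sig M (a n)\<close>, and excludes the value \<open>\<infinity>\<close> of the
  supremum.\<close>

lemma sum_exp_dissipation_le_1:
  assumes k: "k > 0"
    and rev: "\<And>n M'. n \<in> N \<Longrightarrow> M' \<in> MM \<Longrightarrow> takes M' b (a n) \<Longrightarrow> sig M' b \<le> s n"
    and fwd: "(\<Sum>n\<in>N. exp ((s n + sig M (a n)) / k)) \<le> 1"
  shows "(\<Sum>n\<in>N. exp_ereal (- dissipation takes sig MM M (a n) b / ereal k)) \<le> 1"
proof -
  have "exp_ereal (- dissipation takes sig MM M (a n) b / ereal k) \<le> ereal (exp ((s n + sig M (a n)) / k))"
    if n: "n \<in> N" for n
  proof -
    have le: "max_sigma takes sig MM b (a n) \<le> ereal (s n)"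
      unfolding max_sigma_def using rev[OF n] by (intro SUP_least) auto
    show ?thesis
    proof (cases "max_sigma takes sig MM b (a n)")
      case (real r)
      have "(r + sig M (a n)) / k \<le> (s n + sig M (a n)) / k"
        using le real k by (intro divide_right_mono) auto
      then show ?thesis
        using k by (simp add: dissipation_def real exp_ereal_def add.commute)
    next
      \<comment> \<open>No manipulation leads back: the dissipation is infinite and its term is
        0.\<close>
      case MInf
      then show ?thesis
        using k by (simp add: dissipation_def exp_ereal_def divide_ereal_def)
    qed (use le in auto)
  qed
  then have "(\<Sum>n\<in>N. exp_ereal (- dissipation takes sig MM M (a n) b / ereal k)) \<le>
      (\<Sum>n\<in>N. ereal (exp ((s n + sig M (a n)) / k)))"
    by (rule sum_mono)
  also have "\<dots> \<le> 1"
    using fwd by (simp add: sum_ereal)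
  finally show ?thesis .
qed

lemma classical_sum_exp_dissipation_le_1:
  assumes k: "k > 0" and S: "classical_setting k S"
    and man: "\<And>M. M \<in> MM \<Longrightarrow> classical_manipulation S M" and M: "M \<in> MM" and N: "finite N"
    and a: "\<And>n. n \<in> N \<Longrightarrow> classical_state S (a n)" and b: "classical_state S b"
    and dist: "\<And>m n. m \<in> N \<Longrightarrow> n \<in> N \<Longrightarrow> m \<noteq> n \<Longrightarrow> classical_distinguishable S (a m) (a n)"
    and takes: "\<And>n. n \<in> N \<Longrightarrow> classical_takes k S M (a n) b"
    and sa: "\<And>n. n \<in> N \<Longrightarrow> classical_entropy_finite S (a n)" and sb: "classical_entropy_finite S b"
    and en: "\<And>n. n \<in> N \<Longrightarrow> classical_energies_finite k S M (a n)"
    and rev: "\<And>n M'. n \<in> N \<Longrightarrow> M' \<in> MM \<Longrightarrow> classical_takes k S M' b (a n) \<Longrightarrow>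
      classical_energies_finite k S M' b"
  shows "(\<Sum>n\<in>N. exp_ereal (- dissipation (classical_takes k S) (classical_sigma k S) MM M (a n) b / ereal k)) \<le> 1"
proof (rule sum_exp_dissipation_le_1[OF k])
  define L where "L c = (\<integral>x. fst c x * ln (fst c x) \<partial>liouville (c_sys S))" for c :: "'a cstate"
  \<comment> \<open>As \<open>L\<close> is minus the entropy over \<open>k\<close>, this is the
    entropy of \<open>a n\<close> minus that of \<open>b\<close>.\<close>
  let ?s = "\<lambda>n. k * (L b - L (a n))"
  have "(\<Sum>n\<in>N. exp (classical_sigma k S M (a n) / k - L (a n) + L b)) \<le> 1"
    using classical_dissipation_bound[OF k S man[OF M] N a b dist takes sa sb en] by (simp add: L_def)
  then show "(\<Sum>n\<in>N. exp ((?s n + classical_sigma k S M (a n)) / k)) \<le> 1"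
    using k by (simp add: add_divide_distrib add_diff_eq diff_add_eq add.commute)
  show "classical_sigma k S M' b \<le> ?s n"
    if n: "n \<in> N" and M': "M' \<in> MM" and t: "classical_takes k S M' b (a n)" for n M'
  proof -
    \<comment> \<open>The bound with the roles exchanged, for the single run from \<open>b\<close>
      to \<open>a n\<close>: one exponential is at most 1, so its exponent is at most 0.\<close>
    have "classical_sigma k S M' b / k - L b + L (a n) \<le> 0"
      using classical_dissipation_bound[OF k S man[OF M'], of "{()}" "\<lambda>_. b" "a n"]
        b a[OF n] t sb sa[OF n] rev[OF n M' t] by (simp add: L_def)
    then show ?thesis
      using k by (simp add: field_simps)
  qed
qed

lemma quantum_sum_exp_dissipation_le_1:
  assumes k: "k > 0" and S: "quantum_setting k S"
    and man: "\<And>M. M \<in> MM \<Longrightarrow> quantum_manipulation hbar S M" and M: "M \<in> MM" and N: "finite N"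
    and a: "\<And>n. n \<in> N \<Longrightarrow> quantum_state S (a n)" and b: "quantum_state S b"
    and dist: "\<And>m n. m \<in> N \<Longrightarrow> n \<in> N \<Longrightarrow> m \<noteq> n \<Longrightarrow> quantum_distinguishable S (a m) (a n)"
    and takes: "\<And>n. n \<in> N \<Longrightarrow> quantum_takes k S M (a n) b"
    and sa: "\<And>n. n \<in> N \<Longrightarrow> quantum_entropy_finite S (a n)" and sb: "quantum_entropy_finite S b"
    and en: "\<And>n. n \<in> N \<Longrightarrow> quantum_energies_finite k S M (a n)"
    and rev: "\<And>n M'. n \<in> N \<Longrightarrow> M' \<in> MM \<Longrightarrow> quantum_takes k S M' b (a n) \<Longrightarrow>
      quantum_energies_finite k S M' b"
  shows "(\<Sum>n\<in>N. exp_ereal (- dissipation (quantum_takes k S) (quantum_sigma k S) MM M (a n) b / ereal k)) \<le> 1"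
proof -
  \<comment> \<open>The eigenbasis of the density operator is supplied by the hypothesis of finite
    entropy.\<close>
  have spectrum: "\<exists>e p L. spectral_mixture (q_sys S) e p (fst c) \<and> ((\<lambda>j. p j * ln (p j)) has_sum L) (q_sys S)"
    if "quantum_state S c" "quantum_entropy_finite S c" for c
    using that density_operator_spectral_mixture
    unfolding quantum_state_def quantum_entropy_finite_def summable_on_def by blast
  obtain f q Lb where b': "spectral_mixture (q_sys S) f q (fst b)" "((\<lambda>j. q j * ln (q j)) has_sum Lb) (q_sys S)"
    using spectrum[OF b sb] by blast
  have "\<forall>n\<in>N. \<exists>e p L. spectral_mixture (q_sys S) e p (fst (a n)) \<and> ((\<lambda>j. p j * ln (p j)) has_sum L) (q_sys S)"
    using spectrum[OF a sa] by blast
  then obtain e p L where a': "\<And>n. n \<in> N \<Longrightarrow> spectral_mixture (q_sys S) (e n) (p n) (fst (a n))"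
    "\<And>n. n \<in> N \<Longrightarrow> ((\<lambda>j. p n j * ln (p n j)) has_sum L n) (q_sys S)"
    by metis
  let ?s = "\<lambda>n. k * (Lb - L n)"
  show ?thesis
  proof (rule sum_exp_dissipation_le_1[OF k])
    have "(\<Sum>n\<in>N. exp (quantum_sigma k S M (a n) / k - L n + Lb)) \<le> 1"
      using quantum_dissipation_bound[OF k S man[OF M] N a'(1) b'(1) a'(2) b'(2) dist takes en] .
    then show "(\<Sum>n\<in>N. exp ((?s n + quantum_sigma k S M (a n)) / k)) \<le> 1"
      using k by (simp add: add_divide_distrib add_diff_eq diff_add_eq add.commute)
    show "quantum_sigma k S M' b \<le> ?s n"
      if n: "n \<in> N" and M': "M' \<in> MM" and t: "quantum_takes k S M' b (a n)" for n M'
    proof -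
      have "quantum_sigma k S M' b / k - Lb + L n \<le> 0"
        using quantum_dissipation_bound[OF k S man[OF M'], of "{()}" "\<lambda>_. f" "\<lambda>_. q" "\<lambda>_. b" "e n" "p n" "a n"
            "\<lambda>_. Lb" "L n"] b' a'[OF n] t rev[OF n M' t] by simp
      then show ?thesis
        using k by (simp add: field_simps)
    qed
  qed
qed

theorem corollary2p2:
  fixes k hbar :: real and n :: nat
    and CS :: "('a, 'i, 'b) classical_setting"
    and CC :: "('a, 'i, 'b) cmanipulation set" and CM :: "('a, 'i, 'b) cmanipulation"
    and ca :: "nat \<Rightarrow> 'a cstate" and cb :: "'a cstate"
    and QS :: "('c, 'j, 'd) quantum_setting"
    and QC :: "('c, 'j, 'd) qmanipulation set" and QM :: "('c, 'j, 'd) qmanipulation"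
    and qa :: "nat \<Rightarrow> 'c qstate" and qb :: "'c qstate"
  assumes "k > 0" and "hbar > 0"
  shows
    "(classical_setting k CS \<longrightarrow>
      (\<forall>M\<in>CC. classical_manipulation CS M) \<longrightarrow> CM \<in> CC \<longrightarrow>
      (\<forall>i\<in>{1..n}. classical_state CS (ca i)) \<longrightarrow> classical_state CS cb \<longrightarrow>
      (\<forall>i\<in>{1..n}. \<forall>j\<in>{1..n}. i \<noteq> j \<longrightarrow> classical_distinguishable CS (ca i) (ca j)) \<longrightarrow>
      (\<forall>i\<in>{1..n}. classical_takes k CS CM (ca i) cb) \<longrightarrow>
      (\<forall>i\<in>{1..n}. classical_entropy_finite CS (ca i)) \<longrightarrow> classical_entropy_finite CS cb \<longrightarrow>
      (\<forall>i\<in>{1..n}. classical_energies_finite k CS CM (ca i)) \<longrightarrow>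
      (\<forall>i\<in>{1..n}. \<forall>M\<in>CC. classical_takes k CS M cb (ca i) \<longrightarrow>
                            classical_energies_finite k CS M cb) \<longrightarrow>
      (\<Sum>i=1..n. exp_ereal (- dissipation (classical_takes k CS) (classical_sigma k CS)
                                 CC CM (ca i) cb / ereal k)) \<le> 1)
     \<and>
     (quantum_setting k QS \<longrightarrow>
      (\<forall>M\<in>QC. quantum_manipulation hbar QS M) \<longrightarrow> QM \<in> QC \<longrightarrow>
      (\<forall>i\<in>{1..n}. quantum_state QS (qa i)) \<longrightarrow> quantum_state QS qb \<longrightarrow>
      (\<forall>i\<in>{1..n}. \<forall>j\<in>{1..n}. i \<noteq> j \<longrightarrow> quantum_distinguishable QS (qa i) (qa j)) \<longrightarrow>
      (\<forall>i\<in>{1..n}. quantum_takes k QS QM (qa i) qb) \<longrightarrow>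
      (\<forall>i\<in>{1..n}. quantum_entropy_finite QS (qa i)) \<longrightarrow> quantum_entropy_finite QS qb \<longrightarrow>
      (\<forall>i\<in>{1..n}. quantum_energies_finite k QS QM (qa i)) \<longrightarrow>
      (\<forall>i\<in>{1..n}. \<forall>M\<in>QC. quantum_takes k QS M qb (qa i) \<longrightarrow>
                            quantum_energies_finite k QS M qb) \<longrightarrow>
      (\<Sum>i=1..n. exp_ereal (- dissipation (quantum_takes k QS) (quantum_sigma k QS)
                                 QC QM (qa i) qb / ereal k)) \<le> 1)"
proof (intro conjI impI)
  show "(\<Sum>i=1..n. exp_ereal (- dissipation (classical_takes k CS) (classical_sigma k CS)
      CC CM (ca i) cb / ereal k)) \<le> 1"
    if "classical_setting k CS" "\<forall>M\<in>CC. classical_manipulation CS M" "CM \<in> CC"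
      "\<forall>i\<in>{1..n}. classical_state CS (ca i)" "classical_state CS cb"
      "\<forall>i\<in>{1..n}. \<forall>j\<in>{1..n}. i \<noteq> j \<longrightarrow> classical_distinguishable CS (ca i) (ca j)"
      "\<forall>i\<in>{1..n}. classical_takes k CS CM (ca i) cb"
      "\<forall>i\<in>{1..n}. classical_entropy_finite CS (ca i)" "classical_entropy_finite CS cb"
      "\<forall>i\<in>{1..n}. classical_energies_finite k CS CM (ca i)"
      "\<forall>i\<in>{1..n}. \<forall>M\<in>CC. classical_takes k CS M cb (ca i) \<longrightarrow> classical_energies_finite k CS M cb"
    using that by (intro classical_sum_exp_dissipation_le_1[OF \<open>k > 0\<close>]) simp_all
  show "(\<Sum>i=1..n. exp_ereal (- dissipation (quantum_takes k QS) (quantum_sigma k QS)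
      QC QM (qa i) qb / ereal k)) \<le> 1"
    if "quantum_setting k QS" "\<forall>M\<in>QC. quantum_manipulation hbar QS M" "QM \<in> QC"
      "\<forall>i\<in>{1..n}. quantum_state QS (qa i)" "quantum_state QS qb"
      "\<forall>i\<in>{1..n}. \<forall>j\<in>{1..n}. i \<noteq> j \<longrightarrow> quantum_distinguishable QS (qa i) (qa j)"
      "\<forall>i\<in>{1..n}. quantum_takes k QS QM (qa i) qb"
      "\<forall>i\<in>{1..n}. quantum_entropy_finite QS (qa i)" "quantum_entropy_finite QS qb"
      "\<forall>i\<in>{1..n}. quantum_energies_finite k QS QM (qa i)"
      "\<forall>i\<in>{1..n}. \<forall>M\<in>QC. quantum_takes k QS M qb (qa i) \<longrightarrow> quantum_energies_finite k QS M qb"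
    using that by (intro quantum_sum_exp_dissipation_le_1[OF \<open>k > 0\<close>, where hbar = hbar]) simp_all
qed

end
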